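(* Let $(M,g)$ be a Riemannian manifold and let $\gamma:[0,l]\to M$ be a geodesic loop in $(M,g)$ that is locally extremal and is not self-conjugate. Then $\gamma$ is a closed geodesic, i.e. $\dot{\gamma}(0)=\dot{\gamma}(l)$.
   Context: Let $(M,g)$ be a Riemannian manifold. A non-constant smooth curve $\gamma:[0,l]\to M$ (with $l>0$) is a geodesic loop if $\gamma|_{(0,l)}$ is a unit-speed geodesic of $(M,g)$ and $\gamma(0)=\gamma(l)$; its length is then $l$. A geodesic loop $\gamma:[0,l]\to M$ is a closed (or periodic) geodesic if in addition $\dot{\gamma}(0)=\dot{\gamma}(l)$ (one-sided derivatives at the endpoints). A geodesic loop $\gamma:[0,l]\to M$ is locally minimizing (resp. locally maximizing) if there is a neighborhood $W$ of $(\gamma(0),\dot{\gamma}(0))$ in $TM$ (with $TM$ endowed with, say, the Sasaki metric associated to $g$) such that $\mathrm{length}(\gamma)\le \mathrm{length}(\gamma')$ (resp. $\mathrm{length}(\gamma)\ge \mathrm{length}(\gamma')$) for every geodesic loop $\gamma':[0,l']\to M$, with any $l'>0$, such that $(\gamma'(0),\dot{\gamma}'(0))\in W$. A geodesic loop is locally extremal if it is locally minimizing or locally maximizing. A geodesic loop $\gamma:[0,l]\to M$ is self-conjugate if $\gamma(0)$ and $\gamma(l)$ are conjugate to each other along $\gamma$ (i.e. there is a nontrivial Jacobi field along $\gamma$ vanishing at $0$ and at $l$). *)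

theory Defs
  imports "HOL-Analysis.Analysis"
begin

section \<open>Smooth maps\<close>

text \<open>
  \<open>Ck k S f\<close>: \<open>f\<close> is \<open>k\<close> times continuously differentiable on \<open>S\<close>, with derivatives taken
  within \<open>S\<close>. It is applied only to sets on which these derivatives are unique, namely open
  subsets of \<open>real^'n\<close> and relatively open subsets of nondegenerate intervals of \<open>real\<close> (where it
  means one-sided derivatives at the endpoints).
\<close>

primrec Ck :: "nat \<Rightarrow> 'v::real_normed_vector set \<Rightarrow> ('v \<Rightarrow> 'w::real_normed_vector) \<Rightarrow> bool" where
  "Ck 0 S f \<longleftrightarrow> continuous_on S f"
| "Ck (Suc k) S f \<longleftrightarrow>
     (\<exists>f'. (\<forall>x\<in>S. (f has_derivative f' x) (at x within S)) \<and> (\<forall>v. Ck k S (\<lambda>x. f' x v)))"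

definition smooth_on :: "'v::real_normed_vector set \<Rightarrow> ('v \<Rightarrow> 'w::real_normed_vector) \<Rightarrow> bool" where
  "smooth_on S f \<longleftrightarrow> (\<forall>k. Ck k S f)"

section \<open>Smooth manifolds and their tangent bundles\<close>

type_synonym ('a, 'n) chart = "'a set \<times> ('a \<Rightarrow> real^'n)"

abbreviation cdom :: "('a, 'n) chart \<Rightarrow> 'a set" where "cdom \<equiv> fst"
abbreviation cmap :: "('a, 'n) chart \<Rightarrow> 'a \<Rightarrow> real^'n" where "cmap \<equiv> snd"
abbreviation cimg :: "('a, 'n) chart \<Rightarrow> (real^'n) set" where "cimg c \<equiv> cmap c ` cdom c"
abbreviation cinv :: "('a, 'n) chart \<Rightarrow> real^'n \<Rightarrow> 'a" where "cinv c \<equiv> inv_into (cdom c) (cmap c)"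

text \<open>
  A tangent vector at \<open>p\<close> is the family of its components in all the charts around \<open>p\<close>; these
  components transform by the Jacobians of the transition maps.
\<close>

type_synonym ('a, 'n) tvec = "('a, 'n) chart \<Rightarrow> real^'n"

locale smooth_manifold =
  fixes X :: "'a topology" and \<A> :: "('a, 'n::finite) chart set"
  assumes Hausdorff: "Hausdorff_space X"
    and second_countable: "second_countable X"
    and chart_open: "c \<in> \<A> \<Longrightarrow> openin X (cdom c)"
    and chart_image_open: "c \<in> \<A> \<Longrightarrow> open (cimg c)"
    and chart_homeo: "c \<in> \<A> \<Longrightarrow>
      homeomorphic_map (subtopology X (cdom c)) (top_of_set (cimg c)) (cmap c)"
    and charts_cover: "(\<Union>c\<in>\<A>. cdom c) = topspace X"
    and transition_smooth: "c \<in> \<A> \<Longrightarrow> d \<in> \<A> \<Longrightarrow>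
      smooth_on (cmap c ` (cdom c \<inter> cdom d)) (cmap d \<circ> cinv c)"
begin

definition charts_at :: "'a \<Rightarrow> ('a, 'n) chart set" where
  "charts_at p = {c \<in> \<A>. p \<in> cdom c}"

definition tangent_space :: "'a \<Rightarrow> ('a, 'n) tvec set" where
  "tangent_space p = {v \<in> extensional (charts_at p).
     \<forall>c\<in>charts_at p. \<forall>d\<in>charts_at p.
       v d = frechet_derivative (cmap d \<circ> cinv c) (at (cmap c p)) (v c)}"

definition zero_tvec :: "'a \<Rightarrow> ('a, 'n) tvec" where
  "zero_tvec p = (\<lambda>c\<in>charts_at p. 0)"

definition add_tvec :: "'a \<Rightarrow> ('a, 'n) tvec \<Rightarrow> ('a, 'n) tvec \<Rightarrow> ('a, 'n) tvec" where
  "add_tvec p u v = (\<lambda>c\<in>charts_at p. u c + v c)"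

definition scale_tvec :: "'a \<Rightarrow> real \<Rightarrow> ('a, 'n) tvec \<Rightarrow> ('a, 'n) tvec" where
  "scale_tvec p r v = (\<lambda>c\<in>charts_at p. r *\<^sub>R v c)"

text \<open>The tangent vector at \<open>p\<close> whose component in the chart \<open>c\<close> around \<open>p\<close> is \<open>w\<close>.\<close>

definition tvec_of :: "('a, 'n) chart \<Rightarrow> 'a \<Rightarrow> real^'n \<Rightarrow> ('a, 'n) tvec" where
  "tvec_of c p w =
     (\<lambda>d\<in>charts_at p. frechet_derivative (cmap d \<circ> cinv c) (at (cmap c p)) w)"

definition tangent_bundle :: "('a \<times> ('a, 'n) tvec) set" where
  "tangent_bundle = (SIGMA p:topspace X. tangent_space p)"

text \<open>
  The manifold topology of the tangent bundle, which is the one induced by the Sasaki metric (or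
  by any other Riemannian metric on the bundle): a set is open iff it is open in each of the
  standard bundle charts, which identify the part of the bundle over \<open>cdom c\<close> with
  \<open>cimg c \<times> UNIV\<close>.
\<close>

definition tangent_bundle_topology :: "('a \<times> ('a, 'n) tvec) topology" where
  "tangent_bundle_topology = topology (\<lambda>W. W \<subseteq> tangent_bundle \<and>
     (\<forall>c\<in>\<A>. open {(x, w). x \<in> cimg c \<and> (cinv c x, tvec_of c (cinv c x) w) \<in> W}))"

lemma openin_tangent_bundle_topology:
  "openin tangent_bundle_topology W \<longleftrightarrow> W \<subseteq> tangent_bundle \<and>
     (\<forall>c\<in>\<A>. open {(x, w). x \<in> cimg c \<and> (cinv c x, tvec_of c (cinv c x) w) \<in> W})"
proof -
  let ?P = "\<lambda>c W. {(x, w). x \<in> cimg c \<and> (cinv c x, tvec_of c (cinv c x) w) \<in> W}"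
  have int: "?P c (S \<inter> T) = ?P c S \<inter> ?P c T" for c S T by auto
  have un: "?P c (\<Union>K) = (\<Union>S\<in>K. ?P c S)" for c K by auto
  have "istopology (\<lambda>W. W \<subseteq> tangent_bundle \<and> (\<forall>c\<in>\<A>. open (?P c W)))"
    unfolding istopology_def int un by (auto intro!: open_Int open_UN)
  then show ?thesis
    by (simp add: tangent_bundle_topology_def topology_inverse')
qed

section \<open>Curves and vector fields along curves\<close>

text \<open>
  Curves are functions on \<open>real\<close> of which only the restriction to the interval \<open>I\<close> matters; all
  derivatives are taken within \<open>I\<close>.
\<close>

definition smooth_curve :: "real set \<Rightarrow> (real \<Rightarrow> 'a) \<Rightarrow> bool" where
  "smooth_curve I \<gamma> \<longleftrightarrow> continuous_map (top_of_set I) X \<gamma> \<and>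
     (\<forall>c\<in>\<A>. smooth_on {t \<in> I. \<gamma> t \<in> cdom c} (cmap c \<circ> \<gamma>))"

definition velocity :: "real set \<Rightarrow> (real \<Rightarrow> 'a) \<Rightarrow> real \<Rightarrow> ('a, 'n) tvec" where
  "velocity I \<gamma> t = (\<lambda>c\<in>charts_at (\<gamma> t). vector_derivative (cmap c \<circ> \<gamma>) (at t within I))"

definition smooth_field_along :: "real set \<Rightarrow> (real \<Rightarrow> 'a) \<Rightarrow> (real \<Rightarrow> ('a, 'n) tvec) \<Rightarrow> bool" where
  "smooth_field_along I \<gamma> V \<longleftrightarrow> (\<forall>t\<in>I. V t \<in> tangent_space (\<gamma> t)) \<and>
     (\<forall>c\<in>\<A>. smooth_on {t \<in> I. \<gamma> t \<in> cdom c} (\<lambda>t. V t c))"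

end

section \<open>Riemannian manifolds\<close>

locale riemannian_manifold = smooth_manifold X \<A>
  for X :: "'a topology" and \<A> :: "('a, 'n::finite) chart set" +
  fixes g :: "'a \<Rightarrow> ('a, 'n) tvec \<Rightarrow> ('a, 'n) tvec \<Rightarrow> real"
  assumes metric_sym: "\<lbrakk>p \<in> topspace X; u \<in> tangent_space p; v \<in> tangent_space p\<rbrakk> \<Longrightarrow>
      g p u v = g p v u"
    and metric_add: "\<lbrakk>p \<in> topspace X; u \<in> tangent_space p; v \<in> tangent_space p;
      w \<in> tangent_space p\<rbrakk> \<Longrightarrow> g p (add_tvec p u v) w = g p u w + g p v w"
    and metric_scale: "\<lbrakk>p \<in> topspace X; u \<in> tangent_space p; v \<in> tangent_space p\<rbrakk> \<Longrightarrow>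
      g p (scale_tvec p r u) v = r * g p u v"
    and metric_pos: "\<lbrakk>p \<in> topspace X; u \<in> tangent_space p; u \<noteq> zero_tvec p\<rbrakk> \<Longrightarrow> g p u u > 0"
    and metric_smooth: "c \<in> \<A> \<Longrightarrow>
      smooth_on (cimg c) (\<lambda>x. g (cinv c x) (tvec_of c (cinv c x) a) (tvec_of c (cinv c x) b))"
begin

text \<open>
  The coefficient matrix of the metric in a chart, the partial derivatives \<open>\<partial>\<^sub>i f\<close>, and the
  Christoffel symbols \<open>christoffel c x k i j = \<Gamma>\<^sup>k\<^sub>i\<^sub>j(x)\<close> of the Levi-Civita connection.
\<close>

definition gmat :: "('a, 'n) chart \<Rightarrow> real^'n \<Rightarrow> real^'n^'n" where
  "gmat c x = (\<chi> i j. g (cinv c x) (tvec_of c (cinv c x) (axis i 1)) (tvec_of c (cinv c x) (axis j 1)))"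

definition pderiv_at :: "'n \<Rightarrow> (real^'n \<Rightarrow> real) \<Rightarrow> real^'n \<Rightarrow> real" where
  "pderiv_at i f x = frechet_derivative f (at x) (axis i 1)"

definition christoffel :: "('a, 'n) chart \<Rightarrow> real^'n \<Rightarrow> 'n \<Rightarrow> 'n \<Rightarrow> 'n \<Rightarrow> real" where
  "christoffel c x k i j = (1/2) * (\<Sum>m\<in>UNIV. matrix_inv (gmat c x) $ k $ m *
     (pderiv_at i (\<lambda>y. gmat c y $ j $ m) x + pderiv_at j (\<lambda>y. gmat c y $ i $ m) x
      - pderiv_at m (\<lambda>y. gmat c y $ i $ j) x))"

text \<open>The covariant derivative of a vector field \<open>V\<close> along the curve \<open>\<gamma>\<close>.\<close>

definition cov_deriv ::
  "real set \<Rightarrow> (real \<Rightarrow> 'a) \<Rightarrow> (real \<Rightarrow> ('a, 'n) tvec) \<Rightarrow> real \<Rightarrow> ('a, 'n) tvec" where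
  "cov_deriv I \<gamma> V t = (\<lambda>c\<in>charts_at (\<gamma> t).
     vector_derivative (\<lambda>s. V s c) (at t within I) +
     (\<chi> k. \<Sum>i\<in>UNIV. \<Sum>j\<in>UNIV. christoffel c (cmap c (\<gamma> t)) k i j * velocity I \<gamma> t c $ i * V t c $ j))"

text \<open>
  The components of the Riemann tensor, with the convention
  \<open>R(\<partial>\<^sub>i, \<partial>\<^sub>j) \<partial>\<^sub>k = (\<Sum>m. riemann_coeff c x m i j k \<partial>\<^sub>m)\<close> and
  \<open>R(X, Y) Z = \<nabla>\<^sub>X \<nabla>\<^sub>Y Z - \<nabla>\<^sub>Y \<nabla>\<^sub>X Z - \<nabla>\<^sub>[\<^sub>X\<^sub>,\<^sub>Y\<^sub>] Z\<close>.
\<close>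

definition riemann_coeff :: "('a, 'n) chart \<Rightarrow> real^'n \<Rightarrow> 'n \<Rightarrow> 'n \<Rightarrow> 'n \<Rightarrow> 'n \<Rightarrow> real" where
  "riemann_coeff c x m i j k =
     pderiv_at i (\<lambda>y. christoffel c y m j k) x - pderiv_at j (\<lambda>y. christoffel c y m i k) x +
     (\<Sum>r\<in>UNIV. christoffel c x m i r * christoffel c x r j k
               - christoffel c x m j r * christoffel c x r i k)"

definition riemann ::
  "'a \<Rightarrow> ('a, 'n) tvec \<Rightarrow> ('a, 'n) tvec \<Rightarrow> ('a, 'n) tvec \<Rightarrow> ('a, 'n) tvec" where
  "riemann p u v w = (\<lambda>c\<in>charts_at p. \<chi> m. \<Sum>i\<in>UNIV. \<Sum>j\<in>UNIV. \<Sum>k\<in>UNIV.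
     riemann_coeff c (cmap c p) m i j k * u c $ i * v c $ j * w c $ k)"

definition unit_speed_geodesic :: "real set \<Rightarrow> (real \<Rightarrow> 'a) \<Rightarrow> bool" where
  "unit_speed_geodesic I \<gamma> \<longleftrightarrow> smooth_curve I \<gamma> \<and>
     (\<forall>t\<in>I. cov_deriv I \<gamma> (velocity I \<gamma>) t = zero_tvec (\<gamma> t) \<and>
            g (\<gamma> t) (velocity I \<gamma> t) (velocity I \<gamma> t) = 1)"

definition jacobi_field :: "real set \<Rightarrow> (real \<Rightarrow> 'a) \<Rightarrow> (real \<Rightarrow> ('a, 'n) tvec) \<Rightarrow> bool" where
  "jacobi_field I \<gamma> J \<longleftrightarrow> smooth_field_along I \<gamma> J \<and>
     (\<forall>t\<in>I. add_tvec (\<gamma> t) (cov_deriv I \<gamma> (cov_deriv I \<gamma> J) t)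
              (riemann (\<gamma> t) (J t) (velocity I \<gamma> t) (velocity I \<gamma> t)) = zero_tvec (\<gamma> t))"

section \<open>Geodesic loops\<close>

definition curve_length :: "(real \<Rightarrow> 'a) \<Rightarrow> real \<Rightarrow> real" where
  "curve_length \<gamma> l =
     integral {0..l} (\<lambda>t. sqrt (g (\<gamma> t) (velocity {0..l} \<gamma> t) (velocity {0..l} \<gamma> t)))"

definition geodesic_loop :: "(real \<Rightarrow> 'a) \<Rightarrow> real \<Rightarrow> bool" where
  "geodesic_loop \<gamma> l \<longleftrightarrow> l > 0 \<and> smooth_curve {0..l} \<gamma> \<and> \<not> \<gamma> constant_on {0..l} \<and>
     unit_speed_geodesic {0<..<l} \<gamma> \<and> \<gamma> 0 = \<gamma> l"

definition closed_geodesic :: "(real \<Rightarrow> 'a) \<Rightarrow> real \<Rightarrow> bool" where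
  "closed_geodesic \<gamma> l \<longleftrightarrow>
     geodesic_loop \<gamma> l \<and> velocity {0..l} \<gamma> 0 = velocity {0..l} \<gamma> l"

definition locally_minimizing :: "(real \<Rightarrow> 'a) \<Rightarrow> real \<Rightarrow> bool" where
  "locally_minimizing \<gamma> l \<longleftrightarrow>
     (\<exists>W. openin tangent_bundle_topology W \<and> (\<gamma> 0, velocity {0..l} \<gamma> 0) \<in> W \<and>
       (\<forall>\<gamma>' l'. geodesic_loop \<gamma>' l' \<and> (\<gamma>' 0, velocity {0..l'} \<gamma>' 0) \<in> W \<longrightarrow>
          curve_length \<gamma> l \<le> curve_length \<gamma>' l'))"

definition locally_maximizing :: "(real \<Rightarrow> 'a) \<Rightarrow> real \<Rightarrow> bool" where
  "locally_maximizing \<gamma> l \<longleftrightarrow>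
     (\<exists>W. openin tangent_bundle_topology W \<and> (\<gamma> 0, velocity {0..l} \<gamma> 0) \<in> W \<and>
       (\<forall>\<gamma>' l'. geodesic_loop \<gamma>' l' \<and> (\<gamma>' 0, velocity {0..l'} \<gamma>' 0) \<in> W \<longrightarrow>
          curve_length \<gamma> l \<ge> curve_length \<gamma>' l'))"

definition locally_extremal :: "(real \<Rightarrow> 'a) \<Rightarrow> real \<Rightarrow> bool" where
  "locally_extremal \<gamma> l \<longleftrightarrow> locally_minimizing \<gamma> l \<or> locally_maximizing \<gamma> l"

definition self_conjugate :: "(real \<Rightarrow> 'a) \<Rightarrow> real \<Rightarrow> bool" where
  "self_conjugate \<gamma> l \<longleftrightarrow>
     (\<exists>J. jacobi_field {0..l} \<gamma> J \<and> (\<exists>t\<in>{0..l}. J t \<noteq> zero_tvec (\<gamma> t)) \<and>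
          J 0 = zero_tvec (\<gamma> 0) \<and> J l = zero_tvec (\<gamma> l))"

end

end

theory Submission
  imports Defs
begin

text \<open>
  In bundle charts a geodesic is an integral curve of the geodesic spray. Along the given geodesic the
  flow of the spray is continuous in the initial vector and differentiable at the initial vector of
  \<open>\<gamma>\<close>; the derivative is a Jacobi field along \<open>\<gamma>\<close>. By the first variation formula the
  squared speed \<open>h\<close> of nearby geodesics \<open>\<gamma>\<^sub>z\<close> on \<open>{0..l}\<close> with variation field \<open>J\<close> satisfies
  \<open>l * h' = 2 * (g (J l) (\<gamma>' l) - g (J 0) (\<gamma>' 0))\<close>. If \<open>\<gamma>\<close> is not self-conjugate and its end
  velocities differ, then the map \<open>z \<mapsto> (\<gamma>\<^sub>z l - \<gamma>\<^sub>z 0, h z)\<close> (in a chart) has a surjective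
  derivative at the initial vector of \<open>\<gamma>\<close>, so it is open there: arbitrarily close to \<open>\<gamma>\<close> there are
  loops of speed slightly less than one and slightly greater than one, which after reparametrization
  are geodesic loops that are shorter, respectively longer, than \<open>\<gamma>\<close>. Openness needs the
  derivative at a single point only, so no smooth dependence on initial values is required.
\<close>

section \<open>Calculus of \<open>C\<^sup>k\<close> maps\<close>

text \<open>All nearby geodesics keep the parameter interval \<open>{0..l}\<close>; their speed
  varies instead of their length. Closing up is then a condition at one fixed time, and a geodesic
  that closes up has length \<open>l\<close> times its speed. The target of the submersion has one
  dimension more than the manifold, and the hypotheses supply its two parts. Since \<gamma> is not
  self-conjugate, variations with fixed initial point reach every displacement of the end point. A
  further variation, equal at both ends to the difference \<open>u\<close> of the end velocities,
  keeps the displacement zero to first order, and the squared speed changes along it at the rate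
  \<open>2 g(u, u) / l\<close>, which is nonzero by positivity. The obstacle is that \<gamma> need
  not lie in one chart. Flow and derivative are built chart by chart and joined by bisection; the
  pieces fit because the spray is a well-defined vector field on the tangent bundle, which is the
  transformation law of the Christoffel symbols. A loop is geodesic by definition on the open
  interval only; the equation reaches the endpoints by continuity.\<close>

lemma Ck_SucD: "Ck (Suc k) S f \<Longrightarrow> Ck k S f"
proof (induction k arbitrary: f)
  case 0
  then show ?case by (auto intro: has_derivative_continuous_on)
next
  case (Suc k)
  then obtain f' where "\<forall>x\<in>S. (f has_derivative f' x) (at x within S)" "\<forall>v. Ck (Suc k) S (\<lambda>x. f' x v)"
    unfolding Ck.simps(2)[of "Suc k"] by blast
  with Suc.IH show ?case unfolding Ck.simps(2)[of k] by blast
qed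

lemma Ck_imp_continuous_on: "Ck k S f \<Longrightarrow> continuous_on S f"
proof (induction k)
  case (Suc k)
  then show ?case using Ck_SucD by blast
qed simp

lemma Ck_subset: "Ck k S f \<Longrightarrow> T \<subseteq> S \<Longrightarrow> Ck k T f"
proof (induction k arbitrary: f)
  case 0
  then show ?case by (auto intro: continuous_on_subset)
next
  case (Suc k)
  then obtain f' where f': "\<forall>x\<in>S. (f has_derivative f' x) (at x within S)" "\<forall>v. Ck k S (\<lambda>x. f' x v)"
    by auto
  then have "\<forall>x\<in>T. (f has_derivative f' x) (at x within T)"
    using Suc.prems(2) by (meson has_derivative_subset subsetD)
  with f' Suc show ?case by auto
qed

lemma Ck_cong:
  assumes "\<And>x. x \<in> S \<Longrightarrow> f x = g x"
  shows "Ck k S f \<longleftrightarrow> Ck k S g"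
proof (cases k)
  case 0
  then show ?thesis using assms by (simp cong: continuous_on_cong)
next
  case (Suc m)
  have "(f has_derivative f') (at x within S) \<longleftrightarrow> (g has_derivative f') (at x within S)"
    if "x \<in> S" for x f'
    using has_derivative_transform[OF that, of f g f'] has_derivative_transform[OF that, of g f f'] assms
    by auto
  then show ?thesis unfolding Suc Ck.simps by (intro ex_cong1 conj_cong ball_cong) auto
qed

lemma Ck_const: "Ck k S (\<lambda>x. c)"
proof (induction k arbitrary: c)
  case (Suc k)
  show ?case unfolding Ck.simps
    by (rule exI[of _ "\<lambda>x v. 0"]) (use Suc in auto)
qed simp

lemma Ck_bounded_linear:
  assumes "bounded_linear L"
  shows "Ck k S L"
proof (cases k)
  case 0
  then show ?thesis using assms by (simp add: linear_continuous_on)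
next
  case (Suc m)
  then show ?thesis unfolding Suc Ck.simps
    using assms by (intro exI[of _ "\<lambda>x. L"]) (auto simp: Ck_const intro: bounded_linear_imp_has_derivative)
qed

lemma Ck_linear_compose:
  assumes "bounded_linear L" "Ck k S f"
  shows "Ck k S (\<lambda>x. L (f x))"
  using assms(2)
proof (induction k arbitrary: f)
  case 0
  then show ?case using assms(1) by (simp add: bounded_linear.continuous_on)
next
  case (Suc k)
  then obtain f' where "\<forall>x\<in>S. (f has_derivative f' x) (at x within S)" "\<forall>v. Ck k S (\<lambda>x. f' x v)"
    by auto
  then show ?case unfolding Ck.simps
    by (intro exI[of _ "\<lambda>x v. L (f' x v)"])
      (auto intro: bounded_linear.has_derivative[OF assms(1)] Suc.IH)
qed

lemma Ck_add: "Ck k S f \<Longrightarrow> Ck k S g \<Longrightarrow> Ck k S (\<lambda>x. f x + g x)"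
proof (induction k arbitrary: f g)
  case 0
  then show ?case by (simp add: continuous_on_add)
next
  case (Suc k)
  then obtain f' g' where "\<forall>x\<in>S. (f has_derivative f' x) (at x within S)" "\<forall>a. Ck k S (\<lambda>x. f' x a)"
    "\<forall>x\<in>S. (g has_derivative g' x) (at x within S)" "\<forall>a. Ck k S (\<lambda>x. g' x a)"
    by auto
  then show ?case unfolding Ck.simps
    by (intro exI[of _ "\<lambda>x a. f' x a + g' x a"]) (auto intro: has_derivative_add Suc.IH)
qed

lemma Ck_bilinear:
  assumes "bounded_bilinear p" "Ck k S f" "Ck k S g"
  shows "Ck k S (\<lambda>x. p (f x) (g x))"
proof -
  interpret bounded_bilinear p by fact
  show ?thesis using assms(2,3)
  proof (induction k arbitrary: f g)
    case 0
    then show ?case by (simp add: continuous_on)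
  next
    case (Suc k)
    then obtain f' g' where "\<forall>x\<in>S. (f has_derivative f' x) (at x within S)" "\<forall>a. Ck k S (\<lambda>x. f' x a)"
      "\<forall>x\<in>S. (g has_derivative g' x) (at x within S)" "\<forall>a. Ck k S (\<lambda>x. g' x a)"
      by auto
    then show ?case unfolding Ck.simps
      by (intro exI[of _ "\<lambda>x a. p (f x) (g' x a) + p (f' x a) (g x)"])
        (auto intro!: FDERIV Ck_add Suc.IH Ck_SucD[OF Suc.prems(1)] Ck_SucD[OF Suc.prems(2)])
  qed
qed

lemma Ck_Pair: "Ck k S f \<Longrightarrow> Ck k S g \<Longrightarrow> Ck k S (\<lambda>x. (f x, g x))"
proof (induction k arbitrary: f g)
  case 0
  then show ?case by (simp add: continuous_on_Pair)
next
  case (Suc k)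
  then obtain f' g' where "\<forall>x\<in>S. (f has_derivative f' x) (at x within S)" "\<forall>a. Ck k S (\<lambda>x. f' x a)"
    "\<forall>x\<in>S. (g has_derivative g' x) (at x within S)" "\<forall>a. Ck k S (\<lambda>x. g' x a)"
    by auto
  then show ?case unfolding Ck.simps
    by (intro exI[of _ "\<lambda>x a. (f' x a, g' x a)"]) (auto intro: has_derivative_Pair Suc.IH)
qed

lemma Ck_minus: "Ck k S f \<Longrightarrow> Ck k S (\<lambda>x. - f x)"
  by (rule Ck_linear_compose[OF bounded_linear_minus[OF bounded_linear_ident]])

lemma Ck_diff: "Ck k S f \<Longrightarrow> Ck k S g \<Longrightarrow> Ck k S (\<lambda>x. f x - g x)"
  using Ck_add[of k S f "\<lambda>x. - g x"] Ck_minus by fastforce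

lemma Ck_sum: "(\<And>i. i \<in> I \<Longrightarrow> Ck k S (f i)) \<Longrightarrow> Ck k S (\<lambda>x. \<Sum>i\<in>I. f i x)"
  by (induction I rule: infinite_finite_induct) (auto intro: Ck_add Ck_const)

lemma Ck_mult: "Ck k S f \<Longrightarrow> Ck k S g \<Longrightarrow> Ck k S (\<lambda>x. f x * g x :: real)"
  by (rule Ck_bilinear[OF bounded_bilinear_mult])

lemma Ck_scaleR: "Ck k S f \<Longrightarrow> Ck k S g \<Longrightarrow> Ck k S (\<lambda>x. f x *\<^sub>R g x)"
  by (rule Ck_bilinear[OF bounded_bilinear_scaleR])

lemma Ck_inner: "Ck k S f \<Longrightarrow> Ck k S (\<lambda>x. f x \<bullet> b)"
  by (rule Ck_linear_compose[OF bounded_linear_inner_left])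

lemma Ck_prod: "(\<And>i. i \<in> I \<Longrightarrow> Ck k S (f i)) \<Longrightarrow> Ck k S (\<lambda>x. \<Prod>i\<in>I. f i x :: real)"
  by (induction I rule: infinite_finite_induct) (auto intro: Ck_mult Ck_const)

lemma Ck_vec_nth: "Ck k S f \<Longrightarrow> Ck k S (\<lambda>x. f x $ i)"
  by (rule Ck_linear_compose[OF bounded_linear_vec_nth])

lemma Ck_vec_lambda:
  fixes f :: "'n::finite \<Rightarrow> 'v::real_normed_vector \<Rightarrow> real"
  assumes "\<And>i. Ck k S (f i)"
  shows "Ck k S (\<lambda>x. \<chi> i. f i x)"
proof -
  have "(\<lambda>x. \<chi> i. f i x) = (\<lambda>x. \<Sum>i\<in>UNIV. f i x *\<^sub>R axis i 1)"
    by (auto simp: vec_eq_iff axis_def if_distrib[of "(*) _"] sum.delta cong: if_cong)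
  then show ?thesis by (simp add: Ck_sum Ck_scaleR Ck_const assms)
qed

lemma Ck_inverse:
  fixes f :: "'v::real_normed_vector \<Rightarrow> real"
  assumes "Ck k S f" "\<And>x. x \<in> S \<Longrightarrow> f x \<noteq> 0"
  shows "Ck k S (\<lambda>x. inverse (f x))"
  using assms
proof (induction k arbitrary: f)
  case 0
  then show ?case by (auto intro: continuous_on_inverse)
next
  case (Suc k)
  then obtain f' where f': "\<forall>x\<in>S. (f has_derivative f' x) (at x within S)" "\<forall>v. Ck k S (\<lambda>x. f' x v)"
    by auto
  \<comment> \<open>The derivative of the reciprocal contains the reciprocal again, so its
    regularity one order lower is taken from the induction hypothesis.\<close>
  have inv: "Ck k S (\<lambda>x. inverse (f x))" using Suc Ck_SucD by blast
  show ?case unfolding Ck.simps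
    by (rule exI[of _ "\<lambda>x v. - (inverse (f x) * f' x v * inverse (f x))"])
      (use f' Suc.prems(2) in \<open>auto intro!: Ck_minus Ck_mult inv has_derivative_inverse'\<close>)
qed

lemma linear_eq_sum_Basis:
  fixes L :: "'e::euclidean_space \<Rightarrow> 'w::real_vector"
  assumes "linear L"
  shows "L v = (\<Sum>b\<in>Basis. (v \<bullet> b) *\<^sub>R L b)"
  by (metis (no_types, lifting) assms euclidean_representation linear_scale linear_sum sum.cong)

text \<open>\<open>Ck\<close> controls the derivative of \<open>h\<close> only in fixed directions,
  whereas the chain rule evaluates it at the moving vector \<open>f' x v\<close>. Expanding this
  vector in the finite \<open>Basis\<close> reduces to fixed directions; hence the Euclidean middle
  space.\<close>

lemma Ck_compose:
  fixes f :: "'v::real_normed_vector \<Rightarrow> 'e::euclidean_space" and h :: "'e \<Rightarrow> 'w::real_normed_vector"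
  assumes "Ck k T h" "Ck k S f" "f ` S \<subseteq> T"
  shows "Ck k S (\<lambda>x. h (f x))"
  using assms
proof (induction k arbitrary: f h)
  case 0
  then show ?case using continuous_on_compose2 by fastforce
next
  case (Suc k)
  then obtain f' h' where f': "\<forall>x\<in>S. (f has_derivative f' x) (at x within S)" "\<forall>a. Ck k S (\<lambda>x. f' x a)"
    and h': "\<forall>x\<in>T. (h has_derivative h' x) (at x within T)" "\<forall>a. Ck k T (\<lambda>x. h' x a)"
    by auto
  have lin: "linear (h' (f x))" if "x \<in> S" for x
    using h'(1) Suc.prems(3) that has_derivative_linear by blast
  have "Ck k S (\<lambda>x. h' (f x) (f' x v))" for v
  proof -
    have "Ck k S (\<lambda>x. \<Sum>b\<in>Basis. (f' x v \<bullet> b) *\<^sub>R h' (f x) b)"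
      using Suc.IH[OF h'(2)[rule_format] Ck_SucD[OF Suc.prems(2)] Suc.prems(3)] f'(2)
      by (intro Ck_sum Ck_scaleR Ck_inner) auto
    then show ?thesis
      by (subst Ck_cong[OF linear_eq_sum_Basis[OF lin]]) auto
  qed
  moreover have "((\<lambda>x. h (f x)) has_derivative (\<lambda>v. h' (f x) (f' x v))) (at x within S)" if "x \<in> S" for x
    using has_derivative_in_compose2[of T h h' f S x "f' x"] that f' h' Suc.prems(3) by blast
  ultimately show ?case unfolding Ck.simps
    by (intro exI[of _ "\<lambda>x v. h' (f x) (f' x v)"]) simp
qed

section \<open>Frechet derivatives of \<open>Ck\<close> maps on open sets\<close>

lemma Ck_Suc_has_derivative:
  assumes "Ck (Suc k) S f" "open S" "x \<in> S"
  shows "(f has_derivative frechet_derivative f (at x)) (at x)"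
proof -
  obtain f' where "\<forall>x\<in>S. (f has_derivative f' x) (at x within S)"
    using assms(1) unfolding Ck.simps by blast
  then have "f differentiable (at x)" using assms(2,3) by (metis at_within_open differentiableI)
  then show ?thesis by (simp add: frechet_derivative_works)
qed

lemma Ck_Suc_linear:
  assumes "Ck (Suc k) S f" "open S" "x \<in> S"
  shows "linear (frechet_derivative f (at x))"
  using Ck_Suc_has_derivative[OF assms] has_derivative_linear by blast

text \<open>On an open set derivatives are unique, so the derivative family hidden in the
  existential of \<open>Ck\<close> can be traded for \<open>frechet_derivative\<close>.\<close>

lemma Ck_frechet_derivative:
  assumes "Ck (Suc k) S f" "open S"
  shows "Ck k S (\<lambda>x. frechet_derivative f (at x) v)"
proof -
  obtain f' where f': "\<forall>x\<in>S. (f has_derivative f' x) (at x within S)" "\<forall>v. Ck k S (\<lambda>x. f' x v)"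
    using assms by auto
  have "f' x v = frechet_derivative f (at x) v" if "x \<in> S" for x
    using frechet_derivative_at[of f "f' x" x] f'(1) that assms(2) by (metis at_within_open)
  then show ?thesis using f'(2) Ck_cong[of S "\<lambda>x. f' x v" "\<lambda>x. frechet_derivative f (at x) v" k] by blast
qed

text \<open>Base point and direction both move; expanding the direction in \<open>Basis\<close>
  leaves only fixed directions. This serves the tangent maps of transitions and the linearised
  spray.\<close>

lemma Ck_frechet_derivative_apply:
  fixes h :: "'e::euclidean_space \<Rightarrow> 'w::real_normed_vector"
  assumes "Ck (Suc k) T h" "open T" "Ck k S f" "f ` S \<subseteq> T" "Ck k S v"
  shows "Ck k S (\<lambda>x. frechet_derivative h (at (f x)) (v x))"
proof -
  have "Ck k S (\<lambda>x. \<Sum>b\<in>Basis. (v x \<bullet> b) *\<^sub>R frechet_derivative h (at (f x)) b)"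
    by (intro Ck_sum Ck_scaleR Ck_inner assms Ck_compose[OF Ck_frechet_derivative[OF assms(1,2)] assms(3,4)])
  moreover have "linear (frechet_derivative h (at (f x)))" if "x \<in> S" for x
    using Ck_Suc_linear[OF assms(1,2)] assms(4) that by blast
  ultimately show ?thesis
    by (subst Ck_cong[OF linear_eq_sum_Basis]) auto
qed

section \<open>Symmetry of second derivatives\<close>

lemma second_difference_mean_value:
  fixes f :: "'v::real_normed_vector \<Rightarrow> real"
  assumes "Ck 2 S f" "open S" "0 < h" and S: "\<And>s t. 0 \<le> s \<Longrightarrow> s \<le> h \<Longrightarrow> 0 \<le> t \<Longrightarrow> t \<le> h \<Longrightarrow> x + s *\<^sub>R u + t *\<^sub>R v \<in> S"
  shows "\<exists>s t. 0 < s \<and> s < h \<and> 0 < t \<and> t < h \<and>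
    f (x + h *\<^sub>R u + h *\<^sub>R v) - f (x + h *\<^sub>R u) - f (x + h *\<^sub>R v) + f x =
    h\<^sup>2 * frechet_derivative (\<lambda>y. frechet_derivative f (at y) u) (at (x + s *\<^sub>R u + t *\<^sub>R v)) v"
proof -
  define D where "D y = frechet_derivative f (at y)" for y
  define D2 where "D2 y = frechet_derivative (\<lambda>y. D y u) (at y)" for y
  have Ck2: "Ck (Suc (Suc 0)) S f" using assms(1) by (simp add: numeral_2_eq_2)
  have D: "(f has_derivative D y) (at y)" if "y \<in> S" for y
    unfolding D_def using Ck_Suc_has_derivative[OF Ck2 \<open>open S\<close> that] .
  have D2: "((\<lambda>y. D y u) has_derivative D2 y) (at y)" if "y \<in> S" for y
    unfolding D_def D2_def using Ck_Suc_has_derivative[OF Ck_frechet_derivative[OF Ck2 \<open>open S\<close>] \<open>open S\<close> that] .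
  have scale: "L (r *\<^sub>R w) = r * L w" if "(g has_derivative L) F" for g :: "'v \<Rightarrow> real" and L r w F
    using has_derivative_linear[OF that] linear_scale by fastforce
  have d1: "((\<lambda>s. f (x + s *\<^sub>R u + t *\<^sub>R v)) has_real_derivative D (x + s *\<^sub>R u + t *\<^sub>R v) u) (at s)"
    if "0 \<le> s" "s \<le> h" "0 \<le> t" "t \<le> h" for s t
  proof -
    have "((\<lambda>s. f (x + s *\<^sub>R u + t *\<^sub>R v)) has_derivative (\<lambda>r. D (x + s *\<^sub>R u + t *\<^sub>R v) (r *\<^sub>R u))) (at s)"
      using D[OF S[OF that]] by (rule has_derivative_compose[rotated]) (auto intro!: derivative_eq_intros)
    then show ?thesis using scale[OF D[OF S[OF that]]]
      by (simp add: has_field_derivative_def mult.commute[of _ "D _ _"] cong: if_cong)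
  qed
  have d2: "((\<lambda>t. D (x + s *\<^sub>R u + t *\<^sub>R v) u) has_real_derivative D2 (x + s *\<^sub>R u + t *\<^sub>R v) v) (at t)"
    if "0 \<le> s" "s \<le> h" "0 \<le> t" "t \<le> h" for s t
  proof -
    have "((\<lambda>t. D (x + s *\<^sub>R u + t *\<^sub>R v) u) has_derivative (\<lambda>r. D2 (x + s *\<^sub>R u + t *\<^sub>R v) (r *\<^sub>R v))) (at t)"
      using D2[OF S[OF that]] by (rule has_derivative_compose[rotated]) (auto intro!: derivative_eq_intros)
    then show ?thesis using scale[OF D2[OF S[OF that]]]
      by (simp add: has_field_derivative_def mult.commute[of _ "D2 _ _"] cong: if_cong)
  qed
  \<comment> \<open>The mean value theorem is applied in \<open>s\<close> to the difference over the
    \<open>v\<close>-step; a second application in \<open>t\<close> to the resulting difference of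
    first derivatives produces the mixed derivative.\<close>
  have "((\<lambda>s. f (x + s *\<^sub>R u + h *\<^sub>R v) - f (x + s *\<^sub>R u + 0 *\<^sub>R v)) has_real_derivative
     D (x + s *\<^sub>R u + h *\<^sub>R v) u - D (x + s *\<^sub>R u + 0 *\<^sub>R v) u) (at s)" if "0 \<le> s" "s \<le> h" for s
    using d1[of s h] d1[of s 0] that \<open>0 < h\<close> by (intro DERIV_diff) auto
  from MVT2[OF \<open>0 < h\<close>, of "\<lambda>s. f (x + s *\<^sub>R u + h *\<^sub>R v) - f (x + s *\<^sub>R u + 0 *\<^sub>R v)", OF this]
  obtain s where s: "0 < s" "s < h" "f (x + h *\<^sub>R u + h *\<^sub>R v) - f (x + h *\<^sub>R u) - (f (x + h *\<^sub>R v) - f x) =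
      h * (D (x + s *\<^sub>R u + h *\<^sub>R v) u - D (x + s *\<^sub>R u + 0 *\<^sub>R v) u)"
    by auto
  from MVT2[OF \<open>0 < h\<close>, of "\<lambda>t. D (x + s *\<^sub>R u + t *\<^sub>R v) u", OF d2] s
  obtain t where "0 < t" "t < h" "D (x + s *\<^sub>R u + h *\<^sub>R v) u - D (x + s *\<^sub>R u + 0 *\<^sub>R v) u =
      h * D2 (x + s *\<^sub>R u + t *\<^sub>R v) v"
    by auto
  with s show ?thesis unfolding D2_def D_def
    by (intro exI[of _ s] exI[of _ t]) (simp add: power2_eq_square)
qed

text \<open>The second difference is unchanged when \<open>u\<close> and \<open>v\<close> are
  exchanged, so the same number, divided by \<open>h^2\<close>, is a value of either mixed
  derivative at a point near \<open>x\<close>. Continuity of both at \<open>x\<close> then excludes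
  a gap.\<close>

lemma second_derivative_symmetric_real:
  fixes f :: "'v::real_normed_vector \<Rightarrow> real"
  assumes "Ck 2 S f" "open S" "x \<in> S"
  shows "frechet_derivative (\<lambda>y. frechet_derivative f (at y) u) (at x) v =
         frechet_derivative (\<lambda>y. frechet_derivative f (at y) v) (at x) u"
proof (rule ccontr)
  define D2 where "D2 u v y = frechet_derivative (\<lambda>y. frechet_derivative f (at y) u) (at y) v" for u v y
  assume "\<not> ?thesis"
  then have ne: "D2 u v x \<noteq> D2 v u x" by (simp add: D2_def)
  \<comment> \<open>Half the gap: two values within distance less than \<open>e\<close> of the two
    derivatives at \<open>x\<close> cannot coincide.\<close>
  define e where "e = \<bar>D2 u v x - D2 v u x\<bar> / 2"
  have "e > 0" using ne by (simp add: e_def)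
  have Ck2: "Ck (Suc (Suc 0)) S f" using assms(1) by (simp add: numeral_2_eq_2)
  have "isCont (D2 u v) x" for u v
    using Ck_frechet_derivative[OF Ck_frechet_derivative[OF Ck2 \<open>open S\<close>] \<open>open S\<close>] assms(2,3)
    unfolding D2_def by (simp add: continuous_on_eq_continuous_at)
  then have "\<forall>\<^sub>F y in at x. y \<in> S \<and> dist (D2 u v y) (D2 u v x) < e \<and> dist (D2 v u y) (D2 v u x) < e"
    using \<open>e > 0\<close> assms(2,3) unfolding isCont_def
    by (intro eventually_conj tendstoD) (auto intro: eventually_at_in_open')
  then obtain d where d: "d > 0" "\<And>y. y \<noteq> x \<Longrightarrow> dist y x < d \<Longrightarrow>
      y \<in> S \<and> dist (D2 u v y) (D2 u v x) < e \<and> dist (D2 v u y) (D2 v u x) < e"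
    unfolding eventually_at by auto
  \<comment> \<open>Keeps the whole parallelogram spanned by \<open>h u\<close> and
    \<open>h v\<close> within distance \<open>d\<close> of \<open>x\<close>; the summand 1 avoids
    division by zero when both vectors vanish.\<close>
  define h where "h = d / (2 * (norm u + norm v + 1))"
  have "h > 0" using d(1) unfolding h_def by (intro divide_pos_pos) (auto simp: add_nonneg_pos)
  have hd: "h * (norm u + norm v) < d"
  proof -
    have "h * (norm u + norm v) \<le> h * (norm u + norm v + 1)" using \<open>h > 0\<close> by simp
    also have "\<dots> = d / 2"
    proof -
      have "norm u + norm v + 1 > 0" by (simp add: add_nonneg_pos)
      then show ?thesis by (simp add: h_def field_simps)
    qed
    finally show ?thesis using d(1) by simp
  qed
  have near: "dist (x + s *\<^sub>R u + t *\<^sub>R v) x < d" if "0 \<le> s" "s \<le> h" "0 \<le> t" "t \<le> h" for s t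
  proof -
    have "dist (x + s *\<^sub>R u + t *\<^sub>R v) x \<le> s * norm u + t * norm v"
      using that norm_triangle_ineq[of "s *\<^sub>R u" "t *\<^sub>R v"] by (simp add: dist_norm add.assoc)
    also have "\<dots> \<le> h * norm u + h * norm v" using that by (intro add_mono mult_right_mono) auto
    finally show ?thesis using hd by (simp add: distrib_left)
  qed
  have D: "y \<in> S \<and> dist (D2 u v y) (D2 u v x) < e \<and> dist (D2 v u y) (D2 v u x) < e" if "dist y x < d" for y
    using d(2)[OF _ that] assms(3) \<open>e > 0\<close> by (cases "y = x") auto
  obtain s t where st: "0 < s" "s < h" "0 < t" "t < h"
    "f (x + h *\<^sub>R u + h *\<^sub>R v) - f (x + h *\<^sub>R u) - f (x + h *\<^sub>R v) + f x = h\<^sup>2 * D2 u v (x + s *\<^sub>R u + t *\<^sub>R v)"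
    using second_difference_mean_value[OF assms(1,2) \<open>h > 0\<close>, of x u v] near D unfolding D2_def by blast
  have S': "x + a *\<^sub>R v + b *\<^sub>R u \<in> S" if "0 \<le> a" "a \<le> h" "0 \<le> b" "b \<le> h" for a b
    using D near[OF that(3,4,1,2)] by (simp add: algebra_simps)
  obtain s' t' where st': "0 < s'" "s' < h" "0 < t'" "t' < h"
    "f (x + h *\<^sub>R v + h *\<^sub>R u) - f (x + h *\<^sub>R v) - f (x + h *\<^sub>R u) + f x = h\<^sup>2 * D2 v u (x + s' *\<^sub>R v + t' *\<^sub>R u)"
    using second_difference_mean_value[OF assms(1,2) \<open>h > 0\<close> S'] unfolding D2_def by blast
  have "h\<^sup>2 * D2 u v (x + s *\<^sub>R u + t *\<^sub>R v) = h\<^sup>2 * D2 v u (x + s' *\<^sub>R v + t' *\<^sub>R u)"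
    unfolding st(5)[symmetric] st'(5)[symmetric] by (simp add: algebra_simps)
  then have "D2 u v (x + s *\<^sub>R u + t *\<^sub>R v) = D2 v u (x + t' *\<^sub>R u + s' *\<^sub>R v)"
    using \<open>h > 0\<close> by (simp add: algebra_simps)
  moreover have "dist (D2 u v (x + s *\<^sub>R u + t *\<^sub>R v)) (D2 u v x) < e"
    using D[OF near[of s t]] st by auto
  moreover have "dist (D2 v u (x + t' *\<^sub>R u + s' *\<^sub>R v)) (D2 v u x) < e"
    using D[OF near[of t' s']] st' by auto
  ultimately have "dist (D2 u v x) (D2 v u x) < e + e"
    by (metis dist_commute dist_triangle_less_add)
  then show False by (simp add: e_def dist_real_def)
qed

text \<open>Taking the inner product with a fixed \<open>b\<close> commutes with both
  differentiations, which reduces to the real-valued case.\<close>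

lemma second_derivative_symmetric:
  fixes f :: "'v::real_normed_vector \<Rightarrow> 'w::real_inner"
  assumes "Ck 2 S f" "open S" "x \<in> S"
  shows "frechet_derivative (\<lambda>y. frechet_derivative f (at y) u) (at x) v =
         frechet_derivative (\<lambda>y. frechet_derivative f (at y) v) (at x) u"
proof (rule vector_eq_ldot[THEN iffD1], rule allI)
  fix b :: 'w
  have Ck2: "Ck (Suc (Suc 0)) S f" using assms(1) by (simp add: numeral_2_eq_2)
  have D: "(f has_derivative frechet_derivative f (at y)) (at y)" if "y \<in> S" for y
    using Ck_Suc_has_derivative[OF Ck2 \<open>open S\<close> that] .
  have D1: "frechet_derivative (\<lambda>y. f y \<bullet> b) (at y) u = frechet_derivative f (at y) u \<bullet> b" if "y \<in> S" for y u
    using frechet_derivative_at[OF has_derivative_inner_left[OF D[OF that]], of b] by metis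
  have D2: "frechet_derivative (\<lambda>y. frechet_derivative (\<lambda>y. f y \<bullet> b) (at y) u) (at x) v =
     frechet_derivative (\<lambda>y. frechet_derivative f (at y) u) (at x) v \<bullet> b" for u v
  proof -
    have "((\<lambda>y. frechet_derivative f (at y) u \<bullet> b) has_derivative
        (\<lambda>v. frechet_derivative (\<lambda>y. frechet_derivative f (at y) u) (at x) v \<bullet> b)) (at x)"
      using Ck_Suc_has_derivative[OF Ck_frechet_derivative[OF Ck2 \<open>open S\<close>] \<open>open S\<close> \<open>x \<in> S\<close>]
      by (rule has_derivative_inner_left)
    then have "((\<lambda>y. frechet_derivative (\<lambda>y. f y \<bullet> b) (at y) u) has_derivative
        (\<lambda>v. frechet_derivative (\<lambda>y. frechet_derivative f (at y) u) (at x) v \<bullet> b)) (at x)"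
      by (rule has_derivative_transform_within_open[OF _ \<open>open S\<close> \<open>x \<in> S\<close>]) (simp add: D1)
    from frechet_derivative_at[OF this] show ?thesis by metis
  qed
  have "Ck 2 S (\<lambda>y. f y \<bullet> b)" by (rule Ck_inner[OF assms(1)])
  from second_derivative_symmetric_real[OF this assms(2,3), of u v]
  show "b \<bullet> frechet_derivative (\<lambda>y. frechet_derivative f (at y) u) (at x) v =
      b \<bullet> frechet_derivative (\<lambda>y. frechet_derivative f (at y) v) (at x) u"
    unfolding D2 by (simp add: inner_commute)
qed

section \<open>Ordinary differential equations\<close>

text \<open>Stated for the squared norm, which unlike the norm is differentiable at the origin.\<close>

lemma gronwall_square:
  fixes y :: "real \<Rightarrow> 'e::real_inner"
  assumes y: "\<And>t. t \<in> {a..b} \<Longrightarrow> (y has_vector_derivative y' t) (at t within {a..b})"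
    and bound: "\<And>t. t \<in> {a..b} \<Longrightarrow> norm (y' t) \<le> L * norm (y t) + \<kappa>"
    and "L \<ge> 0" "\<kappa> \<ge> 0" "t \<in> {a..b}"
  shows "(norm (y t))\<^sup>2 \<le> exp ((2 * L + 1) * (t - a)) * ((norm (y a))\<^sup>2 + \<kappa>\<^sup>2 * (t - a))"
proof -
  \<comment> \<open>Cauchy-Schwarz bounds the derivative of \<open>|y|^2\<close> by
    \<open>2 L |y|^2 + 2 \<kappa> |y|\<close>, and the second term is at most
    \<open>|y|^2 + \<kappa>^2\<close>; the extra 1 in the rate absorbs this \<open>|y|^2\<close>.
    With the integrating factor, \<psi> is then nonincreasing.\<close>
  define M where "M = 2 * L + 1"
  define \<psi> where "\<psi> t = exp (- (M * (t - a))) * (y t \<bullet> y t) - \<kappa>\<^sup>2 * (t - a)" for t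
  have "M \<ge> 0" using \<open>L \<ge> 0\<close> by (simp add: M_def)
  have deriv: "(\<psi> has_real_derivative
      exp (- (M * (s - a))) * (2 * (y s \<bullet> y' s) - M * (y s \<bullet> y s)) - \<kappa>\<^sup>2) (at s)" if "a < s" "s < t" for s
  proof -
    have "(y has_vector_derivative y' s) (at s)"
      using y[of s] that assms(5) at_within_Icc_at[of a s b] by auto
    then have "((\<lambda>s. y s \<bullet> y s) has_real_derivative 2 * (y s \<bullet> y' s)) (at s)"
      unfolding has_real_derivative_iff_has_vector_derivative
      using bounded_bilinear.has_vector_derivative[OF bounded_bilinear_inner] by (fastforce simp: inner_commute)
    then show ?thesis unfolding \<psi>_def
      by (auto intro!: derivative_eq_intros simp: algebra_simps)
  qed
  have neg: "exp (- (M * (s - a))) * (2 * (y s \<bullet> y' s) - M * (y s \<bullet> y s)) - \<kappa>\<^sup>2 \<le> 0" if "a < s" "s < t" for s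
  proof -
    have "y s \<bullet> y' s \<le> norm (y s) * norm (y' s)" by (rule norm_cauchy_schwarz)
    also have "\<dots> \<le> norm (y s) * (L * norm (y s) + \<kappa>)"
      using bound[of s] that assms(5) by (intro mult_left_mono) auto
    finally have "2 * (y s \<bullet> y' s) \<le> 2 * L * (norm (y s))\<^sup>2 + 2 * \<kappa> * norm (y s)"
      by (simp add: power2_eq_square algebra_simps)
    moreover have "2 * \<kappa> * norm (y s) \<le> (norm (y s))\<^sup>2 + \<kappa>\<^sup>2"
      using sum_squares_bound[of \<kappa> "norm (y s)"] by linarith
    ultimately have "2 * (y s \<bullet> y' s) - M * (y s \<bullet> y s) \<le> \<kappa>\<^sup>2"
      by (simp add: M_def power2_norm_eq_inner algebra_simps)
    then have "exp (- (M * (s - a))) * (2 * (y s \<bullet> y' s) - M * (y s \<bullet> y s)) \<le> exp (- (M * (s - a))) * \<kappa>\<^sup>2"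
      by (intro mult_left_mono) auto
    also have "\<dots> \<le> 1 * \<kappa>\<^sup>2" using that \<open>M \<ge> 0\<close> by (intro mult_right_mono) auto
    finally show ?thesis by simp
  qed
  have cont: "continuous_on {a..t} \<psi>"
  proof -
    have "continuous_on {a..b} y" by (rule continuous_on_vector_derivative[OF y])
    then have "continuous_on {a..t} y" using assms(5) by (auto intro: continuous_on_subset)
    then show ?thesis unfolding \<psi>_def by (intro continuous_intros)
  qed
  have "\<psi> t \<le> \<psi> a"
    by (rule DERIV_nonpos_imp_decreasing_open[OF _ _ cont]) (use assms(5) deriv neg in \<open>auto simp del: diff_le_0_iff_le\<close>)
  then have "exp (- (M * (t - a))) * (norm (y t))\<^sup>2 \<le> (norm (y a))\<^sup>2 + \<kappa>\<^sup>2 * (t - a)"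
    by (simp add: \<psi>_def power2_norm_eq_inner)
  then have "exp (M * (t - a)) * (exp (- (M * (t - a))) * (norm (y t))\<^sup>2) \<le>
      exp (M * (t - a)) * ((norm (y a))\<^sup>2 + \<kappa>\<^sup>2 * (t - a))"
    by (intro mult_left_mono) auto
  then show ?thesis by (simp add: M_def mult.assoc[symmetric] exp_add[symmetric])
qed

text \<open>Square root of \<open>gronwall_square\<close>. The constants are generous on purpose:
  \<open>C\<close> is enlarged to \<open>C^2\<close> (as \<open>C \<ge> 1\<close>) and
  \<open>t - a\<close> to \<open>(b - a + 1)^2\<close>, so that the bound is dominated by a perfect
  square.\<close>

lemma gronwall_norm:
  fixes y :: "real \<Rightarrow> 'e::real_inner"
  assumes "\<And>t. t \<in> {a..b} \<Longrightarrow> (y has_vector_derivative y' t) (at t within {a..b})"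
    and "\<And>t. t \<in> {a..b} \<Longrightarrow> norm (y' t) \<le> L * norm (y t) + \<kappa>"
    and "L \<ge> 0" "\<kappa> \<ge> 0" "t \<in> {a..b}"
  shows "norm (y t) \<le> exp ((2 * L + 1) * (b - a)) * (norm (y a) + \<kappa> * (b - a + 1))"
proof -
  define C where "C = exp ((2 * L + 1) * (b - a))"
  have "C \<ge> 1" using assms by (simp add: C_def)
  have ab: "0 \<le> t - a" "t - a \<le> b - a" using assms(5) by auto
  have "(norm (y t))\<^sup>2 \<le> exp ((2 * L + 1) * (t - a)) * ((norm (y a))\<^sup>2 + \<kappa>\<^sup>2 * (t - a))"
    using gronwall_square[OF assms] .
  also have "\<dots> \<le> C * ((norm (y a))\<^sup>2 + \<kappa>\<^sup>2 * (b - a + 1)\<^sup>2)"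
  proof -
    have "t - a \<le> (b - a + 1)\<^sup>2"
      using ab self_le_power[of "b - a + 1" 2] by linarith
    then show ?thesis unfolding C_def using ab \<open>L \<ge> 0\<close>
      by (intro mult_mono add_mono mult_left_mono) (auto intro!: mult_left_mono)
  qed
  also have "\<dots> \<le> C\<^sup>2 * ((norm (y a))\<^sup>2 + \<kappa>\<^sup>2 * (b - a + 1)\<^sup>2)"
    using \<open>C \<ge> 1\<close> self_le_power[of C 2] by (intro mult_right_mono) auto
  also have "\<dots> \<le> C\<^sup>2 * (norm (y a) + \<kappa> * (b - a + 1))\<^sup>2"
  proof -
    have "0 \<le> norm (y a) * (\<kappa> * (b - a + 1))" using ab \<open>\<kappa> \<ge> 0\<close> by auto
    then show ?thesis by (intro mult_left_mono) (auto simp: power2_sum power_mult_distrib mult_ac)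
  qed
  finally have "(norm (y t))\<^sup>2 \<le> (C * (norm (y a) + \<kappa> * (b - a + 1)))\<^sup>2"
    by (simp add: power_mult_distrib)
  moreover have "0 \<le> C * (norm (y a) + \<kappa> * (b - a + 1))" using \<open>C \<ge> 1\<close> ab \<open>\<kappa> \<ge> 0\<close> by auto
  ultimately show ?thesis unfolding C_def by (rule power2_le_imp_le)
qed

text \<open>Picard iteration on the whole interval at once, in Bielecki's weighted norm: for the
  unknown \<open>u t = exp (- \<mu> (t - a)) y t\<close> the integral operator is a contraction
  whatever the length of the interval.\<close>

lemma ode_lipschitz_global_solution:
  fixes h :: "real \<Rightarrow> 'e::euclidean_space \<Rightarrow> 'e"
  assumes "a \<le> b" and h: "continuous_on ({a..b} \<times> UNIV) (\<lambda>(t, y). h t y)"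
    and lip: "\<And>t y z. t \<in> {a..b} \<Longrightarrow> norm (h t y - h t z) \<le> L * norm (y - z)" and "L \<ge> 0"
  shows "\<exists>y. y a = y0 \<and> (\<forall>t\<in>{a..b}. (y has_vector_derivative h t (y t)) (at t within {a..b}))"
proof -
  \<comment> \<open>The contraction factor is \<open>L / \<mu>\<close>; this choice keeps it at most
    1/2 and makes \<mu> positive even for \<open>L = 0\<close>.\<close>
  define \<mu> where "\<mu> = 2 * L + 1"
  have "\<mu> > 0" using \<open>L \<ge> 0\<close> by (simp add: \<mu>_def)
  define k where "k u s = h s (exp (\<mu> * (s - a)) *\<^sub>R u s)" for u s
  define Q where "Q u t = exp (- (\<mu> * (t - a))) *\<^sub>R (y0 + integral {a..t} (k u))" for u t
  \<comment> \<open>The fixed point is sought among bounded continuous functions on all of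
    \<open>real\<close>; clamping the argument to \<open>{a..b}\<close> makes \<open>Q u\<close>
    such a function.\<close>
  define cl where "cl t = max a (min b t)" for t
  have cl: "cl t \<in> {a..b}" and cl_id: "t \<in> {a..b} \<Longrightarrow> cl t = t" for t
    using \<open>a \<le> b\<close> by (auto simp: cl_def)
  have kcont: "continuous_on {a..b} (k u)" if "continuous_on {a..b} u" for u
  proof -
    have "continuous_on {a..b} (\<lambda>s. (s, exp (\<mu> * (s - a)) *\<^sub>R u s))"
      by (intro continuous_intros that)
    from continuous_on_compose2[OF h this] show ?thesis by (auto simp: k_def)
  qed
  have kint: "k u integrable_on {a..t}" if "continuous_on {a..b} u" "t \<in> {a..b}" for u t
    using kcont[OF that(1)] that(2)
    by (intro integrable_continuous_real) (auto intro: continuous_on_subset)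
  have Qcont: "continuous_on {a..b} (Q u)" if "continuous_on {a..b} u" for u
    unfolding Q_def using indefinite_integral_continuous_1[OF kint[OF that, of b]] \<open>a \<le> b\<close>
    by (intro continuous_intros) auto
  have Qb: "(\<lambda>t. Q u (cl t)) \<in> bcontfun" if "continuous_on {a..b} u" for u
    unfolding bcontfun_def
  proof safe
    show "continuous_on UNIV (\<lambda>t. Q u (cl t))"
      by (rule continuous_on_compose2[OF Qcont[OF that]]) (use cl in \<open>auto simp: cl_def intro!: continuous_intros\<close>)
    have "bounded (Q u ` {a..b})"
      using compact_continuous_image[OF Qcont[OF that]] compact_imp_bounded by blast
    then show "bounded (range (\<lambda>t. Q u (cl t)))"
      by (rule bounded_subset) (use cl in auto)
  qed
  define P where "P u = Bcontfun (\<lambda>t. Q (apply_bcontfun u) (cl t))" for u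
  have P: "apply_bcontfun (P u) t = Q (apply_bcontfun u) (cl t)" for u t
    unfolding P_def using Bcontfun_inverse[OF Qb] by simp
  have "dist (P u) (P v) \<le> (1/2) * dist u v" for u v
  proof (rule dist_bound)
    fix t
    let ?t = "cl t" and ?d = "dist u v"
    have t: "?t \<in> {a..b}" by (rule cl)
    have sub: "{a..?t} \<subseteq> {a..b}" using t by auto
    have I: "((\<lambda>s. L * (exp (\<mu> * (s - a)) * ?d)) has_integral
        L * (exp (\<mu> * (?t - a)) / \<mu> * ?d) - L * (exp (\<mu> * (a - a)) / \<mu> * ?d)) {a..?t}"
      using t \<open>\<mu> > 0\<close> by (intro fundamental_theorem_of_calculus)
        (auto intro!: derivative_eq_intros simp flip: has_real_derivative_iff_has_vector_derivative)
    have "norm (integral {a..?t} (\<lambda>s. k u s - k v s)) \<le> integral {a..?t} (\<lambda>s. L * (exp (\<mu> * (s - a)) * ?d))"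
    proof (rule integral_norm_bound_integral)
      show "(\<lambda>s. k u s - k v s) integrable_on {a..?t}"
        by (intro integrable_diff kint t) auto
      show "(\<lambda>s. L * (exp (\<mu> * (s - a)) * ?d)) integrable_on {a..?t}" using I by blast
      fix s assume s: "s \<in> {a..?t}"
      have "norm (k u s - k v s) \<le> L * norm (exp (\<mu> * (s - a)) *\<^sub>R u s - exp (\<mu> * (s - a)) *\<^sub>R v s)"
        unfolding k_def using s sub by (intro lip) auto
      also have "\<dots> = L * (exp (\<mu> * (s - a)) * dist (u s) (v s))"
        by (simp add: scaleR_diff_right[symmetric] dist_norm)
      also have "\<dots> \<le> L * (exp (\<mu> * (s - a)) * ?d)"
        using \<open>L \<ge> 0\<close> by (intro mult_left_mono dist_bounded) auto
      finally show "norm (k u s - k v s) \<le> L * (exp (\<mu> * (s - a)) * ?d)" .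
    qed
    also have "\<dots> = L * (exp (\<mu> * (?t - a)) / \<mu> * ?d) - L * (1 / \<mu> * ?d)"
      using integral_unique[OF I] by simp
    also have "\<dots> \<le> exp (\<mu> * (?t - a)) * (L / \<mu> * ?d)"
      using \<open>L \<ge> 0\<close> \<open>\<mu> > 0\<close> by (simp add: field_simps)
    also have "\<dots> \<le> exp (\<mu> * (?t - a)) * (1/2 * ?d)"
      using \<open>L \<ge> 0\<close> \<open>\<mu> > 0\<close> by (intro mult_left_mono mult_right_mono) (auto simp: \<mu>_def field_simps)
    finally have *: "norm (integral {a..?t} (\<lambda>s. k u s - k v s)) \<le> exp (\<mu> * (?t - a)) * (1/2 * ?d)" .
    have "P u t - P v t = exp (- (\<mu> * (?t - a))) *\<^sub>R integral {a..?t} (\<lambda>s. k u s - k v s)"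
      unfolding P Q_def using integral_diff[OF kint kint, OF _ t _ t, of u v]
      by (simp add: scaleR_diff_right[symmetric])
    then have "dist (P u t) (P v t) = exp (- (\<mu> * (?t - a))) * norm (integral {a..?t} (\<lambda>s. k u s - k v s))"
      by (simp add: dist_norm)
    also have "\<dots> \<le> exp (- (\<mu> * (?t - a))) * (exp (\<mu> * (?t - a)) * (1/2 * ?d))"
      using * by (intro mult_left_mono) auto
    also have "\<dots> = 1/2 * ?d" by (simp add: mult.assoc[symmetric] exp_add[symmetric])
    finally show "dist (P u t) (P v t) \<le> (1/2) * dist u v" .
  qed
  then obtain u where u: "P u = u"
    using banach_fix_type[of "1/2" P] by auto
  define y where "y t = y0 + integral {a..t} (k u)" for t
  have ku: "k u t = h t (y t)" if "t \<in> {a..b}" for t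
  proof -
    have "apply_bcontfun u t = exp (- (\<mu> * (t - a))) *\<^sub>R y t"
      using P[of u t] unfolding u Q_def y_def cl_id[OF that] .
    then show ?thesis unfolding k_def by (simp add: exp_add[symmetric])
  qed
  have "(y has_vector_derivative h t (y t)) (at t within {a..b})" if "t \<in> {a..b}" for t
    unfolding y_def using integral_has_vector_derivative[OF kcont[of u] that] ku[OF that]
    by (auto simp: y_def intro!: derivative_eq_intros)
  then show ?thesis by (intro exI[of _ y]) (auto simp: y_def)
qed

text \<open>The vector field lives on \<open>U\<close> only, so solutions starting near
  \<open>x a\<close> must be shown to survive until \<open>b\<close>. The unknown is therefore the
  deviation \<open>w\<close> from \<open>x\<close>. Differentiability at \<open>x a\<close> follows
  by comparing \<open>w\<close> with the solution \<open>B\<close> of the linearised equation: their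
  difference obeys a Gronwall estimate whose inhomogeneity is small compared with the initial
  deviation.\<close>

lemma ode_flow_along:
  fixes f :: "'e::euclidean_space \<Rightarrow> 'e"
  assumes "open U" "a \<le> b"
    and f': "\<And>p. p \<in> U \<Longrightarrow> (f has_derivative f' p) (at p)"
    and f'_cont: "\<And>v. continuous_on U (\<lambda>p. f' p v)"
    and xU: "\<And>t. t \<in> {a..b} \<Longrightarrow> x t \<in> U"
    and x: "\<And>t. t \<in> {a..b} \<Longrightarrow> (x has_vector_derivative f (x t)) (at t within {a..b})"
  obtains \<delta> y A where "\<delta> > 0" "ball (x a) \<delta> \<subseteq> U"
    "\<And>z. z \<in> ball (x a) \<delta> \<Longrightarrow> y z a = z"
    "\<And>z t. z \<in> ball (x a) \<delta> \<Longrightarrow> t \<in> {a..b} \<Longrightarrow> y z t \<in> U"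
    "\<And>z t. z \<in> ball (x a) \<delta> \<Longrightarrow> t \<in> {a..b} \<Longrightarrow> (y z has_vector_derivative f (y z t)) (at t within {a..b})"
    "\<And>t. t \<in> {a..b} \<Longrightarrow> y (x a) t = x t"
    "\<And>t. t \<in> {a..b} \<Longrightarrow> continuous_on (ball (x a) \<delta>) (\<lambda>z. y z t)"
    "\<And>t. t \<in> {a..b} \<Longrightarrow> ((\<lambda>z. y z t) has_derivative A t) (at (x a))"
    "\<And>t \<zeta>. t \<in> {a..b} \<Longrightarrow> ((\<lambda>s. A s \<zeta>) has_vector_derivative f' (x t) (A t \<zeta>)) (at t within {a..b})"
proof -
  have xcont: "continuous_on {a..b} x" by (rule continuous_on_vector_derivative[OF x])
  have "compact (x ` {a..b})" using xcont compact_continuous_image by blast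
  then obtain \<rho>0 where \<rho>0: "\<rho>0 > 0" "(\<Union>p\<in>x ` {a..b}. ball p \<rho>0) \<subseteq> U"
    using compact_subset_open_imp_ball_epsilon_subset[of "x ` {a..b}" U] \<open>open U\<close> xU by blast
  define \<rho> where "\<rho> = \<rho>0 / 2"
  have "\<rho> > 0" using \<rho>0 by (simp add: \<rho>_def)
  \<comment> \<open>A closed tube around the trajectory; halving \<open>\<rho>0\<close> places its
    closed balls inside open balls contained in \<open>U\<close>, and its compactness supplies all
    uniform bounds.\<close>
  define K where "K = {p + q |p q. p \<in> x ` {a..b} \<and> q \<in> cball 0 \<rho>}"
  have "compact K" unfolding K_def by (intro compact_sums \<open>compact (x ` {a..b})\<close> compact_cball)
  have KI: "x t + q \<in> K" if "t \<in> {a..b}" "norm q \<le> \<rho>" for t q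
    using that unfolding K_def by (intro CollectI exI[of _ "x t"] exI[of _ q]) auto
  have "K \<subseteq> U"
  proof
    fix p assume "p \<in> K"
    then obtain t q where "t \<in> {a..b}" "norm q \<le> \<rho>" "p = x t + q" unfolding K_def by auto
    then have "p \<in> ball (x t) \<rho>0" using \<rho>0 by (auto simp: \<rho>_def dist_norm)
    then show "p \<in> U" using \<rho>0 \<open>t \<in> {a..b}\<close> by blast
  qed
  \<comment> \<open>In finite dimension, continuity of the derivative in each fixed direction gives
    continuity in operator norm; on the tube this yields the bound \<open>L\<close> and, later,
    uniform continuity.\<close>
  define F where "F p = Blinfun (f' p)" for p
  have F: "blinfun_apply (F p) = f' p" if "p \<in> U" for p
    unfolding F_def using has_derivative_bounded_linear[OF f'[OF that]] by (rule bounded_linear_Blinfun_apply)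
  have "continuous_on U F"
    by (rule continuous_on_blinfun_componentwise) (use f'_cont F in \<open>simp cong: continuous_on_cong\<close>)
  then have FK: "continuous_on K F" using \<open>K \<subseteq> U\<close> continuous_on_subset by blast
  then have "bounded (F ` K)" using \<open>compact K\<close> compact_continuous_image compact_imp_bounded by blast
  then obtain L where L: "L > 0" "\<And>p. p \<in> K \<Longrightarrow> norm (F p) \<le> L"
    unfolding bounded_pos by auto
  define C where "C = exp ((2 * L + 1) * (b - a))"
  have "C \<ge> 1" using L(1) \<open>a \<le> b\<close> by (simp add: C_def)
  note grow = gronwall_norm[where a=a and b=b and L=L, folded C_def]
  have onormF: "onorm (f' p) = norm (F p)" if "p \<in> K" for p
    using F that \<open>K \<subseteq> U\<close> by (metis norm_blinfun.rep_eq subsetD)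
  have flip: "norm (f (x t + p) - f (x t + q)) \<le> L * norm (p - q)"
    if "t \<in> {a..b}" "norm p \<le> \<rho>" "norm q \<le> \<rho>" for t p q
  proof -
    have "norm (f (x t + p) - f (x t + q)) \<le> L * norm ((x t + p) - (x t + q))"
    proof (rule differentiable_bound)
      show "convex (cball (x t) \<rho>)" by simp
      fix y assume "y \<in> cball (x t) \<rho>"
      then have "y \<in> K" using KI[OF that(1), of "y - x t"] by (auto simp: dist_norm norm_minus_commute)
      then show "(f has_derivative f' y) (at y within cball (x t) \<rho>)" "onorm (f' y) \<le> L"
        using f' \<open>K \<subseteq> U\<close> L onormF by (auto intro: has_derivative_at_withinI)
    qed (use that in \<open>auto simp: dist_norm\<close>)
    then show ?thesis by simp
  qed
  \<comment> \<open>Retracting the deviation from \<open>x\<close> to a ball makes the equation for it globally Lipschitz;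
    small initial deviations never feel the retraction.\<close>
  define r where "r = closest_point (cball (0::'e) \<rho>)"
  have ne: "cball (0::'e) \<rho> \<noteq> {}" using \<open>\<rho> > 0\<close> by simp
  have rb: "norm (r p) \<le> \<rho>" for p
    using closest_point_in_set[OF closed_cball ne, of p] by (simp add: r_def)
  have rlip: "norm (r p - r q) \<le> norm (p - q)" for p q
    using closest_point_lipschitz[OF convex_cball closed_cball ne, of p q] by (simp add: r_def dist_norm)
  have rid: "r p = p" if "norm p \<le> \<rho>" for p
    unfolding r_def by (rule closest_point_self) (use that in simp)
  have rcont: "continuous_on S r" for S
    by (rule lipschitz_on_continuous_on[of 1]) (simp add: lipschitz_on_def dist_norm rlip)
  define h where "h t q = f (x t + r q) - f (x t)" for t q
  have fcont: "continuous_on K f"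
    using f' \<open>K \<subseteq> U\<close> by (meson continuous_at_imp_continuous_on has_derivative_continuous subsetD)
  have hlip: "norm (h t p - h t q) \<le> L * norm (p - q)" if "t \<in> {a..b}" for t p q
  proof -
    have "norm (h t p - h t q) \<le> L * norm (r p - r q)"
      unfolding h_def using flip[OF that rb rb] by simp
    also have "\<dots> \<le> L * norm (p - q)" using L(1) rlip by simp
    finally show ?thesis .
  qed
  have hcont: "continuous_on ({a..b} \<times> UNIV) (\<lambda>(t, q). h t q)"
  proof -
    have xfst: "continuous_on ({a..b} \<times> UNIV) (\<lambda>p. x (fst p))"
      by (rule continuous_on_compose2[OF xcont]) (auto intro!: continuous_intros)
    have "continuous_on ({a..b} \<times> UNIV) (\<lambda>p. f (x (fst p) + r (snd p)))"
      by (rule continuous_on_compose2[OF fcont])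
        (auto intro!: continuous_intros xfst continuous_on_compose2[OF rcont] KI rb)
    moreover have "continuous_on ({a..b} \<times> UNIV) (\<lambda>p. f (x (fst p)))"
      by (rule continuous_on_compose2[OF fcont xfst]) (use KI[of _ 0] \<open>\<rho> > 0\<close> in auto)
    ultimately show ?thesis unfolding h_def case_prod_beta by (rule continuous_on_diff)
  qed
  have "\<exists>w. w a = q \<and> (\<forall>t\<in>{a..b}. (w has_vector_derivative h t (w t)) (at t within {a..b}))" for q
    by (rule ode_lipschitz_global_solution[OF \<open>a \<le> b\<close> hcont hlip]) (use L(1) in auto)
  then obtain w where w0: "\<And>q. w q a = q"
    and w: "\<And>q t. t \<in> {a..b} \<Longrightarrow> (w q has_vector_derivative h t (w q t)) (at t within {a..b})" by metis
  have wlip: "norm (w p t - w q t) \<le> C * norm (p - q)" if "t \<in> {a..b}" for p q t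
  proof -
    have "norm (w p t - w q t) \<le> C * (norm (w p a - w q a) + 0 * (b - a + 1))"
      by (rule grow[of "\<lambda>t. w p t - w q t" "\<lambda>t. h t (w p t) - h t (w q t)"])
        (use that L(1) hlip in \<open>auto intro!: has_vector_derivative_diff w\<close>)
    then show ?thesis by (simp add: w0)
  qed
  have h0: "h t 0 = 0" for t
  proof -
    have "r 0 = 0" by (rule rid) (use \<open>\<rho> > 0\<close> in simp)
    then show ?thesis by (simp add: h_def)
  qed
  have wzero: "w 0 t = 0" if "t \<in> {a..b}" for t
  proof -
    have "norm (w 0 t) \<le> C * (norm (w 0 a) + 0 * (b - a + 1))"
    proof (rule grow[of "w 0" "\<lambda>t. h t (w 0 t)"])
      show "norm (h s (w 0 s)) \<le> L * norm (w 0 s) + 0" if "s \<in> {a..b}" for s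
        using hlip[OF that, of "w 0 s" 0] by (simp add: h0)
    qed (use that L(1) w in auto)
    then show ?thesis by (simp add: w0)
  qed
  have wbound: "norm (w q t) \<le> C * norm q" if "t \<in> {a..b}" for q t
    using wlip[OF that, of q 0] wzero[OF that] by simp
  \<comment> \<open>By \<open>wbound\<close> deviations grow at most by the factor \<open>C\<close>,
    so starting within \<delta> they stay within \<rho>, where the retraction is the
    identity.\<close>
  define \<delta> where "\<delta> = \<rho> / C"
  have "\<delta> > 0" using \<open>\<rho> > 0\<close> \<open>C \<ge> 1\<close> by (simp add: \<delta>_def)
  have wsmall: "norm (w (z - x a) t) \<le> \<rho>" if "z \<in> ball (x a) \<delta>" "t \<in> {a..b}" for z t
  proof -
    have "C * norm (z - x a) \<le> C * \<delta>" using that(1) \<open>C \<ge> 1\<close>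
      by (intro mult_left_mono) (auto simp: dist_norm norm_minus_commute)
    then show ?thesis using wbound[OF that(2), of "z - x a"] \<open>C \<ge> 1\<close> by (simp add: \<delta>_def)
  qed
  define y where "y z t = x t + w (z - x a) t" for z t
  \<comment> \<open>Right-hand side of the linearised equation along \<open>x\<close>; its solution
    \<open>B q\<close> is going to be the derivative of the flow in the direction
    \<open>q\<close>.\<close>
  define h2 where "h2 t q = blinfun_apply (F (x t)) q" for t q
  have xK: "x t \<in> K" if "t \<in> {a..b}" for t using KI[OF that, of 0] \<open>\<rho> > 0\<close> by simp
  have Fb: "norm (blinfun_apply (F (x t)) q) \<le> L * norm q" if "t \<in> {a..b}" for t q
    using norm_blinfun[of "F (x t)" q] L(2)[OF xK[OF that]]
    by (meson mult_right_mono norm_ge_zero order_trans)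
  have h2lip: "norm (h2 t p - h2 t q) \<le> L * norm (p - q)" if "t \<in> {a..b}" for t p q
    unfolding h2_def blinfun.diff_right[symmetric] by (rule Fb[OF that])
  have h2cont: "continuous_on ({a..b} \<times> UNIV) (\<lambda>(t, q). h2 t q)"
  proof -
    have "continuous_on ({a..b} \<times> UNIV) (\<lambda>p::real \<times> 'e. F (x (fst p)))"
      by (rule continuous_on_compose2[OF FK])
        (auto intro!: continuous_on_compose2[OF xcont] continuous_intros xK)
    then show ?thesis unfolding h2_def case_prod_beta by (intro continuous_intros)
  qed
  have "\<exists>w. w a = q \<and> (\<forall>t\<in>{a..b}. (w has_vector_derivative h2 t (w t)) (at t within {a..b}))" for q
    by (rule ode_lipschitz_global_solution[OF \<open>a \<le> b\<close> h2cont h2lip]) (use L(1) in auto)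
  then obtain B where B0: "\<And>q. B q a = q"
    and B: "\<And>q t. t \<in> {a..b} \<Longrightarrow> (B q has_vector_derivative F (x t) (B q t)) (at t within {a..b})"
    unfolding h2_def by metis
  \<comment> \<open>Uniqueness makes \<open>q \<mapsto> B q t\<close> linear: sums and multiples of
    solutions are solutions with the corresponding initial values.\<close>
  have Bunique: "v t = B (v a) t" if t: "t \<in> {a..b}"
    and v: "\<And>t. t \<in> {a..b} \<Longrightarrow> (v has_vector_derivative F (x t) (v t)) (at t within {a..b})" for v t
  proof -
    have "norm (v t - B (v a) t) \<le> C * (norm (v a - B (v a) a) + 0 * (b - a + 1))"
    proof (rule grow[of "\<lambda>t. v t - B (v a) t" "\<lambda>t. F (x t) (v t - B (v a) t)"])
      show "((\<lambda>t. v t - B (v a) t) has_vector_derivative F (x s) (v s - B (v a) s)) (at s within {a..b})"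
        if "s \<in> {a..b}" for s
        unfolding blinfun.diff_right by (intro has_vector_derivative_diff B v that)
    qed (use t L(1) Fb in auto)
    then show ?thesis by (simp add: B0)
  qed
  have Blin: "bounded_linear (\<lambda>q. B q t)" if "t \<in> {a..b}" for t
  proof (rule bounded_linear_intro)
    fix p q show "B (p + q) t = B p t + B q t"
      using Bunique[OF that, of "\<lambda>t. B p t + B q t", symmetric] has_vector_derivative_add[OF B B]
      by (simp add: B0 blinfun.add_right)
  next
    fix c q show "B (c *\<^sub>R q) t = c *\<^sub>R B q t"
      using Bunique[OF that, of "\<lambda>t. c *\<^sub>R B q t", symmetric]
        bounded_linear.has_vector_derivative[OF bounded_linear_scaleR_right B]
      by (simp add: B0 blinfun.scaleR_right)
  next
    fix q show "norm (B q t) \<le> norm q * C"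
    proof -
      have "norm (B q t) \<le> C * (norm (B q a) + 0 * (b - a + 1))"
        by (rule grow[of "B q" "\<lambda>t. F (x t) (B q t)"]) (use that L(1) Fb B in auto)
      then show ?thesis by (simp add: B0 mult.commute)
    qed
  qed
  have deriv: "((\<lambda>z. y z t) has_derivative (\<lambda>q. B q t)) (at (x a))" if t: "t \<in> {a..b}" for t
    unfolding has_derivative_at_alt
  proof (intro conjI allI impI Blin[OF t])
    fix e :: real assume "e > 0"
    \<comment> \<open>Chosen so that the factors collected below, one \<open>C\<close> from
      Gronwall, one \<open>C\<close> from \<open>wbound\<close> and \<open>b - a + 1\<close> from
      the inhomogeneity, multiply back to \<open>e\<close>.\<close>
    define e' where "e' = e / (C * C * (b - a + 1))"
    have "e' > 0" using \<open>e > 0\<close> \<open>C \<ge> 1\<close> \<open>a \<le> b\<close> unfolding e'_def by (intro divide_pos_pos mult_pos_pos) auto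
    have "uniformly_continuous_on K F" using FK \<open>compact K\<close> compact_uniformly_continuous by blast
    then obtain d where d: "d > 0" "\<And>p q. p \<in> K \<Longrightarrow> q \<in> K \<Longrightarrow> dist q p < d \<Longrightarrow> dist (F q) (F p) < e'"
      using \<open>e' > 0\<close> unfolding uniformly_continuous_on_def by blast
    define d' where "d' = min \<delta> (d / C)"
    have "d' > 0" using d(1) \<open>\<delta> > 0\<close> \<open>C \<ge> 1\<close> by (simp add: d'_def)
    have "norm (y z t - y (x a) t - B (z - x a) t) \<le> e * norm (z - x a)" if z: "norm (z - x a) < d'" for z
    proof -
      have zb: "z \<in> ball (x a) \<delta>" using z by (simp add: d'_def dist_norm norm_minus_commute)
      define q where "q = z - x a"
      have lin: "norm (f (x s + w q s) - f (x s) - F (x s) (w q s)) \<le> e' * (C * norm q)" if s: "s \<in> {a..b}" for s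
      proof -
        have ws: "norm (w q s) \<le> \<rho>" using wsmall[OF zb s] by (simp add: q_def)
        have wd: "norm (w q s) < d"
        proof -
          have "C * norm q < C * (d / C)" using z \<open>C \<ge> 1\<close> unfolding q_def d'_def
            by (intro mult_strict_left_mono) auto
          then show ?thesis using wbound[OF s, of q] \<open>C \<ge> 1\<close> by simp
        qed
        define V where "V = cball (x s) (norm (w q s))"
        have V: "p \<in> K \<and> dist p (x s) < d" if "p \<in> V" for p
          using KI[OF s, of "p - x s"] that ws wd unfolding V_def by (auto simp: dist_norm norm_minus_commute)
        have "norm (f (x s + w q s) - f (x s) - f' (x s) (x s + w q s - x s)) \<le> norm (x s + w q s - x s) * e'"
        proof (rule differentiable_bound_linearization[of "x s" "x s + w q s" V f f' "x s" e'])
          show "x s \<in> V" by (simp add: V_def)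
          fix \<tau> :: real assume "\<tau> \<in> {0..1}"
          then show "x s + \<tau> *\<^sub>R (x s + w q s - x s) \<in> V"
            by (simp add: V_def dist_norm mult_left_le_one_le)
        next
          fix p assume "p \<in> V"
          then have p: "p \<in> K" "dist p (x s) < d" using V by auto
          then show "(f has_derivative f' p) (at p within V)"
            using f' \<open>K \<subseteq> U\<close> has_derivative_at_withinI by blast
          have "onorm (f' p - f' (x s)) = norm (F p - F (x s))"
          proof -
            have "blinfun_apply (F p - F (x s)) = f' p - f' (x s)"
              using F[OF subsetD[OF \<open>K \<subseteq> U\<close> p(1)]] F[OF subsetD[OF \<open>K \<subseteq> U\<close> xK[OF s]]]
              by (simp add: fun_eq_iff blinfun.diff_left)
            then show ?thesis by (metis norm_blinfun.rep_eq)
          qed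
          also have "\<dots> < e'" using d(2)[OF xK[OF s] p] by (simp add: dist_norm)
          finally show "onorm (f' p - f' (x s)) \<le> e'" by simp
        qed
        then have "norm (f (x s + w q s) - f (x s) - F (x s) (w q s)) \<le> norm (w q s) * e'"
          using F xK[OF s] \<open>K \<subseteq> U\<close> by auto
        also have "\<dots> \<le> e' * (C * norm q)"
          using wbound[OF s, of q] \<open>e' > 0\<close> by (subst mult.commute) (intro mult_left_mono, auto)
        finally show ?thesis .
      qed
      have "norm (w q t - B q t) \<le> C * (norm (w q a - B q a) + e' * (C * norm q) * (b - a + 1))"
      proof (rule grow[of "\<lambda>t. w q t - B q t" "\<lambda>t. h t (w q t) - F (x t) (B q t)"])
        fix s assume s: "s \<in> {a..b}"
        show "((\<lambda>t. w q t - B q t) has_vector_derivative h s (w q s) - F (x s) (B q s)) (at s within {a..b})"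
          by (intro has_vector_derivative_diff w B s)
        \<comment> \<open>The retraction is inert at this size of the deviation, so the difference
          splits into the linear part and the Taylor remainder estimated in
          \<open>lin\<close>.\<close>
        have "h s (w q s) - F (x s) (B q s) =
            F (x s) (w q s - B q s) + (f (x s + w q s) - f (x s) - F (x s) (w q s))"
          using wsmall[OF zb s] by (simp add: h_def rid q_def blinfun.diff_right)
        then show "norm (h s (w q s) - F (x s) (B q s)) \<le> L * norm (w q s - B q s) + e' * (C * norm q)"
          using norm_triangle_mono[OF Fb[OF s] lin[OF s]] by simp
      qed (use t L(1) \<open>e' > 0\<close> \<open>C \<ge> 1\<close> in auto)
      also have "\<dots> = e * norm q"
      proof -
        have "C * C * (b - a + 1) > 0" using \<open>C \<ge> 1\<close> \<open>a \<le> b\<close> by (intro mult_pos_pos) auto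
        then have "e' * (C * C * (b - a + 1)) = e" unfolding e'_def by (metis less_irrefl nonzero_divide_eq_eq)
        then show ?thesis by (simp add: w0 B0 mult_ac)
      qed
      finally show ?thesis using wzero[OF t] by (simp add: y_def q_def)
    qed
    then show "\<exists>d>0. \<forall>z. norm (z - x a) < d \<longrightarrow> norm (y z t - y (x a) t - B (z - x a) t) \<le> e * norm (z - x a)"
      using \<open>d' > 0\<close> by blast
  qed
  show ?thesis
  proof (rule that[of \<delta> y "\<lambda>t q. B q t", OF \<open>\<delta> > 0\<close>])
    show "ball (x a) \<delta> \<subseteq> U"
    proof
      fix z assume z: "z \<in> ball (x a) \<delta>"
      then show "z \<in> U" using wsmall[OF z, of a] KI[of a "z - x a"] w0 \<open>a \<le> b\<close> \<open>K \<subseteq> U\<close> by auto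
    qed
    show "y z a = z" for z by (simp add: y_def w0)
    show "y z t \<in> U" if "z \<in> ball (x a) \<delta>" "t \<in> {a..b}" for z t
      unfolding y_def using KI[OF that(2) wsmall[OF that]] \<open>K \<subseteq> U\<close> by blast
    show "(y z has_vector_derivative f (y z t)) (at t within {a..b})"
      if "z \<in> ball (x a) \<delta>" "t \<in> {a..b}" for z t
      unfolding y_def using has_vector_derivative_add[OF x[OF that(2)] w[OF that(2), of "z - x a"]]
        wsmall[OF that] by (simp add: h_def rid)
    show "y (x a) t = x t" if "t \<in> {a..b}" for t using wzero[OF that] by (simp add: y_def)
    show "continuous_on (ball (x a) \<delta>) (\<lambda>z. y z t)" if "t \<in> {a..b}" for t
    proof (rule continuous_on_subset[of UNIV])
      have "C-lipschitz_on UNIV (\<lambda>z. y z t)"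
      proof (rule lipschitz_onI)
        show "dist (y p t) (y q t) \<le> C * dist p q" for p q
          using wlip[OF that, of "p - x a" "q - x a"] by (simp add: y_def dist_norm)
      qed (use \<open>C \<ge> 1\<close> in simp)
      then show "continuous_on UNIV (\<lambda>z. y z t)" by (rule lipschitz_on_continuous_on)
    qed simp
    show "((\<lambda>z. y z t) has_derivative (\<lambda>q. B q t)) (at (x a))" if "t \<in> {a..b}" for t by (rule deriv[OF that])
    show "((\<lambda>s. B \<zeta> s) has_vector_derivative f' (x t) (B \<zeta> t)) (at t within {a..b})" if "t \<in> {a..b}" for t \<zeta>
      using B[OF that, of \<zeta>] F xK[OF that] \<open>K \<subseteq> U\<close> by auto
  qed
qed

section \<open>Transition maps and the tangent bundle\<close>

lemma linear_family_derivative_linear: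
  fixes L :: "'v::real_normed_vector \<Rightarrow> 'e::real_vector \<Rightarrow> 'w::real_normed_vector"
  assumes "open Q" "x \<in> Q" and lin: "\<And>y. y \<in> Q \<Longrightarrow> linear (L y)"
    and DL: "\<And>v. ((\<lambda>y. L y v) has_derivative DL v) (at x)"
  shows "linear (\<lambda>v. DL v e)"
proof (rule linearI)
  fix u v
  have "((\<lambda>y. L y (u + v)) has_derivative (\<lambda>e. DL u e + DL v e)) (at x)"
    by (rule has_derivative_transform_within_open[OF has_derivative_add[OF DL DL] assms(1,2)])
      (simp add: linear_add[OF lin])
  from has_derivative_unique[OF DL this] show "DL (u + v) e = DL u e + DL v e" by metis
next
  fix r v
  have "((\<lambda>y. L y (r *\<^sub>R v)) has_derivative (\<lambda>e. r *\<^sub>R DL v e)) (at x)"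
    by (rule has_derivative_transform_within_open[OF has_derivative_scaleR_right[OF DL] assms(1,2)])
      (simp add: linear_scale[OF lin])
  from has_derivative_unique[OF DL this] show "DL (r *\<^sub>R v) e = r *\<^sub>R DL v e" by metis
qed

text \<open>\<open>L\<close> is differentiable for each fixed vector only. Expanding
  \<open>v y\<close> in \<open>Basis\<close> turns the moving vector into scalar coefficients, and
  the linearity of \<open>DL\<close> in the vector reassembles the sum.\<close>

lemma has_derivative_linear_family:
  fixes L :: "'v::real_normed_vector \<Rightarrow> 'e::euclidean_space \<Rightarrow> 'w::real_normed_vector"
  assumes "open Q" and lin: "\<And>y. y \<in> Q \<Longrightarrow> linear (L y)" and "x \<in> S" and pQ: "\<And>y. y \<in> S \<Longrightarrow> p y \<in> Q"
    and DL: "\<And>v. ((\<lambda>y. L y v) has_derivative DL v) (at (p x))"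
    and p: "(p has_derivative p') (at x within S)" and v: "(v has_derivative v') (at x within S)"
  shows "((\<lambda>y. L (p y) (v y)) has_derivative (\<lambda>e. DL (v x) (p' e) + L (p x) (v' e))) (at x within S)"
proof -
  have "((\<lambda>y. \<Sum>b\<in>Basis. (v y \<bullet> b) *\<^sub>R L (p y) b) has_derivative
    (\<lambda>e. \<Sum>b\<in>Basis. (v x \<bullet> b) *\<^sub>R DL b (p' e) + (v' e \<bullet> b) *\<^sub>R L (p x) b)) (at x within S)"
    by (intro has_derivative_sum has_derivative_scaleR has_derivative_compose[OF p DL] has_derivative_inner_left v)
  moreover have "L (p y) (v y) = (\<Sum>b\<in>Basis. (v y \<bullet> b) *\<^sub>R L (p y) b)" if "y \<in> S" for y
    by (rule linear_eq_sum_Basis[OF lin[OF pQ[OF that]]])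
  ultimately have *: "((\<lambda>y. L (p y) (v y)) has_derivative
    (\<lambda>e. \<Sum>b\<in>Basis. (v x \<bullet> b) *\<^sub>R DL b (p' e) + (v' e \<bullet> b) *\<^sub>R L (p x) b)) (at x within S)"
    using has_derivative_transform[OF \<open>x \<in> S\<close>] by (metis (no_types, lifting))
  have "DL (v x) (p' e) = (\<Sum>b\<in>Basis. (v x \<bullet> b) *\<^sub>R DL b (p' e))" for e
    by (rule linear_eq_sum_Basis[OF linear_family_derivative_linear[OF \<open>open Q\<close> pQ[OF \<open>x \<in> S\<close>] lin DL]])
  moreover have "L (p x) (v' e) = (\<Sum>b\<in>Basis. (v' e \<bullet> b) *\<^sub>R L (p x) b)" for e
    by (rule linear_eq_sum_Basis[OF lin[OF pQ[OF \<open>x \<in> S\<close>]]])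
  ultimately show ?thesis
    using * by (simp add: sum.distrib)
qed

text \<open>The linear case twice: with the middle argument frozen, \<open>B\<close> is a linear
  family in the last one; the result is a linear family in the middle argument over the enlarged
  base point \<open>(p, v)\<close>.\<close>

lemma has_derivative_bilinear_family:
  fixes B :: "'v::euclidean_space \<Rightarrow> 'e::euclidean_space \<Rightarrow> 'f::euclidean_space \<Rightarrow> 'w::real_normed_vector"
  assumes "open Q" and lin1: "\<And>y v. y \<in> Q \<Longrightarrow> linear (\<lambda>u. B y u v)" and lin2: "\<And>y u. y \<in> Q \<Longrightarrow> linear (B y u)"
    and "x \<in> S" and pQ: "\<And>y. y \<in> S \<Longrightarrow> p y \<in> Q"
    and DB: "\<And>u v. ((\<lambda>y. B y u v) has_derivative DB u v) (at (p x))"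
    and p: "(p has_derivative p') (at x within S)"
    and u: "(u has_derivative u') (at x within S)" and v: "(v has_derivative v') (at x within S)"
  shows "((\<lambda>y. B (p y) (u y) (v y)) has_derivative
    (\<lambda>e. DB (u x) (v x) (p' e) + B (p x) (u' e) (v x) + B (p x) (u x) (v' e))) (at x within S)"
proof -
  have inner: "((\<lambda>q. B (fst q) a (snd q)) has_derivative
      (\<lambda>e. DB a (v x) (fst e) + B (p x) a (snd e))) (at (p x, v x))" for a
  proof -
    have "((\<lambda>q. B (fst q) a (snd q)) has_derivative
      (\<lambda>e. DB a (snd (p x, v x)) (fst e) + B (fst (p x, v x)) a (snd e))) (at (p x, v x) within Q \<times> UNIV)"
    proof (rule has_derivative_linear_family[where Q=Q and L="\<lambda>y. B y a" and p=fst and v=snd and DL="DB a"])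
      show "((\<lambda>y. B y a v') has_derivative DB a v') (at (fst (p x, v x)))" for v'
        using DB by simp
      show "(fst has_derivative fst) (at (p x, v x) within Q \<times> UNIV)"
        "(snd has_derivative snd) (at (p x, v x) within Q \<times> UNIV)"
        by (intro bounded_linear_imp_has_derivative bounded_linear_fst bounded_linear_snd)+
    qed (use pQ[OF \<open>x \<in> S\<close>] \<open>open Q\<close> lin2 in auto)
    moreover have "at (p x, v x) within Q \<times> UNIV = at (p x, v x)"
      using pQ[OF \<open>x \<in> S\<close>] \<open>open Q\<close> by (intro at_within_open open_Times) auto
    ultimately show ?thesis by simp
  qed
  have "((\<lambda>y. B (fst (p y, v y)) (u y) (snd (p y, v y))) has_derivative
    (\<lambda>e. DB (u x) (v x) (fst (p' e, v' e)) + B (p x) (u x) (snd (p' e, v' e)) + B (fst (p x, v x)) (u' e) (snd (p x, v x))))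
    (at x within S)"
    by (rule has_derivative_linear_family[where Q="Q \<times> UNIV" and L="\<lambda>q a. B (fst q) a (snd q)" and p="\<lambda>y. (p y, v y)"])
      (use \<open>open Q\<close> lin1 pQ \<open>x \<in> S\<close> inner p u v in \<open>auto intro!: open_Times has_derivative_Pair\<close>)
  then show ?thesis by (simp add: add_ac)
qed

lemma has_derivative_frechet_derivative_apply:
  fixes h :: "'e::euclidean_space \<Rightarrow> 'w::real_normed_vector"
  assumes "Ck (Suc (Suc 0)) Q h" "open Q" and pQ: "\<And>y. y \<in> S \<Longrightarrow> p y \<in> Q" and "x \<in> S"
    and p: "(p has_derivative p') (at x within S)" and v: "(v has_derivative v') (at x within S)"
  shows "((\<lambda>y. frechet_derivative h (at (p y)) (v y)) has_derivative
    (\<lambda>e. frechet_derivative (\<lambda>q. frechet_derivative h (at q) (v x)) (at (p x)) (p' e) +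
         frechet_derivative h (at (p x)) (v' e))) (at x within S)"
  by (rule has_derivative_linear_family[OF assms(2) Ck_Suc_linear[OF assms(1,2)] \<open>x \<in> S\<close> pQ
      Ck_Suc_has_derivative[OF Ck_frechet_derivative[OF assms(1,2)] assms(2) pQ[OF \<open>x \<in> S\<close>]] p v])

text \<open>The linearised flows of related vector fields are related by the derivative of the map,
  because the second derivative of the map is symmetric.\<close>

lemma related_linearization:
  fixes \<phi> :: "'e::euclidean_space \<Rightarrow> 'f::euclidean_space"
  assumes \<phi>: "Ck (Suc (Suc 0)) Q \<phi>" "open Q" "\<phi> ` Q \<subseteq> V" and f: "Ck (Suc 0) Q f" and h: "Ck (Suc 0) V h" "open V"
    and related: "\<And>p. p \<in> Q \<Longrightarrow> frechet_derivative \<phi> (at p) (f p) = h (\<phi> p)"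
    and "t \<in> I" and zt: "z t \<in> Q"
    and z: "(z has_vector_derivative f (z t)) (at t within I)"
    and \<zeta>: "(\<zeta> has_vector_derivative frechet_derivative f (at (z t)) (\<zeta> t)) (at t within I)"
  shows "((\<lambda>t. frechet_derivative \<phi> (at (z t)) (\<zeta> t)) has_vector_derivative
    frechet_derivative h (at (\<phi> (z t))) (frechet_derivative \<phi> (at (z t)) (\<zeta> t))) (at t within I)"
proof -
  define D where "D q = frechet_derivative \<phi> (at q)" for q
  define D2 where "D2 v u = frechet_derivative (\<lambda>q. D q v) (at (z t)) u" for u v
  have lin: "linear (D (z t))" unfolding D_def using Ck_Suc_linear[OF \<phi>(1,2) zt] .
  have linD2: "linear (D2 v)" for v
    unfolding D2_def D_def using Ck_Suc_linear[OF Ck_frechet_derivative[OF \<phi>(1,2)] \<phi>(2) zt] .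
  have sym: "D2 u v = D2 v u" for u v
    unfolding D2_def D_def
    using second_derivative_symmetric[OF \<phi>(1)[folded numeral_2_eq_2] \<phi>(2) zt] .
  \<comment> \<open>Both sides of \<open>related\<close> are differentiated at \<open>z t\<close>,
    the left by the product rule here, the right by the chain rule below; comparison gives the
    identity 2, in which \<open>D2 (f (z t))\<close> still has to be turned around by
    \<open>sym\<close>.\<close>
  have "((\<lambda>q. D q (f q)) has_derivative (\<lambda>e. D2 (f (z t)) e + D (z t) (frechet_derivative f (at (z t)) e))) (at (z t) within Q)"
    unfolding D_def D2_def using has_derivative_frechet_derivative_apply[OF \<phi>(1,2) _ zt, where p="\<lambda>q. q" and p'="\<lambda>e. e" and v=f]
      Ck_Suc_has_derivative[OF f \<phi>(2) zt] by (simp add: has_derivative_at_withinI)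
  then have 1: "((\<lambda>q. D q (f q)) has_derivative (\<lambda>e. D2 (f (z t)) e + D (z t) (frechet_derivative f (at (z t)) e))) (at (z t))"
    by (simp add: at_within_open[OF zt \<phi>(2)])
  have "((\<lambda>q. h (\<phi> q)) has_derivative (\<lambda>e. frechet_derivative h (at (\<phi> (z t))) (D (z t) e))) (at (z t))"
    unfolding D_def using \<phi>(3) zt
    by (intro has_derivative_compose[OF Ck_Suc_has_derivative[OF \<phi>(1,2) zt] Ck_Suc_has_derivative[OF h]]) auto
  then have "((\<lambda>q. D q (f q)) has_derivative (\<lambda>e. frechet_derivative h (at (\<phi> (z t))) (D (z t) e))) (at (z t))"
    by (rule has_derivative_transform_within_open[OF _ \<phi>(2) zt]) (simp add: D_def related)
  from has_derivative_unique[OF this 1]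
  have 2: "frechet_derivative h (at (\<phi> (z t))) (D (z t) e) =
      D2 (f (z t)) e + D (z t) (frechet_derivative f (at (z t)) e)" for e
    by metis
  have "\<forall>\<^sub>F s in at t within I. z s \<in> Q"
    using has_vector_derivative_continuous[OF z] \<phi>(2) zt
    unfolding continuous_within by (rule topological_tendstoD)
  then obtain B where B: "open B" "t \<in> B" "\<And>s. s \<in> B \<Longrightarrow> s \<in> I \<Longrightarrow> z s \<in> Q"
    unfolding eventually_at_topological using zt by metis
  have at: "at t within (I \<inter> B) = at t within I"
    by (rule at_within_nhd[OF \<open>t \<in> B\<close> \<open>open B\<close>]) auto
  have "((\<lambda>t. D (z t) (\<zeta> t)) has_derivative
      (\<lambda>r. D2 (\<zeta> t) (r *\<^sub>R f (z t)) + D (z t) (r *\<^sub>R frechet_derivative f (at (z t)) (\<zeta> t)))) (at t within (I \<inter> B))"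
    unfolding D_def D2_def
    by (rule has_derivative_frechet_derivative_apply[OF \<phi>(1,2)])
      (use z \<zeta> B \<open>t \<in> I\<close> in \<open>auto simp: at has_vector_derivative_def\<close>)
  then show ?thesis
    unfolding D_def[symmetric] 2 has_vector_derivative_def at
    by (simp add: linear_scale[OF lin] linear_scale[OF linD2] sym[of "\<zeta> t"] scaleR_right_distrib)
qed

section \<open>Charts, transition maps and bundle charts\<close>

context smooth_manifold
begin

definition overlap :: "('a, 'n) chart \<Rightarrow> ('a, 'n) chart \<Rightarrow> (real^'n) set" where
  "overlap c d = cmap c ` (cdom c \<inter> cdom d)"

definition transition :: "('a, 'n) chart \<Rightarrow> ('a, 'n) chart \<Rightarrow> real^'n \<Rightarrow> real^'n" where
  "transition c d = cmap d \<circ> cinv c"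

definition dtrans :: "('a, 'n) chart \<Rightarrow> ('a, 'n) chart \<Rightarrow> real^'n \<Rightarrow> real^'n \<Rightarrow> real^'n" where
  "dtrans c d x = frechet_derivative (transition c d) (at x)"

lemma cdom_subset_topspace: "c \<in> \<A> \<Longrightarrow> cdom c \<subseteq> topspace X"
  using chart_open openin_subset by blast

lemma cmap_inj: "c \<in> \<A> \<Longrightarrow> inj_on (cmap c) (cdom c)"
  using homeomorphic_imp_injective_map[OF chart_homeo] cdom_subset_topspace
  by (metis inf.absorb_iff2 topspace_subtopology)

lemma cinv_cmap: "c \<in> \<A> \<Longrightarrow> p \<in> cdom c \<Longrightarrow> cinv c (cmap c p) = p"
  using cmap_inj by (rule inv_into_f_f)

lemma cinv_in: "x \<in> cimg c \<Longrightarrow> cinv c x \<in> cdom c"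
  by (rule inv_into_into)

lemma cmap_cinv: "x \<in> cimg c \<Longrightarrow> cmap c (cinv c x) = x"
  by (rule f_inv_into_f)

lemma open_cmap_image:
  assumes "c \<in> \<A>" "openin X U"
  shows "open (cmap c ` (cdom c \<inter> U))"
proof -
  have "openin (subtopology X (cdom c)) (cdom c \<inter> U)"
    using assms(2) by (metis inf_commute openin_subtopology)
  then have "openin (top_of_set (cimg c)) (cmap c ` (cdom c \<inter> U))"
    using homeomorphic_imp_open_map[OF chart_homeo[OF assms(1)]] by (simp add: open_map_def)
  then show ?thesis using openin_open_eq[OF chart_image_open[OF assms(1)]] by blast
qed

lemma open_overlap: "c \<in> \<A> \<Longrightarrow> d \<in> \<A> \<Longrightarrow> open (overlap c d)"
  unfolding overlap_def by (intro open_cmap_image chart_open)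

lemma overlap_subset: "overlap c d \<subseteq> cimg c"
  unfolding overlap_def by blast

lemma overlap_iff: "c \<in> \<A> \<Longrightarrow> x \<in> overlap c d \<longleftrightarrow> x \<in> cimg c \<and> cinv c x \<in> cdom d"
  unfolding overlap_def
  by (auto simp: cinv_cmap)

lemma cmap_in_overlap: "p \<in> cdom c \<Longrightarrow> p \<in> cdom d \<Longrightarrow> cmap c p \<in> overlap c d"
  unfolding overlap_def by blast

lemma transition_in_overlap: "c \<in> \<A> \<Longrightarrow> d \<in> \<A> \<Longrightarrow> x \<in> overlap c d \<Longrightarrow> transition c d x \<in> overlap d c"
  by (auto simp: overlap_def transition_def cinv_cmap)

lemma transition_cmap: "c \<in> \<A> \<Longrightarrow> p \<in> cdom c \<Longrightarrow> transition c d (cmap c p) = cmap d p"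
  by (simp add: transition_def cinv_cmap)

lemma Ck_transition: "c \<in> \<A> \<Longrightarrow> d \<in> \<A> \<Longrightarrow> Ck k (overlap c d) (transition c d)"
  using transition_smooth unfolding smooth_on_def overlap_def transition_def by blast

lemma transition_has_derivative:
  "c \<in> \<A> \<Longrightarrow> d \<in> \<A> \<Longrightarrow> x \<in> overlap c d \<Longrightarrow> (transition c d has_derivative dtrans c d x) (at x)"
  unfolding dtrans_def by (rule Ck_Suc_has_derivative[OF Ck_transition open_overlap])

lemma linear_dtrans: "c \<in> \<A> \<Longrightarrow> d \<in> \<A> \<Longrightarrow> x \<in> overlap c d \<Longrightarrow> linear (dtrans c d x)"
  using transition_has_derivative has_derivative_linear by blast

lemma dtrans_self:
  assumes "c \<in> \<A>" "x \<in> cimg c"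
  shows "dtrans c c x = id"
proof -
  have "(id has_derivative id) (at x)" by (simp add: id_def)
  then have "(transition c c has_derivative id) (at x)"
    by (rule has_derivative_transform_within_open[OF _ chart_image_open[OF assms(1)] assms(2)])
      (simp add: transition_def cmap_cinv)
  then show ?thesis unfolding dtrans_def by (rule frechet_derivative_at[symmetric])
qed

text \<open>Chain rule for the cocycle identity of transition maps; this is what makes the
  components listed by \<open>tvec_of\<close> consistent.\<close>

lemma dtrans_compose:
  assumes "c \<in> \<A>" "d \<in> \<A>" "e \<in> \<A>" "x \<in> overlap c d" "x \<in> overlap c e"
  shows "dtrans c e x v = dtrans d e (transition c d x) (dtrans c d x v)"
proof -
  have y: "transition c d x \<in> overlap d e"
    using assms by (auto simp: overlap_iff transition_def cinv_cmap cinv_in)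
  have "((\<lambda>y. transition d e (transition c d y)) has_derivative (\<lambda>v. dtrans d e (transition c d x) (dtrans c d x v))) (at x)"
    by (rule has_derivative_compose[OF transition_has_derivative transition_has_derivative]) (use assms y in auto)
  then have "(transition c e has_derivative (\<lambda>v. dtrans d e (transition c d x) (dtrans c d x v))) (at x)"
    by (rule has_derivative_transform_within_open[OF _ open_overlap[OF assms(1,2)] assms(4)])
      (use assms in \<open>auto simp: transition_def overlap_iff cinv_cmap\<close>)
  then show ?thesis unfolding dtrans_def by (metis frechet_derivative_at)
qed

lemma dtrans_inverse:
  assumes "c \<in> \<A>" "d \<in> \<A>" "x \<in> overlap c d"
  shows "dtrans d c (transition c d x) (dtrans c d x v) = v"
  using dtrans_compose[OF assms(1,2,1,3)] dtrans_self[OF assms(1)] assms(3)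
  by (force simp: overlap_iff[OF assms(1)] cinv_in)

lemma charts_atD: "c \<in> charts_at p \<Longrightarrow> c \<in> \<A> \<and> p \<in> cdom c"
  by (simp add: charts_at_def)

lemma charts_at_exists: "p \<in> topspace X \<Longrightarrow> \<exists>c. c \<in> charts_at p"
  using charts_cover unfolding charts_at_def by blast

lemma tvec_of_apply:
  "d \<in> charts_at p \<Longrightarrow> tvec_of c p w d = dtrans c d (cmap c p) w"
  by (simp add: tvec_of_def dtrans_def transition_def)

lemma tvec_of_eq: "tvec_of c p w = (\<lambda>d\<in>charts_at p. dtrans c d (cmap c p) w)"
  by (simp add: tvec_of_def dtrans_def transition_def)

lemma tangent_space_iff:
  "v \<in> tangent_space p \<longleftrightarrow> v \<in> extensional (charts_at p) \<and>
    (\<forall>c\<in>charts_at p. \<forall>d\<in>charts_at p. v d = dtrans c d (cmap c p) (v c))"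
  by (simp add: tangent_space_def dtrans_def transition_def)

lemma tvec_of_tangent:
  assumes "c \<in> \<A>" "p \<in> cdom c"
  shows "tvec_of c p w \<in> tangent_space p"
  unfolding tangent_space_iff
proof (intro conjI ballI)
  show "tvec_of c p w \<in> extensional (charts_at p)" by (simp add: tvec_of_def)
  fix d e assume de: "d \<in> charts_at p" "e \<in> charts_at p"
  have "dtrans c e (cmap c p) w = dtrans d e (transition c d (cmap c p)) (dtrans c d (cmap c p) w)"
    using assms de by (intro dtrans_compose cmap_in_overlap) (auto dest: charts_atD)
  then show "tvec_of c p w e = dtrans d e (cmap d p) (tvec_of c p w d)"
    using de assms by (simp add: tvec_of_apply transition_cmap)
qed

lemma tvec_of_self: "c \<in> \<A> \<Longrightarrow> p \<in> cdom c \<Longrightarrow> tvec_of c p w c = w"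
  using dtrans_self[of c "cmap c p"] by (simp add: tvec_of_apply charts_at_def)

lemma tangent_space_transform:
  assumes "v \<in> tangent_space p" "c \<in> charts_at p" "d \<in> charts_at p"
  shows "v d = dtrans c d (cmap c p) (v c)"
  by (rule bspec[OF bspec[OF conjunct2[OF assms(1)[unfolded tangent_space_iff]] assms(2)] assms(3)])

lemma tangent_eqI:
  assumes "u \<in> tangent_space p" "v \<in> tangent_space p" "c \<in> charts_at p" "u c = v c"
  shows "u = v"
proof (rule extensionalityI)
  show "u \<in> extensional (charts_at p)" "v \<in> extensional (charts_at p)"
    by (rule conjunct1[OF assms(1)[unfolded tangent_space_iff]] conjunct1[OF assms(2)[unfolded tangent_space_iff]])+
  show "u d = v d" if "d \<in> charts_at p" for d
    using tangent_space_transform[OF assms(1,3) that] tangent_space_transform[OF assms(2,3) that] assms(4)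
    by simp
qed

lemma tvec_of_component:
  "v \<in> tangent_space p \<Longrightarrow> c \<in> charts_at p \<Longrightarrow> tvec_of c p (v c) = v"
  by (rule tangent_eqI[of _ p _ c]) (auto simp: tvec_of_tangent tvec_of_self dest: charts_atD)

lemma tvec_of_dtrans:
  assumes "c \<in> charts_at p" "d \<in> charts_at p"
  shows "tvec_of d p (dtrans c d (cmap c p) w) = tvec_of c p w"
  using assms tvec_of_tangent[of c p w] tvec_of_tangent[of d p] tvec_of_self[of d p]
  by (intro tangent_eqI[of _ p _ d]) (auto simp: tvec_of_apply dest: charts_atD)

lemma tvec_of_linear:
  assumes "c \<in> charts_at p"
  shows "tvec_of c p (u + v) = add_tvec p (tvec_of c p u) (tvec_of c p v)"
    and "tvec_of c p (r *\<^sub>R u) = scale_tvec p r (tvec_of c p u)"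
    and "tvec_of c p 0 = zero_tvec p"
proof -
  have lin: "linear (dtrans c d (cmap c p))" if "d \<in> charts_at p" for d
    using assms that by (intro linear_dtrans cmap_in_overlap) (auto dest: charts_atD)
  show "tvec_of c p (u + v) = add_tvec p (tvec_of c p u) (tvec_of c p v)"
    unfolding add_tvec_def tvec_of_eq by (rule restrict_ext) (simp add: linear_add[OF lin])
  show "tvec_of c p (r *\<^sub>R u) = scale_tvec p r (tvec_of c p u)"
    unfolding scale_tvec_def tvec_of_eq by (rule restrict_ext) (simp add: linear_scale[OF lin])
  show "tvec_of c p 0 = zero_tvec p"
    unfolding zero_tvec_def tvec_of_eq by (rule restrict_ext) (simp add: linear_0[OF lin])
qed

subsection \<open>Bundle charts\<close>

definition bundle_dom :: "('a, 'n) chart \<Rightarrow> ((real^'n) \<times> (real^'n)) set" where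
  "bundle_dom c = cimg c \<times> UNIV"

definition bundle_overlap :: "('a, 'n) chart \<Rightarrow> ('a, 'n) chart \<Rightarrow> ((real^'n) \<times> (real^'n)) set" where
  "bundle_overlap c d = overlap c d \<times> UNIV"

definition coords :: "('a, 'n) chart \<Rightarrow> 'a \<times> ('a, 'n) tvec \<Rightarrow> (real^'n) \<times> (real^'n)" where
  "coords c P = (cmap c (fst P), snd P c)"

definition point_of :: "('a, 'n) chart \<Rightarrow> (real^'n) \<times> (real^'n) \<Rightarrow> 'a \<times> ('a, 'n) tvec" where
  "point_of c z = (cinv c (fst z), tvec_of c (cinv c (fst z)) (snd z))"

text \<open>The tangent map of \<open>transition c d\<close>, written out so that its smoothness can
  be read off; \<open>coords_point_of\<close> identifies it with the change of bundle
  charts.\<close>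

definition btrans :: "('a, 'n) chart \<Rightarrow> ('a, 'n) chart \<Rightarrow> (real^'n) \<times> (real^'n) \<Rightarrow> (real^'n) \<times> (real^'n)" where
  "btrans c d z = (transition c d (fst z), dtrans c d (fst z) (snd z))"

lemma open_bundle_dom: "c \<in> \<A> \<Longrightarrow> open (bundle_dom c)"
  unfolding bundle_dom_def by (intro open_Times chart_image_open open_UNIV)

lemma open_bundle_overlap: "c \<in> \<A> \<Longrightarrow> d \<in> \<A> \<Longrightarrow> open (bundle_overlap c d)"
  unfolding bundle_overlap_def by (intro open_Times open_overlap open_UNIV)

lemma bundle_overlap_subset: "bundle_overlap c d \<subseteq> bundle_dom c"
  unfolding bundle_overlap_def bundle_dom_def using overlap_subset by blast

lemma tangent_bundleD: "P \<in> tangent_bundle \<Longrightarrow> fst P \<in> topspace X \<and> snd P \<in> tangent_space (fst P)"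
  unfolding tangent_bundle_def by auto

lemma point_of_coords:
  "P \<in> tangent_bundle \<Longrightarrow> c \<in> charts_at (fst P) \<Longrightarrow> point_of c (coords c P) = P"
  by (auto simp: point_of_def coords_def cinv_cmap tvec_of_component dest!: charts_atD tangent_bundleD
      intro!: prod_eqI) (metis (no_types, lifting) charts_at_def mem_Collect_eq tvec_of_component)

lemma point_of_tangent_bundle:
  "c \<in> \<A> \<Longrightarrow> z \<in> bundle_dom c \<Longrightarrow> point_of c z \<in> tangent_bundle"
  using cdom_subset_topspace[of c] cinv_in[of "fst z" c]
  by (auto simp: tangent_bundle_def point_of_def bundle_dom_def intro!: tvec_of_tangent)

lemma fst_point_of: "z \<in> bundle_dom c \<Longrightarrow> fst (point_of c z) \<in> cdom c"
  by (auto simp: point_of_def bundle_dom_def intro: cinv_in)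

lemma coords_in_bundle_dom: "fst P \<in> cdom c \<Longrightarrow> coords c P \<in> bundle_dom c"
  by (auto simp: coords_def bundle_dom_def)

lemma coords_in_bundle_overlap: "fst P \<in> cdom c \<Longrightarrow> fst P \<in> cdom d \<Longrightarrow> coords c P \<in> bundle_overlap c d"
  by (auto simp: coords_def bundle_overlap_def intro: cmap_in_overlap)

lemma point_of_in_cdom_iff:
  "c \<in> \<A> \<Longrightarrow> z \<in> bundle_dom c \<Longrightarrow> fst (point_of c z) \<in> cdom d \<longleftrightarrow> z \<in> bundle_overlap c d"
  by (cases z) (auto simp: point_of_def bundle_dom_def bundle_overlap_def overlap_iff)

lemma coords_point_of:
  assumes "c \<in> \<A>" "d \<in> \<A>" "z \<in> bundle_overlap c d"
  shows "coords d (point_of c z) = btrans c d z"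
  using assms cinv_in[of "fst z" c]
  by (auto simp: coords_def point_of_def btrans_def bundle_overlap_def overlap_iff transition_def
      tvec_of_apply charts_at_def cmap_cinv)

lemma coords_point_of_self: "c \<in> \<A> \<Longrightarrow> z \<in> bundle_dom c \<Longrightarrow> coords c (point_of c z) = z"
  using cinv_in[of "fst z" c]
  by (auto simp: coords_def point_of_def bundle_dom_def cmap_cinv tvec_of_self intro: prod_eqI)

lemma coords_btrans:
  assumes "P \<in> tangent_bundle" "c \<in> charts_at (fst P)" "d \<in> charts_at (fst P)"
  shows "coords d P = btrans c d (coords c P)"
  using coords_point_of[of c d "coords c P"] point_of_coords[OF assms(1,2)]
    coords_in_bundle_overlap[of P c d] assms(2,3)
  by (auto dest: charts_atD)

lemma btrans_in: "c \<in> \<A> \<Longrightarrow> d \<in> \<A> \<Longrightarrow> z \<in> bundle_overlap c d \<Longrightarrow> btrans c d z \<in> bundle_overlap d c"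
  by (auto simp: btrans_def bundle_overlap_def transition_in_overlap)

lemma point_of_btrans:
  assumes "c \<in> \<A>" "d \<in> \<A>" "z \<in> bundle_overlap c d"
  shows "point_of d (btrans c d z) = point_of c z"
proof -
  have z: "z \<in> bundle_dom c" using assms(3) bundle_overlap_subset by blast
  have "fst (point_of c z) \<in> cdom d" using point_of_in_cdom_iff[OF assms(1) z] assms(3) by blast
  then show ?thesis
    using point_of_coords[OF point_of_tangent_bundle[OF assms(1) z], of d] coords_point_of[OF assms] assms(2)
    by (simp add: charts_at_def)
qed

lemma Ck_fst: "Ck k S fst" and Ck_snd: "Ck k S snd"
  by (rule Ck_bounded_linear[OF bounded_linear_fst] Ck_bounded_linear[OF bounded_linear_snd])+

lemma Ck_btrans:
  assumes "c \<in> \<A>" "d \<in> \<A>"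
  shows "Ck k (bundle_overlap c d) (btrans c d)"
  unfolding btrans_def dtrans_def
  by (intro Ck_Pair Ck_compose[OF Ck_transition[OF assms]] Ck_fst Ck_snd
      Ck_frechet_derivative_apply[OF Ck_transition[OF assms] open_overlap[OF assms]])
    (auto simp: bundle_overlap_def)

text \<open>The derivative is block triangular: the position half of a variation transforms on its
  own, as a tangent vector, whereas the velocity half picks up a second derivative of the
  transition.\<close>

lemma frechet_derivative_btrans:
  assumes "c \<in> \<A>" "d \<in> \<A>" "z \<in> bundle_overlap c d"
  shows "frechet_derivative (btrans c d) (at z) \<zeta> =
    (dtrans c d (fst z) (fst \<zeta>),
     frechet_derivative (\<lambda>x. dtrans c d x (snd z)) (at (fst z)) (fst \<zeta>) + dtrans c d (fst z) (snd \<zeta>))"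
proof -
  have x: "fst z \<in> overlap c d" using assms(3) by (auto simp: bundle_overlap_def)
  have "((\<lambda>z. dtrans c d (fst z) (snd z)) has_derivative
    (\<lambda>\<zeta>. frechet_derivative (\<lambda>x. dtrans c d x (snd z)) (at (fst z)) (fst \<zeta>) + dtrans c d (fst z) (snd \<zeta>)))
    (at z within bundle_overlap c d)"
    unfolding dtrans_def
    by (rule has_derivative_frechet_derivative_apply[OF Ck_transition open_overlap])
      (use assms in \<open>auto simp: bundle_overlap_def intro!: derivative_eq_intros\<close>)
  moreover have "((\<lambda>z. transition c d (fst z)) has_derivative (\<lambda>\<zeta>. dtrans c d (fst z) (fst \<zeta>))) (at z within bundle_overlap c d)"
    by (rule has_derivative_compose[OF has_derivative_fst[OF has_derivative_ident] transition_has_derivative])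
      (use assms x in auto)
  ultimately have "(btrans c d has_derivative (\<lambda>\<zeta>. (dtrans c d (fst z) (fst \<zeta>),
     frechet_derivative (\<lambda>x. dtrans c d x (snd z)) (at (fst z)) (fst \<zeta>) + dtrans c d (fst z) (snd \<zeta>)))) (at z)"
    unfolding btrans_def by (simp add: has_derivative_Pair at_within_open[OF assms(3) open_bundle_overlap[OF assms(1,2)]])
  from frechet_derivative_at[OF this, symmetric] show ?thesis by simp
qed

end

section \<open>The geodesic spray\<close>

lemma matrix_inv_works:
  fixes A :: "real^'n^'n"
  assumes "invertible A"
  shows "A ** matrix_inv A = mat 1" "matrix_inv A ** A = mat 1"
  using someI_ex[OF assms[unfolded invertible_def]] unfolding matrix_inv_def by auto

text \<open>Cramer's rule applied to each column of the inverse displays its entries as quotients of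
  determinants, from which smooth dependence on the matrix can be read off.\<close>

lemma matrix_inv_cramer:
  fixes A :: "real^'n^'n"
  assumes "det A \<noteq> 0"
  shows "matrix_inv A $ k $ m = det (\<chi> i j. if j = k then axis m 1 $ i else A $ i $ j) / det A"
proof -
  have "A *v (matrix_inv A *v axis m 1) = axis m 1"
    using matrix_inv_works(1)[of A] assms by (simp add: invertible_det_nz matrix_vector_mul_assoc)
  then have "(matrix_inv A *v axis m 1) $ k = det (\<chi> i j. if j = k then axis m 1 $ i else A $ i $ j) / det A"
    using cramer[OF assms, of "matrix_inv A *v axis m 1" "axis m 1"] by (simp add: vec_eq_iff)
  then show ?thesis by (simp add: matrix_vector_mult_basis column_def)
qed

lemma Ck_det:
  fixes A :: "'v::real_normed_vector \<Rightarrow> real^'n^'n"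
  assumes "\<And>i j. Ck k S (\<lambda>x. A x $ i $ j)"
  shows "Ck k S (\<lambda>x. det (A x))"
  unfolding det_def by (intro Ck_sum Ck_mult Ck_const Ck_prod assms)

lemma Ck_matrix_inv:
  fixes A :: "'v::real_normed_vector \<Rightarrow> real^'n^'n"
  assumes A: "\<And>i j. Ck k S (\<lambda>x. A x $ i $ j)" and "\<And>x. x \<in> S \<Longrightarrow> invertible (A x)"
  shows "Ck k S (\<lambda>x. matrix_inv (A x) $ i $ j)"
proof -
  have "Ck k S (\<lambda>x. det (\<chi> a b. if b = i then axis j 1 $ a else A x $ a $ b) * inverse (det (A x)))"
  proof (intro Ck_mult Ck_inverse Ck_det A)
    show "Ck k S (\<lambda>x. (\<chi> a b. if b = i then axis j 1 $ a else A x $ a $ b) $ a $ b)" for a b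
      using A by (cases "b = i") (auto intro: Ck_const)
  qed (use assms(2) in \<open>simp add: invertible_det_nz\<close>)
  moreover have "matrix_inv (A x) $ i $ j =
      det (\<chi> a b. if b = i then axis j 1 $ a else A x $ a $ b) * inverse (det (A x))" if "x \<in> S" for x
    using matrix_inv_cramer[of "A x"] assms(2)[OF that] by (simp add: invertible_det_nz divide_inverse)
  ultimately show ?thesis by (simp cong: Ck_cong)
qed

lemma linear_eq_axis:
  fixes f g :: "real^'n \<Rightarrow> 'w::real_vector"
  assumes "linear f" "linear g" "\<And>i. f (axis i 1) = g (axis i 1)"
  shows "f v = g v"
proof -
  have "f = g"
    by (rule linear_eq_stdbasis[OF assms(1,2)]) (use assms(3) in \<open>auto simp: Basis_vec_def\<close>)
  then show ?thesis by simp
qed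

section \<open>Metric, Christoffel symbols and spray in a chart\<close>

context riemannian_manifold
begin

definition metric_in :: "('a, 'n) chart \<Rightarrow> real^'n \<Rightarrow> real^'n \<Rightarrow> real^'n \<Rightarrow> real" where
  "metric_in c x a b = g (cinv c x) (tvec_of c (cinv c x) a) (tvec_of c (cinv c x) b)"

definition dmetric_in :: "('a, 'n) chart \<Rightarrow> real^'n \<Rightarrow> real^'n \<Rightarrow> real^'n \<Rightarrow> real^'n \<Rightarrow> real" where
  "dmetric_in c x a b e = frechet_derivative (\<lambda>y. metric_in c y a b) (at x) e"

lemma cinv_charts_at: "c \<in> \<A> \<Longrightarrow> x \<in> cimg c \<Longrightarrow> c \<in> charts_at (cinv c x)"
  by (simp add: charts_at_def cinv_in)

lemma cinv_topspace: "c \<in> \<A> \<Longrightarrow> x \<in> cimg c \<Longrightarrow> cinv c x \<in> topspace X"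
  by (rule subsetD[OF cdom_subset_topspace cinv_in])

lemma metric_in_props:
  assumes "c \<in> \<A>" "x \<in> cimg c"
  shows metric_in_sym: "metric_in c x a b = metric_in c x b a"
    and metric_in_linear1: "linear (\<lambda>a. metric_in c x a b)"
    and metric_in_linear2: "linear (metric_in c x a)"
    and metric_in_pos: "a \<noteq> 0 \<Longrightarrow> metric_in c x a a > 0"
proof -
  note c = cinv_charts_at[OF assms] and p = cinv_topspace[OF assms]
  have T: "tvec_of c (cinv c x) v \<in> tangent_space (cinv c x)" for v
    using tvec_of_tangent[OF assms(1) cinv_in[OF assms(2)]] .
  show sym: "metric_in c x a b = metric_in c x b a" for a b
    unfolding metric_in_def by (rule metric_sym[OF p T T])
  show lin: "linear (\<lambda>a. metric_in c x a b)" for b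
    by (rule linearI) (simp_all add: metric_in_def tvec_of_linear[OF c] metric_add[OF p T T T] metric_scale[OF p T T])
  show "linear (metric_in c x a)" using lin[of a] unfolding sym[of _ a] .
  show "metric_in c x a a > 0" if "a \<noteq> 0"
  proof -
    have "tvec_of c (cinv c x) a \<noteq> zero_tvec (cinv c x)"
      using tvec_of_self[OF assms(1) cinv_in[OF assms(2)], of a] c that by (auto simp: zero_tvec_def)
    then show ?thesis unfolding metric_in_def by (rule metric_pos[OF p T])
  qed
qed

lemma metric_in_coords:
  assumes "c \<in> charts_at p" "u \<in> tangent_space p" "v \<in> tangent_space p"
  shows "g p u v = metric_in c (cmap c p) (u c) (v c)"
  using assms by (simp add: metric_in_def cinv_cmap tvec_of_component charts_atD)

lemma metric_in_transition:
  assumes "c \<in> \<A>" "d \<in> \<A>" "x \<in> overlap c d"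
  shows "metric_in c x a b = metric_in d (transition c d x) (dtrans c d x a) (dtrans c d x b)"
proof -
  have x: "x \<in> cimg c" "cinv c x \<in> cdom d" using assms by (auto simp: overlap_iff)
  have cc: "c \<in> charts_at (cinv c x)" "d \<in> charts_at (cinv c x)"
    using assms x by (auto simp: charts_at_def cinv_in)
  have "cinv d (transition c d x) = cinv c x"
    using assms x by (simp add: transition_def cinv_cmap)
  then show ?thesis
    using tvec_of_dtrans[OF cc] x by (simp add: metric_in_def cmap_cinv)
qed

lemma metric_in_nondegenerate:
  assumes "c \<in> \<A>" "x \<in> cimg c" "\<And>e. metric_in c x a e = 0"
  shows "a = 0"
  using metric_in_pos[OF assms(1,2), of a] assms(3)[of a] by (cases "a = 0") auto

lemma metric_in_eqI:
  assumes "c \<in> \<A>" "x \<in> cimg c" "\<And>e. metric_in c x a e = metric_in c x b e"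
  shows "a = b"
  using metric_in_nondegenerate[OF assms(1,2), of "a - b"] assms(3)
    linear_diff[OF metric_in_linear1[OF assms(1,2)]] by simp

lemma Ck_metric_in: "c \<in> \<A> \<Longrightarrow> Ck k (cimg c) (\<lambda>x. metric_in c x a b)"
  using metric_smooth unfolding smooth_on_def metric_in_def by blast

lemma metric_in_has_derivative:
  "c \<in> \<A> \<Longrightarrow> x \<in> cimg c \<Longrightarrow> ((\<lambda>y. metric_in c y a b) has_derivative dmetric_in c x a b) (at x)"
  unfolding dmetric_in_def by (rule Ck_Suc_has_derivative[OF Ck_metric_in chart_image_open])

lemma dmetric_in_linear:
  assumes "c \<in> \<A>" "x \<in> cimg c"
  shows "linear (dmetric_in c x a b)"
    and "linear (\<lambda>a. dmetric_in c x a b e)" "linear (\<lambda>b. dmetric_in c x a b e)"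
proof -
  show "linear (dmetric_in c x a b)"
    using metric_in_has_derivative[OF assms] has_derivative_linear by blast
  show "linear (\<lambda>a. dmetric_in c x a b e)"
    by (rule linear_family_derivative_linear[OF chart_image_open[OF assms(1)] assms(2),
        where L="\<lambda>y a. metric_in c y a b"])
      (use assms in \<open>auto intro: metric_in_linear1 metric_in_has_derivative\<close>)
  show "linear (\<lambda>b. dmetric_in c x a b e)"
    by (rule linear_family_derivative_linear[OF chart_image_open[OF assms(1)] assms(2),
        where L="\<lambda>y. metric_in c y a"])
      (use assms in \<open>auto intro: metric_in_linear2 metric_in_has_derivative\<close>)
qed

lemma dmetric_in_sym:
  assumes "c \<in> \<A>" "x \<in> cimg c"
  shows "dmetric_in c x a b e = dmetric_in c x b a e"
proof -
  have "((\<lambda>y. metric_in c y b a) has_derivative dmetric_in c x a b) (at x)"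
    by (rule has_derivative_transform_within_open[OF metric_in_has_derivative[OF assms] chart_image_open[OF assms(1)] assms(2)])
      (simp add: metric_in_sym[OF assms(1)])
  from has_derivative_unique[OF this metric_in_has_derivative[OF assms]] show ?thesis by metis
qed

lemma has_derivative_metric_in:
  assumes "c \<in> \<A>" "x \<in> S" "\<And>y. y \<in> S \<Longrightarrow> p y \<in> cimg c"
    and "(p has_derivative p') (at x within S)"
    and "(u has_derivative u') (at x within S)" "(v has_derivative v') (at x within S)"
  shows "((\<lambda>y. metric_in c (p y) (u y) (v y)) has_derivative
    (\<lambda>e. dmetric_in c (p x) (u x) (v x) (p' e) + metric_in c (p x) (u' e) (v x) + metric_in c (p x) (u x) (v' e)))
    (at x within S)"
  by (rule has_derivative_bilinear_family[OF chart_image_open[OF assms(1)] metric_in_linear1[OF assms(1)]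
      metric_in_linear2[OF assms(1)] assms(2,3) metric_in_has_derivative[OF assms(1) assms(3)[OF assms(2)]] assms(4-6)])

text \<open>The bilinear form lets linearity replace most index sums. It is not a tensor:
  \<open>christoffel_form_transition\<close> involves the second derivative of the
  transition.\<close>

definition christoffel_form :: "('a, 'n) chart \<Rightarrow> real^'n \<Rightarrow> real^'n \<Rightarrow> real^'n \<Rightarrow> real^'n" where
  "christoffel_form c x a b = (\<chi> k. \<Sum>i\<in>UNIV. \<Sum>j\<in>UNIV. christoffel c x k i j * a $ i * b $ j)"

lemma christoffel_form_linear1: "linear (\<lambda>a. christoffel_form c x a b)"
  by (rule linearI) (simp_all add: christoffel_form_def vec_eq_iff algebra_simps sum.distrib sum_distrib_left)

lemma christoffel_form_linear2: "linear (christoffel_form c x a)"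
  by (rule linearI) (simp_all add: christoffel_form_def vec_eq_iff algebra_simps sum.distrib sum_distrib_left)

lemma christoffel_form_axis: "christoffel_form c x (axis i 1) (axis j 1) $ k = christoffel c x k i j"
proof -
  have "(\<Sum>j'\<in>UNIV. christoffel c x k i' j' * axis i 1 $ i' * axis j 1 $ j') =
      (if i' = i then christoffel c x k i j else 0)" for i'
    by (simp add: axis_def if_distrib[of "(*) _"] sum.delta cong: if_cong)
  then show ?thesis by (simp add: christoffel_form_def sum.delta)
qed

lemma gmat_metric_in: "gmat c x $ i $ j = metric_in c x (axis i 1) (axis j 1)"
  by (simp add: gmat_def metric_in_def)

lemma metric_in_axis2:
  assumes "c \<in> \<A>" "x \<in> cimg c"
  shows "metric_in c x v (axis l 1) = (\<Sum>k\<in>UNIV. v $ k * gmat c x $ k $ l)"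
proof -
  have "metric_in c x v (axis l 1) = metric_in c x (\<Sum>k\<in>UNIV. v $ k *\<^sub>R axis k 1) (axis l 1)"
    using basis_expansion[of v] by (simp add: scalar_mult_eq_scaleR)
  also have "\<dots> = (\<Sum>k\<in>UNIV. v $ k * gmat c x $ k $ l)"
    by (simp add: linear_sum[OF metric_in_linear1[OF assms]] linear_scale[OF metric_in_linear1[OF assms]] gmat_metric_in)
  finally show ?thesis .
qed

text \<open>A vector in the kernel of the Gram matrix is orthogonal to all axis vectors, hence to
  itself, and vanishes by positivity.\<close>

lemma invertible_gmat:
  assumes "c \<in> \<A>" "x \<in> cimg c"
  shows "invertible (gmat c x)"
proof -
  have "a = 0" if "gmat c x *v a = 0" for a
  proof (rule metric_in_nondegenerate[OF assms])
    have "metric_in c x a (axis l 1) = 0" for l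
    proof -
      have "metric_in c x a (axis l 1) = (gmat c x *v a) $ l"
        unfolding metric_in_axis2[OF assms] matrix_vector_mult_def
        by (auto intro!: sum.cong simp: gmat_metric_in metric_in_sym[OF assms])
      then show ?thesis using that by simp
    qed
    then show "metric_in c x a e = 0" for e
      using linear_eq_axis[OF metric_in_linear2[OF assms] linear_zero] by auto
  qed
  then show ?thesis unfolding invertible_left_inverse matrix_left_invertible_ker by blast
qed

text \<open>The Koszul formula for coordinate fields, whose brackets vanish. It determines the
  Christoffel form by the metric without an inverse matrix; symmetry, the transformation law,
  conservation of speed and first variation all go through it.\<close>

lemma koszul:
  assumes "c \<in> \<A>" "x \<in> cimg c"
  shows "2 * metric_in c x (christoffel_form c x a b) e =
    dmetric_in c x b e a + dmetric_in c x a e b - dmetric_in c x a b e"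
proof -
  have axis: "2 * metric_in c x (christoffel_form c x (axis i 1) (axis j 1)) (axis l 1) =
    dmetric_in c x (axis j 1) (axis l 1) (axis i 1) + dmetric_in c x (axis i 1) (axis l 1) (axis j 1)
    - dmetric_in c x (axis i 1) (axis j 1) (axis l 1)" for i j l
  proof -
    \<comment> \<open>The bracket in the definition of \<open>christoffel\<close>; lowering the
      index with \<open>gmat\<close> cancels the inverse matrix in front of it.\<close>
    define E where "E m = dmetric_in c x (axis j 1) (axis m 1) (axis i 1) + dmetric_in c x (axis i 1) (axis m 1) (axis j 1)
    - dmetric_in c x (axis i 1) (axis j 1) (axis m 1)" for m
    have chr: "christoffel c x k i j = 1/2 * (\<Sum>m\<in>UNIV. matrix_inv (gmat c x) $ k $ m * E m)" for k
      unfolding christoffel_def E_def pderiv_at_def gmat_metric_in dmetric_in_def by simp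
    have "2 * metric_in c x (christoffel_form c x (axis i 1) (axis j 1)) (axis l 1) =
      (\<Sum>k\<in>UNIV. \<Sum>m\<in>UNIV. gmat c x $ k $ l * matrix_inv (gmat c x) $ k $ m * E m)"
      unfolding metric_in_axis2[OF assms] christoffel_form_axis chr
      by (simp add: sum_distrib_left sum_distrib_right mult_ac)
    also have "\<dots> = (\<Sum>m\<in>UNIV. \<Sum>k\<in>UNIV. gmat c x $ k $ l * matrix_inv (gmat c x) $ k $ m * E m)"
      by (rule sum.swap)
    also have "\<dots> = (\<Sum>m\<in>UNIV. (gmat c x ** matrix_inv (gmat c x)) $ l $ m * E m)"
      by (simp add: matrix_matrix_mult_def sum_distrib_right gmat_metric_in metric_in_sym[OF assms, of "axis l 1"])
    also have "\<dots> = E l"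
      unfolding matrix_inv_works(1)[OF invertible_gmat[OF assms]]
      by (simp add: mat_def if_distrib[of "\<lambda>x. x * _"] sum.delta cong: if_cong)
    finally show ?thesis by (simp add: E_def)
  qed
  note lins = linear_compose_add linear_compose_sub dmetric_in_linear[OF assms]
    metric_in_linear2[OF assms]
    linear_compose[OF christoffel_form_linear1 metric_in_linear1[OF assms], unfolded o_def]
    linear_compose[OF christoffel_form_linear2 metric_in_linear1[OF assms], unfolded o_def]
  have scale: "linear (\<lambda>v. 2 * f v)" if "linear f" for f :: "real^'n \<Rightarrow> real"
    using linear_compose_scale_right[OF that, of 2] by simp
  \<comment> \<open>Both sides are linear in every argument, so agreement on axis vectors is
    extended one argument at a time: first \<open>e\<close>, then \<open>b\<close>, then
    \<open>a\<close>.\<close>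
  have 1: "2 * metric_in c x (christoffel_form c x (axis i 1) (axis j 1)) e =
    dmetric_in c x (axis j 1) e (axis i 1) + dmetric_in c x (axis i 1) e (axis j 1)
    - dmetric_in c x (axis i 1) (axis j 1) e" for i j e
    by (rule linear_eq_axis[of _ _ e]) (intro lins scale axis)+
  have 2: "2 * metric_in c x (christoffel_form c x (axis i 1) b) e =
    dmetric_in c x b e (axis i 1) + dmetric_in c x (axis i 1) e b - dmetric_in c x (axis i 1) b e" for i b e
    by (rule linear_eq_axis[of _ _ b]) (intro lins scale 1)+
  show ?thesis
    by (rule linear_eq_axis[of _ _ a]) (intro lins scale 2)+
qed

lemma christoffel_form_sym:
  assumes "c \<in> \<A>" "x \<in> cimg c"
  shows "christoffel_form c x a b = christoffel_form c x b a"
proof (rule metric_in_eqI[OF assms])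
  show "metric_in c x (christoffel_form c x a b) e = metric_in c x (christoffel_form c x b a) e" for e
    using koszul[OF assms, of a b e] koszul[OF assms, of b a e] dmetric_in_sym[OF assms, of a b] by simp
qed

lemma Ck_christoffel:
  assumes "c \<in> \<A>"
  shows "Ck m (cimg c) (\<lambda>x. christoffel c x k i j)"
  unfolding christoffel_def pderiv_at_def
proof (intro Ck_mult Ck_const Ck_sum Ck_add Ck_diff Ck_matrix_inv)
  show *: "Ck m (cimg c) (\<lambda>x. gmat c x $ i $ j)" for i j m
    unfolding gmat_metric_in using Ck_metric_in[OF assms] .
  show "Ck m (cimg c) (\<lambda>x. frechet_derivative (\<lambda>y. gmat c y $ i $ j) (at x) v)" for i j v
    by (rule Ck_frechet_derivative[OF * chart_image_open[OF assms]])
  then show "Ck m (cimg c) (\<lambda>x. frechet_derivative (\<lambda>y. gmat c y $ i $ j) (at x) v)"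
    "Ck m (cimg c) (\<lambda>x. frechet_derivative (\<lambda>y. gmat c y $ i $ j) (at x) v)" for i j v
    by this+
qed (rule invertible_gmat[OF assms])

lemma Ck_christoffel_form: "c \<in> \<A> \<Longrightarrow> Ck m (cimg c) (\<lambda>x. christoffel_form c x a b)"
  unfolding christoffel_form_def
  by (intro Ck_vec_lambda Ck_sum Ck_mult Ck_const Ck_christoffel)

definition dchristoffel_form :: "('a, 'n) chart \<Rightarrow> real^'n \<Rightarrow> real^'n \<Rightarrow> real^'n \<Rightarrow> real^'n \<Rightarrow> real^'n" where
  "dchristoffel_form c x a b e = frechet_derivative (\<lambda>y. christoffel_form c y a b) (at x) e"

lemma christoffel_form_has_derivative:
  "c \<in> \<A> \<Longrightarrow> x \<in> cimg c \<Longrightarrow>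
    ((\<lambda>y. christoffel_form c y a b) has_derivative dchristoffel_form c x a b) (at x)"
  unfolding dchristoffel_form_def by (rule Ck_Suc_has_derivative[OF Ck_christoffel_form chart_image_open])

lemma has_derivative_christoffel_form:
  assumes "c \<in> \<A>" "x \<in> S" "\<And>y. y \<in> S \<Longrightarrow> p y \<in> cimg c"
    and "(p has_derivative p') (at x within S)"
    and "(u has_derivative u') (at x within S)" "(v has_derivative v') (at x within S)"
  shows "((\<lambda>y. christoffel_form c (p y) (u y) (v y)) has_derivative
    (\<lambda>e. dchristoffel_form c (p x) (u x) (v x) (p' e) + christoffel_form c (p x) (u' e) (v x)
      + christoffel_form c (p x) (u x) (v' e)))
    (at x within S)"
  by (rule has_derivative_bilinear_family[OF chart_image_open[OF assms(1)] christoffel_form_linear1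
      christoffel_form_linear2 assms(2,3) christoffel_form_has_derivative[OF assms(1) assms(3)[OF assms(2)]] assms(4-6)])

text \<open>The Christoffel symbols are determined by the metric through \<open>koszul\<close>, so their transformation law
  follows by differentiating that of the metric.\<close>

lemma christoffel_form_transition:
  assumes "c \<in> \<A>" "d \<in> \<A>" "x \<in> overlap c d"
  shows "frechet_derivative (\<lambda>y. dtrans c d y w) (at x) w - dtrans c d x (christoffel_form c x w w) =
    - christoffel_form d (transition c d x) (dtrans c d x w) (dtrans c d x w)"
proof -
  define y where "y = transition c d x"
  define D where "D = dtrans c d x"
  define D2 where "D2 a e = frechet_derivative (\<lambda>y. dtrans c d y a) (at x) e" for a e
  have x: "x \<in> cimg c" and y: "y \<in> cimg d"
    using assms(3) transition_in_overlap[OF assms] overlap_subset unfolding y_def by blast+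
  have Ck2: "Ck (Suc (Suc 0)) (overlap c d) (transition c d)" by (rule Ck_transition[OF assms(1,2)])
  have D2: "((\<lambda>y. dtrans c d y a) has_derivative D2 a) (at x)" for a
    unfolding D2_def dtrans_def
    by (rule Ck_Suc_has_derivative[OF Ck_frechet_derivative[OF Ck2 open_overlap] open_overlap]) (use assms in auto)
  have sym: "D2 a e = D2 e a" for a e
    unfolding D2_def dtrans_def
    using second_derivative_symmetric[OF Ck2[folded numeral_2_eq_2] open_overlap assms(3)] assms(1,2) by blast
  have dm: "dmetric_in c x a b e = dmetric_in d y (D a) (D b) (D e) + metric_in d y (D2 a e) (D b) + metric_in d y (D a) (D2 b e)"
    for a b e
  proof -
    have "((\<lambda>z. metric_in d (transition c d z) (dtrans c d z a) (dtrans c d z b)) has_derivative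
      (\<lambda>e. dmetric_in d (transition c d x) (dtrans c d x a) (dtrans c d x b) (D e)
         + metric_in d (transition c d x) (D2 a e) (dtrans c d x b) + metric_in d (transition c d x) (dtrans c d x a) (D2 b e)))
      (at x within overlap c d)"
      by (rule has_derivative_metric_in[OF assms(2,3)])
        (use assms transition_in_overlap[OF assms(1,2)] overlap_subset[of d c] D2 transition_has_derivative[OF assms] in
          \<open>auto intro: has_derivative_at_withinI simp: D_def\<close>)
    then have "((\<lambda>z. metric_in d (transition c d z) (dtrans c d z a) (dtrans c d z b)) has_derivative
      (\<lambda>e. dmetric_in d y (D a) (D b) (D e) + metric_in d y (D2 a e) (D b) + metric_in d y (D a) (D2 b e))) (at x)"
      by (simp add: at_within_open[OF assms(3) open_overlap[OF assms(1,2)]] D_def y_def)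
    then have "((\<lambda>z. metric_in c z a b) has_derivative
      (\<lambda>e. dmetric_in d y (D a) (D b) (D e) + metric_in d y (D2 a e) (D b) + metric_in d y (D a) (D2 b e))) (at x)"
      by (rule has_derivative_transform_within_open[OF _ open_overlap[OF assms(1,2)] assms(3)])
        (simp add: metric_in_transition[OF assms(1,2)])
    from has_derivative_unique[OF metric_in_has_derivative[OF assms(1) x] this] show ?thesis by metis
  qed
  have "D (christoffel_form c x w w) = D2 w w + christoffel_form d y (D w) (D w)"
  proof (rule metric_in_eqI[OF assms(2) y])
    fix e'
    define e where "e = dtrans d c y e'"
    \<comment> \<open>The Jacobian of a transition is invertible, so testing against vectors
      \<open>D e\<close> is testing against all vectors.\<close>
    have e': "e' = D e"
      using dtrans_inverse[OF assms(2,1) transition_in_overlap[OF assms]] assms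
      by (simp add: e_def D_def y_def transition_def overlap_iff cmap_cinv cinv_cmap)
    have "2 * metric_in d y (D (christoffel_form c x w w)) (D e) = 2 * metric_in c x (christoffel_form c x w w) e"
      unfolding D_def y_def metric_in_transition[OF assms] ..
    \<comment> \<open>The terms pairing \<open>D w\<close> with \<open>D2 e w\<close> and with
      \<open>D2 w e\<close> cancel by symmetry of the second derivative; only \<open>D2 w w\<close>
      survives.\<close>
    also have "\<dots> = 2 * metric_in d y (D2 w w) (D e) + 2 * metric_in d y (christoffel_form d y (D w) (D w)) (D e)"
      unfolding koszul[OF assms(1) x] koszul[OF assms(2) y] dm
      using metric_in_sym[OF assms(2) y] sym[of e w] by simp
    finally show "metric_in d y (D (christoffel_form c x w w)) e' =
        metric_in d y (D2 w w + christoffel_form d y (D w) (D w)) e'"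
      by (simp add: e' linear_add[OF metric_in_linear1[OF assms(2) y]])
  qed
  then show ?thesis by (simp add: D_def D2_def y_def)
qed

definition spray :: "('a, 'n) chart \<Rightarrow> (real^'n) \<times> (real^'n) \<Rightarrow> (real^'n) \<times> (real^'n)" where
  "spray c z = (snd z, - christoffel_form c (fst z) (snd z) (snd z))"

lemma Ck_spray:
  assumes "c \<in> \<A>"
  shows "Ck m (bundle_dom c) (spray c)"
proof -
  have "Ck m (bundle_dom c) (\<lambda>z. christoffel c (fst z) k i j)" for k i j
    by (rule Ck_compose[OF Ck_christoffel[OF assms] Ck_fst]) (auto simp: bundle_dom_def)
  then show ?thesis unfolding spray_def christoffel_form_def
    by (intro Ck_Pair Ck_snd Ck_minus Ck_vec_lambda Ck_sum Ck_mult Ck_vec_nth)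
qed

text \<open>The local sprays form one vector field on the tangent bundle: the second derivative of
  the transition in the tangent map of \<open>btrans\<close> is exactly the inhomogeneous term in
  the transformation of the Christoffel form.\<close>

lemma spray_related:
  assumes "c \<in> \<A>" "d \<in> \<A>" "z \<in> bundle_overlap c d"
  shows "frechet_derivative (btrans c d) (at z) (spray c z) = spray d (btrans c d z)"
proof -
  have x: "fst z \<in> overlap c d" using assms(3) by (auto simp: bundle_overlap_def)
  show ?thesis
    unfolding frechet_derivative_btrans[OF assms]
    using christoffel_form_transition[OF assms(1,2) x, of "snd z"]
    by (simp add: spray_def btrans_def linear_neg[OF linear_dtrans[OF assms(1,2) x]])
qed

definition dspray :: "('a, 'n) chart \<Rightarrow> (real^'n) \<times> (real^'n) \<Rightarrow> (real^'n) \<times> (real^'n) \<Rightarrow> (real^'n) \<times> (real^'n)" where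
  "dspray c z = frechet_derivative (spray c) (at z)"

text \<open>This is the Jacobi equation in raw coordinates, before covariant derivatives are
  introduced. The factor 2 comes from the symmetry of the Christoffel form.\<close>

lemma dspray_eq:
  assumes "c \<in> \<A>" "z \<in> bundle_dom c"
  shows "dspray c z \<zeta> = (snd \<zeta>, - (dchristoffel_form c (fst z) (snd z) (snd z) (fst \<zeta>)
    + 2 *\<^sub>R christoffel_form c (fst z) (snd z) (snd \<zeta>)))"
proof -
  have x: "fst z \<in> cimg c" using assms(2) by (auto simp: bundle_dom_def)
  have "(fst has_derivative fst) (at z within bundle_dom c)" "(snd has_derivative snd) (at z within bundle_dom c)"
    by (intro bounded_linear_imp_has_derivative bounded_linear_fst bounded_linear_snd)+
  note d = has_derivative_christoffel_form[OF assms(1,2) _ this(1,2,2)]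
  have "(spray c has_derivative (\<lambda>\<zeta>. (snd \<zeta>, - (dchristoffel_form c (fst z) (snd z) (snd z) (fst \<zeta>)
     + christoffel_form c (fst z) (snd \<zeta>) (snd z) + christoffel_form c (fst z) (snd z) (snd \<zeta>))))) (at z within bundle_dom c)"
    unfolding spray_def
    by (intro has_derivative_Pair has_derivative_minus d bounded_linear_imp_has_derivative bounded_linear_snd)
      (auto simp: bundle_dom_def)
  then have "dspray c z = (\<lambda>\<zeta>. (snd \<zeta>, - (dchristoffel_form c (fst z) (snd z) (snd z) (fst \<zeta>)
     + christoffel_form c (fst z) (snd \<zeta>) (snd z) + christoffel_form c (fst z) (snd z) (snd \<zeta>))))"
    unfolding dspray_def at_within_open[OF assms(2) open_bundle_dom[OF assms(1)]]
    by (rule frechet_derivative_at[symmetric])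
  then show ?thesis
    by (simp add: christoffel_form_sym[OF assms(1) x, of "snd \<zeta>"] scaleR_2 add.assoc)
qed

end

section \<open>The geodesic flow along an integral curve of the spray\<close>

lemma at_within_Int_open: "t \<in> B \<Longrightarrow> open B \<Longrightarrow> at t within (I \<inter> B) = at t within I"
  by (rule at_within_nhd) auto

lemma eventually_at_within_glue:
  fixes a b c t :: real
  assumes "t \<in> {a..c}" "a < b" "b < c"
    and P: "t \<le> b \<Longrightarrow> \<forall>\<^sub>F s in at t within {a..b}. P s"
    and Q: "t \<ge> b \<Longrightarrow> \<forall>\<^sub>F s in at t within {b..c}. Q s"
  shows "\<forall>\<^sub>F s in at t within {a..c}. if s \<le> b then P s else Q s"
proof -
  obtain d1 where d1: "d1 > 0" "\<And>s. t \<le> b \<Longrightarrow> s \<in> {a..b} \<Longrightarrow> s \<noteq> t \<Longrightarrow> dist s t < d1 \<Longrightarrow> P s"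
  proof (cases "t \<le> b")
    case True
    then show ?thesis using P that unfolding eventually_at by blast
  next
    case False
    then show ?thesis using that[of 1] by auto
  qed
  obtain d2 where d2: "d2 > 0" "\<And>s. t \<ge> b \<Longrightarrow> s \<in> {b..c} \<Longrightarrow> s \<noteq> t \<Longrightarrow> dist s t < d2 \<Longrightarrow> Q s"
  proof (cases "t \<ge> b")
    case True
    then show ?thesis using Q that unfolding eventually_at by blast
  next
    case False
    then show ?thesis using that[of 1] by auto
  qed
  \<comment> \<open>For \<open>t \<noteq> b\<close> the distance to \<open>b\<close> keeps nearby
    points on the side of \<open>t\<close>; for \<open>t = b\<close> both sides matter and the value
    1 imposes nothing essential.\<close>
  define d where "d = min (min d1 d2) (if t = b then 1 else \<bar>t - b\<bar>)"
  have "d > 0" using d1(1) d2(1) by (simp add: d_def)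
  moreover have "if s \<le> b then P s else Q s" if "s \<in> {a..c}" "s \<noteq> t" "dist s t < d" for s
    using d1(2)[of s] d2(2)[of s] that by (auto simp: d_def dist_real_def split: if_splits)
  ultimately show ?thesis unfolding eventually_at by blast
qed

lemma has_vector_derivative_glue:
  fixes a b c t :: real and f h :: "real \<Rightarrow> 'v::real_normed_vector"
  assumes "t \<in> {a..c}" "a < b" "b < c"
    and f: "t \<le> b \<Longrightarrow> (f has_vector_derivative D) (at t within {a..b})"
    and h: "t \<ge> b \<Longrightarrow> (h has_vector_derivative D) (at t within {b..c})"
    and "t = b \<Longrightarrow> f b = h b"
  shows "((\<lambda>s. if s \<le> b then f s else h s) has_vector_derivative D) (at t within {a..c})"
proof -
  define k where "k s = (if s \<le> b then f s else h s)" for s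
  \<comment> \<open>Rephrasing the derivative as smallness of a scalar error quotient turns it into
    an eventuality, to which \<open>eventually_at_within_glue\<close> applies.\<close>
  define q where "q F s = norm (F s - F t - (s - t) *\<^sub>R D) / norm (s - t)" for F :: "real \<Rightarrow> 'v" and s
  have q: "(F has_vector_derivative D) (at t within S) \<longleftrightarrow> (\<forall>e>0. \<forall>\<^sub>F s in at t within S. q F s < e)"
    for F :: "real \<Rightarrow> 'v" and S
    unfolding has_vector_derivative_def has_derivative_within' eventually_at q_def
    by (auto simp: bounded_linear_scaleR_left dist_norm)
  have "\<forall>\<^sub>F s in at t within {a..c}. q k s < e" if "e > 0" for e
  proof -
    have "\<forall>\<^sub>F s in at t within {a..c}. if s \<le> b then q f s < e \<or> \<not> t \<le> b else q h s < e \<or> \<not> b \<le> t"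
      by (rule eventually_at_within_glue[OF assms(1-3)])
        (use f h that in \<open>auto simp: q elim: eventually_mono\<close>)
    moreover have "\<forall>\<^sub>F s in at t within {a..c}. (s \<le> b \<longrightarrow> t \<le> b) \<and> (b < s \<longrightarrow> b \<le> t)"
      using eventually_at_within_glue[OF assms(1-3), of "\<lambda>s. t \<le> b" "\<lambda>s. b \<le> t"]
      by (auto elim!: eventually_mono split: if_splits)
    ultimately show ?thesis
      by eventually_elim (use assms(6) in \<open>auto simp: q_def k_def split: if_splits\<close>)
  qed
  then show ?thesis unfolding k_def[symmetric] q by blast
qed

section \<open>Integral curves of the spray and the flow around one of them\<close>

context riemannian_manifold
begin

text \<open>The condition that nearby points stay in the chart replaces continuity, which then follows from the
  differentiability in the chart; in this form integral curves can be glued.\<close>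

definition integral_curve :: "real set \<Rightarrow> (real \<Rightarrow> 'a \<times> ('a, 'n) tvec) \<Rightarrow> bool" where
  "integral_curve I Z \<longleftrightarrow> (\<forall>t\<in>I. Z t \<in> tangent_bundle \<and> (\<forall>c\<in>charts_at (fst (Z t)).
     (\<forall>\<^sub>F s in at t within I. fst (Z s) \<in> cdom c) \<and>
     ((\<lambda>s. coords c (Z s)) has_vector_derivative spray c (coords c (Z t))) (at t within I)))"

lemma integral_curve_subset: "integral_curve I Z \<Longrightarrow> J \<subseteq> I \<Longrightarrow> integral_curve J Z"
  unfolding integral_curve_def
  by (meson at_le filter_leD has_vector_derivative_within_subset subsetD)

text \<open>A solution in the single chart \<open>d\<close> is a solution in every chart by
  \<open>spray_related\<close>; continuity of \<open>z\<close> keeps nearby points in the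
  overlap.\<close>

lemma integral_curve_point_of:
  assumes "d \<in> \<A>" and z: "\<And>t. t \<in> I \<Longrightarrow> z t \<in> bundle_dom d"
    and dz: "\<And>t. t \<in> I \<Longrightarrow> (z has_vector_derivative spray d (z t)) (at t within I)"
  shows "integral_curve I (\<lambda>t. point_of d (z t))"
  unfolding integral_curve_def
proof (intro ballI conjI)
  fix t assume t: "t \<in> I"
  show "point_of d (z t) \<in> tangent_bundle" by (rule point_of_tangent_bundle[OF assms(1) z[OF t]])
  fix c assume "c \<in> charts_at (fst (point_of d (z t)))"
  then have c: "c \<in> \<A>" and zt: "z t \<in> bundle_overlap d c"
    using point_of_in_cdom_iff[OF assms(1) z[OF t]] by (auto simp: charts_at_def)
  have ev: "\<forall>\<^sub>F s in at t within I. z s \<in> bundle_overlap d c"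
    using has_vector_derivative_continuous[OF dz[OF t]] open_bundle_overlap[OF assms(1) c] zt
    unfolding continuous_within by (rule topological_tendstoD)
  show "\<forall>\<^sub>F s in at t within I. fst (point_of d (z s)) \<in> cdom c"
    using ev by eventually_elim (use point_of_in_cdom_iff[OF assms(1)] bundle_overlap_subset in blast)
  have "((\<lambda>s. btrans d c (z s)) has_vector_derivative frechet_derivative (btrans d c) (at (z t)) (spray d (z t))) (at t within I)"
    by (rule vector_derivative_diff_chain_within[OF dz[OF t], unfolded o_def])
      (rule has_derivative_at_withinI[OF Ck_Suc_has_derivative[OF Ck_btrans[OF assms(1) c] open_bundle_overlap[OF assms(1) c] zt]])
  then have "((\<lambda>s. btrans d c (z s)) has_vector_derivative spray c (btrans d c (z t))) (at t within I)"
    unfolding spray_related[OF assms(1) c zt] .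
  moreover have "\<forall>\<^sub>F s in at t within I. btrans d c (z s) = coords c (point_of d (z s))"
    using ev by eventually_elim (simp add: coords_point_of[OF assms(1) c])
  ultimately show "((\<lambda>s. coords c (point_of d (z s))) has_vector_derivative spray c (coords c (point_of d (z t)))) (at t within I)"
    unfolding has_vector_derivative_def coords_point_of[OF assms(1) c zt]
    by (rule has_derivative_transform_eventually) (use coords_point_of[OF assms(1) c zt] t in auto)
qed

lemma integral_curve_glue:
  assumes "a < b" "b < c" "integral_curve {a..b} Y" "integral_curve {b..c} Z" "Y b = Z b"
  shows "integral_curve {a..c} (\<lambda>t. if t \<le> b then Y t else Z t)"
  unfolding integral_curve_def
proof (intro ballI)
  fix t assume t: "t \<in> {a..c}"
  define W where "W t = (if t \<le> b then Y t else Z t)" for t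
  have WY: "W t = Y t" if "t \<le> b" using that by (simp add: W_def)
  have WZ: "W t = Z t" if "t \<ge> b" using that assms(5) by (auto simp: W_def)
  have Y: "t \<le> b \<Longrightarrow> t \<in> {a..b}" and Z: "b \<le> t \<Longrightarrow> t \<in> {b..c}" using t by auto
  have TB: "W t \<in> tangent_bundle"
    using assms(3,4) Y Z unfolding integral_curve_def W_def by (cases "t \<le> b") auto
  have "(\<forall>\<^sub>F s in at t within {a..c}. fst (W s) \<in> cdom d) \<and>
     ((\<lambda>s. coords d (W s)) has_vector_derivative spray d (coords d (W t))) (at t within {a..c})"
    if d: "d \<in> charts_at (fst (W t))" for d
  proof
    have "\<forall>\<^sub>F s in at t within {a..c}. if s \<le> b then fst (Y s) \<in> cdom d else fst (Z s) \<in> cdom d"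
      by (rule eventually_at_within_glue[OF t assms(1,2)])
        (use assms(3,4) Y Z WY WZ d in \<open>auto simp: integral_curve_def\<close>)
    then show "\<forall>\<^sub>F s in at t within {a..c}. fst (W s) \<in> cdom d"
      by eventually_elim (auto simp: W_def split: if_splits)
    have "((\<lambda>s. if s \<le> b then coords d (Y s) else coords d (Z s)) has_vector_derivative
        spray d (coords d (W t))) (at t within {a..c})"
      by (rule has_vector_derivative_glue[OF t assms(1,2)])
        (use assms(3,4,5) Y Z WY WZ d in \<open>auto simp: integral_curve_def\<close>)
    then show "((\<lambda>s. coords d (W s)) has_vector_derivative spray d (coords d (W t))) (at t within {a..c})"
      by (simp add: W_def if_distrib[of "coords d"])
  qed
  then show "(if t \<le> b then Y t else Z t) \<in> tangent_bundle \<and>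
     (\<forall>d\<in>charts_at (fst (if t \<le> b then Y t else Z t)).
       (\<forall>\<^sub>F s in at t within {a..c}. fst (if s \<le> b then Y s else Z s) \<in> cdom d) \<and>
       ((\<lambda>s. coords d (if s \<le> b then Y s else Z s)) has_vector_derivative
         spray d (coords d (if t \<le> b then Y t else Z t))) (at t within {a..c}))"
    using TB unfolding W_def by blast
qed

text \<open>\<open>\<Phi> z\<close> is the integral curve on \<open>{a..b}\<close> starting at the point with coordinates \<open>z\<close> in the chart
  \<open>c\<close>, and \<open>A d t\<close> is the derivative of \<open>z \<mapsto> \<Phi> z t\<close>, read in the chart \<open>d\<close>, at the coordinates of
  \<open>Z a\<close>.\<close>

definition flow_around :: "(real \<Rightarrow> 'a \<times> ('a, 'n) tvec) \<Rightarrow> real \<Rightarrow> real \<Rightarrow> ('a, 'n) chart \<Rightarrow> real \<Rightarrow>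
    ((real^'n) \<times> (real^'n) \<Rightarrow> real \<Rightarrow> 'a \<times> ('a, 'n) tvec) \<Rightarrow>
    (('a, 'n) chart \<Rightarrow> real \<Rightarrow> (real^'n) \<times> (real^'n) \<Rightarrow> (real^'n) \<times> (real^'n)) \<Rightarrow> bool" where
  "flow_around Z a b c \<delta> \<Phi> A \<longleftrightarrow> \<delta> > 0 \<and> ball (coords c (Z a)) \<delta> \<subseteq> bundle_dom c \<and>
    (\<forall>z\<in>ball (coords c (Z a)) \<delta>. integral_curve {a..b} (\<Phi> z) \<and> \<Phi> z a = point_of c z) \<and>
    (\<forall>t\<in>{a..b}. \<Phi> (coords c (Z a)) t = Z t) \<and>
    (\<forall>t\<in>{a..b}. \<forall>d\<in>charts_at (fst (Z t)).
      (\<exists>\<epsilon>>0. \<epsilon> \<le> \<delta> \<and> (\<forall>z\<in>ball (coords c (Z a)) \<epsilon>. fst (\<Phi> z t) \<in> cdom d) \<and>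
         continuous_on (ball (coords c (Z a)) \<epsilon>) (\<lambda>z. coords d (\<Phi> z t))) \<and>
      ((\<lambda>z. coords d (\<Phi> z t)) has_derivative A d t) (at (coords c (Z a))) \<and>
      (\<forall>\<zeta>. ((\<lambda>s. A d s \<zeta>) has_vector_derivative dspray d (coords d (Z t)) (A d t \<zeta>)) (at t within {a..b})))"

text \<open>For a piece inside one chart \<open>d\<close> the flow comes from
  \<open>ode_flow_along\<close>. Transitions are composed on both sides, from \<open>c\<close> into
  \<open>d\<close> at the start and from \<open>d\<close> into an arbitrary chart at time
  \<open>t\<close>; the chain rule gives the derivative, and \<open>related_linearization\<close>
  transports the linearised equation.\<close>

lemma flow_around_local:
  assumes "a \<le> b" and Z: "integral_curve {a..b} Z" and d: "d \<in> \<A>" "\<And>t. t \<in> {a..b} \<Longrightarrow> fst (Z t) \<in> cdom d"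
    and c: "c \<in> charts_at (fst (Z a))"
  shows "\<exists>\<delta> \<Phi> A. flow_around Z a b c \<delta> \<Phi> A"
proof -
  define \<sigma> where "\<sigma> t = coords d (Z t)" for t
  have \<sigma>dom: "\<sigma> t \<in> bundle_dom d" if "t \<in> {a..b}" for t
    unfolding \<sigma>_def by (rule coords_in_bundle_dom[OF d(2)[OF that]])
  have \<sigma>: "(\<sigma> has_vector_derivative spray d (\<sigma> t)) (at t within {a..b})" if "t \<in> {a..b}" for t
    using Z d that unfolding integral_curve_def \<sigma>_def charts_at_def by blast
  have TB: "Z t \<in> tangent_bundle" if "t \<in> {a..b}" for t using Z that by (simp add: integral_curve_def)
  have dat: "d \<in> charts_at (fst (Z t))" if "t \<in> {a..b}" for t using d that by (simp add: charts_at_def)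
  have dsp: "(spray d has_derivative dspray d p) (at p)" if "p \<in> bundle_dom d" for p
    unfolding dspray_def by (rule Ck_Suc_has_derivative[OF Ck_spray[OF d(1)] open_bundle_dom[OF d(1)] that])
  have dspc: "continuous_on (bundle_dom d) (\<lambda>p. dspray d p v)" for v
    unfolding dspray_def
    by (rule Ck_imp_continuous_on[OF Ck_frechet_derivative[OF Ck_spray[OF d(1)] open_bundle_dom[OF d(1)]]])
  show ?thesis
  proof (rule ode_flow_along[OF open_bundle_dom[OF d(1)] \<open>a \<le> b\<close> dsp dspc \<sigma>dom \<sigma>])
    fix \<delta>' y B
    assume \<delta>': "\<delta>' > 0" "ball (\<sigma> a) \<delta>' \<subseteq> bundle_dom d"
    and y0: "\<And>z. z \<in> ball (\<sigma> a) \<delta>' \<Longrightarrow> y z a = z"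
    and ydom: "\<And>z t. z \<in> ball (\<sigma> a) \<delta>' \<Longrightarrow> t \<in> {a..b} \<Longrightarrow> y z t \<in> bundle_dom d"
    and y: "\<And>z t. z \<in> ball (\<sigma> a) \<delta>' \<Longrightarrow> t \<in> {a..b} \<Longrightarrow> (y z has_vector_derivative spray d (y z t)) (at t within {a..b})"
    and y\<sigma>: "\<And>t. t \<in> {a..b} \<Longrightarrow> y (\<sigma> a) t = \<sigma> t"
    and ycont: "\<And>t. t \<in> {a..b} \<Longrightarrow> continuous_on (ball (\<sigma> a) \<delta>') (\<lambda>z. y z t)"
    and yB: "\<And>t. t \<in> {a..b} \<Longrightarrow> ((\<lambda>z. y z t) has_derivative B t) (at (\<sigma> a))"
    and B: "\<And>t \<zeta>. t \<in> {a..b} \<Longrightarrow> ((\<lambda>s. B s \<zeta>) has_vector_derivative dspray d (\<sigma> t) (B t \<zeta>)) (at t within {a..b})"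
  have a: "a \<in> {a..b}" using \<open>a \<le> b\<close> by simp
  define p where "p = coords c (Z a)"
  define \<tau> where "\<tau> = btrans c d"
  have cA: "c \<in> \<A>" using c charts_atD by blast
  have p: "p \<in> bundle_overlap c d"
    unfolding p_def using c d(2)[OF a] by (intro coords_in_bundle_overlap) (auto dest: charts_atD)
  have \<tau>p: "\<tau> p = \<sigma> a"
    unfolding \<tau>_def p_def \<sigma>_def by (rule coords_btrans[OF TB[OF a] c dat[OF a], symmetric])
  have \<tau>cont: "continuous_on (bundle_overlap c d) \<tau>"
    unfolding \<tau>_def by (rule Ck_imp_continuous_on[OF Ck_btrans[OF cA d(1)]])
  have "open (bundle_overlap c d \<inter> \<tau> -` ball (\<sigma> a) \<delta>')"
    by (rule continuous_open_preimage[OF \<tau>cont open_bundle_overlap[OF cA d(1)] open_ball])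
  then obtain \<delta> where \<delta>: "\<delta> > 0" "ball p \<delta> \<subseteq> bundle_overlap c d \<inter> \<tau> -` ball (\<sigma> a) \<delta>'"
    using p \<tau>p \<delta>'(1) open_contains_ball by (metis IntI centre_in_ball vimageI)
  define \<Phi> where "\<Phi> z t = point_of d (y (\<tau> z) t)" for z t
  define A where "A e t \<zeta> = frechet_derivative (btrans d e) (at (\<sigma> t)) (B t (frechet_derivative \<tau> (at p) \<zeta>))" for e t \<zeta>
  have \<tau>: "(\<tau> has_derivative frechet_derivative \<tau> (at p)) (at p)"
    unfolding \<tau>_def by (rule Ck_Suc_has_derivative[OF Ck_btrans[OF cA d(1)] open_bundle_overlap[OF cA d(1)] p])
  have "flow_around Z a b c \<delta> \<Phi> A"
    unfolding flow_around_def p_def[symmetric]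
  proof (intro conjI ballI allI \<delta>(1))
    show "ball p \<delta> \<subseteq> bundle_dom c" using \<delta>(2) bundle_overlap_subset by blast
  next
    fix z assume z: "z \<in> ball p \<delta>"
    then have \<tau>z: "\<tau> z \<in> ball (\<sigma> a) \<delta>'" and z': "z \<in> bundle_overlap c d" using \<delta>(2) by auto
    show "integral_curve {a..b} (\<Phi> z)"
      unfolding \<Phi>_def by (rule integral_curve_point_of[OF d(1) ydom[OF \<tau>z] y[OF \<tau>z]])
    show "\<Phi> z a = point_of c z"
      unfolding \<Phi>_def y0[OF \<tau>z] unfolding \<tau>_def by (rule point_of_btrans[OF cA d(1) z'])
  next
    fix t assume t: "t \<in> {a..b}"
    show "\<Phi> p t = Z t"
      unfolding \<Phi>_def \<tau>p y\<sigma>[OF t] unfolding \<sigma>_def by (rule point_of_coords[OF TB[OF t] dat[OF t]])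
  next
    fix t e assume t: "t \<in> {a..b}" and e: "e \<in> charts_at (fst (Z t))"
    have eA: "e \<in> \<A>" using e charts_atD by blast
    have \<sigma>e: "\<sigma> t \<in> bundle_overlap d e"
      unfolding \<sigma>_def using e d(2)[OF t] by (intro coords_in_bundle_overlap) (auto dest: charts_atD)
    have ytc: "continuous_on (ball p \<delta>) (\<lambda>z. y (\<tau> z) t)"
      by (rule continuous_on_compose2[OF ycont[OF t] continuous_on_subset[OF \<tau>cont]]) (use \<delta>(2) in auto)
    have "open (ball p \<delta> \<inter> (\<lambda>z. y (\<tau> z) t) -` bundle_overlap d e)"
      by (rule continuous_open_preimage[OF ytc open_ball open_bundle_overlap[OF d(1) eA]])
    moreover have "p \<in> ball p \<delta> \<inter> (\<lambda>z. y (\<tau> z) t) -` bundle_overlap d e"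
      using \<delta>(1) \<tau>p y\<sigma>[OF t] \<sigma>e by simp
    ultimately obtain \<epsilon>0 where \<epsilon>0: "\<epsilon>0 > 0" "ball p \<epsilon>0 \<subseteq> ball p \<delta> \<inter> (\<lambda>z. y (\<tau> z) t) -` bundle_overlap d e"
      using open_contains_ball by metis
    define \<epsilon> where "\<epsilon> = min \<epsilon>0 \<delta>"
    have \<epsilon>: "\<epsilon> > 0" "\<epsilon> \<le> \<delta>" "ball p \<epsilon> \<subseteq> ball p \<delta>" and ye: "\<And>z. z \<in> ball p \<epsilon> \<Longrightarrow> y (\<tau> z) t \<in> bundle_overlap d e"
      using \<epsilon>0 \<delta>(1) by (auto simp: \<epsilon>_def)
    have ce: "coords e (\<Phi> z t) = btrans d e (y (\<tau> z) t)" if "z \<in> ball p \<epsilon>" for z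
      unfolding \<Phi>_def by (rule coords_point_of[OF d(1) eA ye[OF that]])
    show "\<exists>\<epsilon>>0. \<epsilon> \<le> \<delta> \<and> (\<forall>z\<in>ball p \<epsilon>. fst (\<Phi> z t) \<in> cdom e) \<and> continuous_on (ball p \<epsilon>) (\<lambda>z. coords e (\<Phi> z t))"
    proof (intro exI conjI ballI)
      show "fst (\<Phi> z t) \<in> cdom e" if "z \<in> ball p \<epsilon>" for z
        unfolding \<Phi>_def
        using point_of_in_cdom_iff[OF d(1) subsetD[OF bundle_overlap_subset ye[OF that]]] ye[OF that] by blast
      have "continuous_on (ball p \<epsilon>) (\<lambda>z. btrans d e (y (\<tau> z) t))"
        by (rule continuous_on_compose2[OF Ck_imp_continuous_on[OF Ck_btrans[OF d(1) eA]] continuous_on_subset[OF ytc \<epsilon>(3)]])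
          (use ye in auto)
      then show "continuous_on (ball p \<epsilon>) (\<lambda>z. coords e (\<Phi> z t))"
        by (rule continuous_on_eq) (simp add: ce)
    qed (use \<epsilon> in auto)
    have yB': "((\<lambda>z. y z t) has_derivative B t) (at (\<tau> p))" using yB[OF t] \<tau>p by simp
    have bt: "(btrans d e has_derivative frechet_derivative (btrans d e) (at (\<sigma> t))) (at (y (\<tau> p) t))"
      using Ck_Suc_has_derivative[OF Ck_btrans[OF d(1) eA] open_bundle_overlap[OF d(1) eA] \<sigma>e] \<tau>p y\<sigma>[OF t] by simp
    have "((\<lambda>z. btrans d e (y (\<tau> z) t)) has_derivative A e t) (at p)"
      unfolding A_def by (rule has_derivative_compose[OF has_derivative_compose[OF \<tau> yB'] bt])
    then show "((\<lambda>z. coords e (\<Phi> z t)) has_derivative A e t) (at p)"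
      by (rule has_derivative_transform_within_open[OF _ open_ball[of p \<epsilon>]]) (use \<epsilon>(1) ce in auto)
    fix \<zeta>
    have sub: "btrans d e ` bundle_overlap d e \<subseteq> bundle_dom e"
      using btrans_in[OF d(1) eA] bundle_overlap_subset by blast
    have Ckd: "Ck (Suc 0) (bundle_overlap d e) (spray d)"
      by (rule Ck_subset[OF Ck_spray[OF d(1)] bundle_overlap_subset])
    have "btrans d e (\<sigma> t) = coords e (Z t)"
      unfolding \<sigma>_def by (rule coords_btrans[OF TB[OF t] dat[OF t] e, symmetric])
    then show "((\<lambda>s. A e s \<zeta>) has_vector_derivative dspray e (coords e (Z t)) (A e t \<zeta>)) (at t within {a..b})"
      using related_linearization[OF Ck_btrans[OF d(1) eA] open_bundle_overlap[OF d(1) eA] sub Ckd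
          Ck_spray[OF eA] open_bundle_dom[OF eA] spray_related[OF d(1) eA] t \<sigma>e \<sigma>[OF t]]
        B[OF t, of "frechet_derivative \<tau> (at p) \<zeta>"]
      unfolding A_def dspray_def by simp
  qed
  then show ?thesis by blast
  qed
qed

text \<open>Flows compose: the end coordinates of the first flow in the chart \<open>e\<close> are
  the initial coordinates of the second, and the derivatives compose accordingly. Continuity of the
  first flow at time \<open>b\<close> allows the initial ball to shrink until its image lies in the
  domain of the second.\<close>

lemma flow_around_glue:
  assumes "a < b" "b < b'" and c: "c \<in> charts_at (fst (Z a))"
    and flow1: "flow_around Z a b c \<delta>1 \<Phi>1 A1"
    and e: "e \<in> charts_at (fst (Z b))" and flow2: "flow_around Z b b' e \<delta>2 \<Phi>2 A2"
  shows "\<exists>\<delta> \<Phi> A. flow_around Z a b' c \<delta> \<Phi> A"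
proof -
  define p where "p = coords c (Z a)"
  define q where "q = coords e (Z b)"
  define \<tau> where "\<tau> z = coords e (\<Phi>1 z b)" for z
  have eA: "e \<in> \<A>" using e charts_atD by blast
  have b: "b \<in> {a..b}" "b \<in> {b..b'}" using assms by auto
  note f1 = flow1[unfolded flow_around_def p_def[symmetric]]
  note f2 = flow2[unfolded flow_around_def q_def[symmetric]]
  obtain \<epsilon>1 where \<epsilon>1: "\<epsilon>1 > 0" "\<epsilon>1 \<le> \<delta>1" "\<And>z. z \<in> ball p \<epsilon>1 \<Longrightarrow> fst (\<Phi>1 z b) \<in> cdom e"
    "continuous_on (ball p \<epsilon>1) \<tau>"
    using f1 b(1) e unfolding \<tau>_def by blast
  have \<tau>p: "\<tau> p = q" using f1 b(1) unfolding \<tau>_def q_def by simp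
  have "open (ball p \<epsilon>1 \<inter> \<tau> -` ball q \<delta>2)"
    by (rule continuous_open_preimage[OF \<epsilon>1(4) open_ball open_ball])
  moreover have "p \<in> ball p \<epsilon>1 \<inter> \<tau> -` ball q \<delta>2" using \<epsilon>1(1) \<tau>p f2 by simp
  ultimately obtain \<delta> where \<delta>: "\<delta> > 0" "ball p \<delta> \<subseteq> ball p \<epsilon>1 \<inter> \<tau> -` ball q \<delta>2"
    using open_contains_ball by metis
  have \<delta>1: "z \<in> ball p \<delta>1" and \<delta>\<epsilon>: "z \<in> ball p \<epsilon>1" and \<delta>2: "\<tau> z \<in> ball q \<delta>2" if "z \<in> ball p \<delta>" for z
    using that \<delta>(2) \<epsilon>1(2) by auto
  define \<Phi> where "\<Phi> z t = (if t \<le> b then \<Phi>1 z t else \<Phi>2 (\<tau> z) t)" for z t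
  define A where "A d t \<zeta> = (if t \<le> b then A1 d t \<zeta> else A2 d t (A1 e b \<zeta>))" for d t \<zeta>
  have joint: "\<Phi>2 (\<tau> z) b = \<Phi>1 z b" if "z \<in> ball p \<delta>" for z
  proof -
    have "\<Phi>2 (\<tau> z) b = point_of e (\<tau> z)" using f2 \<delta>2[OF that] by blast
    also have "\<dots> = \<Phi>1 z b"
      unfolding \<tau>_def
    proof (rule point_of_coords)
      show "\<Phi>1 z b \<in> tangent_bundle" using f1 \<delta>1[OF that] b(1) by (simp add: integral_curve_def)
      show "e \<in> charts_at (fst (\<Phi>1 z b))" using \<epsilon>1(3)[OF \<delta>\<epsilon>[OF that]] eA by (simp add: charts_at_def)
    qed
    finally show ?thesis .
  qed
  have \<tau>d: "(\<tau> has_derivative A1 e b) (at p)" using f1 b(1) e unfolding \<tau>_def by blast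
  \<comment> \<open>At the joint both sides are the derivative of
    \<open>z \<mapsto> coords d (\<Phi>1 z b)\<close>; their agreement is what lets the two
    linearised solutions be glued.\<close>
  have A12: "A1 d b \<zeta> = A2 d b (A1 e b \<zeta>)" if d: "d \<in> charts_at (fst (Z b))" for d \<zeta>
  proof -
    have 1: "((\<lambda>z. coords d (\<Phi>1 z b)) has_derivative A1 d b) (at p)" using f1 b(1) d by blast
    have 2: "((\<lambda>z. coords d (\<Phi>2 z b)) has_derivative A2 d b) (at (\<tau> p))" using f2 b(2) d \<tau>p by simp
    have "((\<lambda>z. coords d (\<Phi>1 z b)) has_derivative (\<lambda>\<zeta>. A2 d b (A1 e b \<zeta>))) (at p)"
      by (rule has_derivative_transform_within_open[OF has_derivative_compose[OF \<tau>d 2] open_ball[of p \<delta>]])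
        (use \<delta>(1) joint in auto)
    from has_derivative_unique[OF 1 this] show ?thesis by metis
  qed
  have "flow_around Z a b' c \<delta> \<Phi> A"
    unfolding flow_around_def p_def[symmetric]
  proof (intro conjI ballI allI \<delta>(1))
    show "ball p \<delta> \<subseteq> bundle_dom c" using \<delta>1 f1 by blast
  next
    fix z assume z: "z \<in> ball p \<delta>"
    have "integral_curve {a..b} (\<Phi>1 z)" "integral_curve {b..b'} (\<Phi>2 (\<tau> z))"
      using f1 f2 \<delta>1[OF z] \<delta>2[OF z] by blast+
    then show "integral_curve {a..b'} (\<Phi> z)"
      unfolding \<Phi>_def by (rule integral_curve_glue[OF assms(1,2)]) (rule joint[OF z, symmetric])
    show "\<Phi> z a = point_of c z" using f1 \<delta>1[OF z] \<open>a < b\<close> by (simp add: \<Phi>_def)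
  next
    fix t assume t: "t \<in> {a..b'}"
    then show "\<Phi> p t = Z t"
      using f1 f2 \<tau>p by (simp add: \<Phi>_def)
  next
    fix t d assume t: "t \<in> {a..b'}" and d: "d \<in> charts_at (fst (Z t))"
    show "\<exists>\<epsilon>>0. \<epsilon> \<le> \<delta> \<and> (\<forall>z\<in>ball p \<epsilon>. fst (\<Phi> z t) \<in> cdom d) \<and> continuous_on (ball p \<epsilon>) (\<lambda>z. coords d (\<Phi> z t))"
    proof (cases "t \<le> b")
      case True
      then have "t \<in> {a..b}" using t by simp
      then obtain \<epsilon> where "\<epsilon> > 0" "\<forall>z\<in>ball p \<epsilon>. fst (\<Phi>1 z t) \<in> cdom d"
          "continuous_on (ball p \<epsilon>) (\<lambda>z. coords d (\<Phi>1 z t))"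
        using f1 d by blast
      with True \<delta>(1) show ?thesis
        by (intro exI[of _ "min \<epsilon> \<delta>"]) (auto simp: \<Phi>_def intro: continuous_on_subset)
    next
      case False
      then have "t \<in> {b..b'}" using t by simp
      then obtain \<epsilon> where \<epsilon>: "\<epsilon> > 0" "\<forall>z\<in>ball q \<epsilon>. fst (\<Phi>2 z t) \<in> cdom d"
          "continuous_on (ball q \<epsilon>) (\<lambda>z. coords d (\<Phi>2 z t))"
        using f2 d by blast
      have \<tau>c: "continuous_on (ball p \<delta>) \<tau>" using \<epsilon>1(4) \<delta>\<epsilon> by (auto intro: continuous_on_subset)
      have "open (ball p \<delta> \<inter> \<tau> -` ball q \<epsilon>)" by (rule continuous_open_preimage[OF \<tau>c open_ball open_ball])
      moreover have "p \<in> ball p \<delta> \<inter> \<tau> -` ball q \<epsilon>" using \<delta>(1) \<tau>p \<epsilon>(1) by simp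
      ultimately obtain \<eta> where \<eta>: "\<eta> > 0" "ball p \<eta> \<subseteq> ball p \<delta> \<inter> \<tau> -` ball q \<epsilon>"
        using open_contains_ball by metis
      have sub: "ball p (min \<eta> \<delta>) \<subseteq> ball p \<delta> \<inter> \<tau> -` ball q \<epsilon>" using \<eta>(2) by auto
      have "continuous_on (ball p (min \<eta> \<delta>)) (\<lambda>z. coords d (\<Phi>2 (\<tau> z) t))"
        by (rule continuous_on_compose2[OF \<epsilon>(3) continuous_on_subset[OF \<tau>c]]) (use sub in auto)
      with False \<delta>(1) \<eta>(1) \<epsilon>(2) sub show ?thesis
        by (intro exI[of _ "min \<eta> \<delta>"]) (auto simp: \<Phi>_def)
    qed
    show "((\<lambda>z. coords d (\<Phi> z t)) has_derivative A d t) (at p)"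
    proof (cases "t \<le> b")
      case True
      then have "A d t = A1 d t" by (simp add: A_def fun_eq_iff)
      with True show ?thesis using f1 t d by (simp add: \<Phi>_def)
    next
      case False
      then have "((\<lambda>z. coords d (\<Phi>2 z t)) has_derivative A2 d t) (at (\<tau> p))" using f2 t d \<tau>p by simp
      moreover have "A d t = (\<lambda>\<zeta>. A2 d t (A1 e b \<zeta>))" using False by (simp add: A_def fun_eq_iff)
      ultimately show ?thesis using False has_derivative_compose[OF \<tau>d] by (simp add: \<Phi>_def)
    qed
    fix \<zeta>
    have e1: "t \<le> b \<Longrightarrow> A d t \<zeta> = A1 d t \<zeta>" and e2: "b \<le> t \<Longrightarrow> A d t \<zeta> = A2 d t (A1 e b \<zeta>)"
      using A12[of d \<zeta>] d by (cases "t = b"; simp add: A_def)+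
    have D1: "\<forall>t\<in>{a..b}. \<forall>d\<in>charts_at (fst (Z t)). \<forall>\<zeta>. ((\<lambda>s. A1 d s \<zeta>) has_vector_derivative
        dspray d (coords d (Z t)) (A1 d t \<zeta>)) (at t within {a..b})"
      using f1 by blast
    have D2: "\<forall>t\<in>{b..b'}. \<forall>d\<in>charts_at (fst (Z t)). \<forall>\<zeta>. ((\<lambda>s. A2 d s \<zeta>) has_vector_derivative
        dspray d (coords d (Z t)) (A2 d t \<zeta>)) (at t within {b..b'})"
      using f2 by blast
    have d1: "((\<lambda>s. A1 d s \<zeta>) has_vector_derivative dspray d (coords d (Z t)) (A d t \<zeta>)) (at t within {a..b})"
      if "t \<le> b"
      unfolding e1[OF that] by (rule D1[rule_format]) (use that t d in auto)
    have d2: "((\<lambda>s. A2 d s (A1 e b \<zeta>)) has_vector_derivative dspray d (coords d (Z t)) (A d t \<zeta>)) (at t within {b..b'})"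
      if "b \<le> t"
      unfolding e2[OF that] by (rule D2[rule_format]) (use that t d in auto)
    have "((\<lambda>s. if s \<le> b then A1 d s \<zeta> else A2 d s (A1 e b \<zeta>)) has_vector_derivative
        dspray d (coords d (Z t)) (A d t \<zeta>)) (at t within {a..b'})"
      by (rule has_vector_derivative_glue[OF t assms(1,2) d1 d2]) (use A12[of d \<zeta>] d in simp_all)
    moreover have "(\<lambda>s. A d s \<zeta>) = (\<lambda>s. if s \<le> b then A1 d s \<zeta> else A2 d s (A1 e b \<zeta>))"
      by (simp add: A_def fun_eq_iff)
    ultimately show "((\<lambda>s. A d s \<zeta>) has_vector_derivative dspray d (coords d (Z t)) (A d t \<zeta>)) (at t within {a..b'})"
      by simp
  qed
  then show ?thesis by blast
qed

text \<open>Bisection: a property that passes to adjoining intervals and holds on all sufficiently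
  short ones holds on \<open>{0..l}\<close>. Short pieces of the curve lie in a single
  chart.\<close>

lemma flow_around_exists:
  assumes "0 < l" and Z: "integral_curve {0..l} Z" and "c \<in> charts_at (fst (Z 0))"
  shows "\<exists>\<delta> \<Phi> A. flow_around Z 0 l c \<delta> \<Phi> A"
proof -
  define P where "P a b \<longleftrightarrow> (0 \<le> a \<and> a < b \<and> b \<le> l \<longrightarrow> (\<forall>c\<in>charts_at (fst (Z a)). \<exists>\<delta> \<Phi> A. flow_around Z a b c \<delta> \<Phi> A))"
    for a b
  have TB: "Z t \<in> tangent_bundle" if "t \<in> {0..l}" for t using Z that by (simp add: integral_curve_def)
  have "P 0 l"
  proof (rule Bolzano)
    show "0 \<le> l" using assms by simp
  next
    fix a b b' assume P: "P a b" "P b b'" "a \<le> b" "b \<le> b'"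
    show "P a b'"
      unfolding P_def
    proof (intro impI ballI)
      fix c assume ab: "0 \<le> a \<and> a < b' \<and> b' \<le> l" and c: "c \<in> charts_at (fst (Z a))"
      show "\<exists>\<delta> \<Phi> A. flow_around Z a b' c \<delta> \<Phi> A"
      proof (cases "a = b \<or> b = b'")
        case True
        then show ?thesis using P ab c unfolding P_def by auto
      next
        case False
        then have lt: "a < b" "b < b'" using P by auto
        obtain e where e: "e \<in> charts_at (fst (Z b))"
          using charts_at_exists[of "fst (Z b)"] tangent_bundleD[OF TB[of b]] lt ab by force
        from P(1) lt ab c obtain \<delta>1 \<Phi>1 A1 where "flow_around Z a b c \<delta>1 \<Phi>1 A1" unfolding P_def by auto
        moreover from P(2) lt ab e obtain \<delta>2 \<Phi>2 A2 where "flow_around Z b b' e \<delta>2 \<Phi>2 A2" unfolding P_def by auto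
        ultimately show ?thesis using flow_around_glue[OF lt c _ e] by blast
      qed
    qed
  next
    fix x assume x: "0 \<le> x" "x \<le> l"
    then obtain d where d: "d \<in> charts_at (fst (Z x))"
      using charts_at_exists[of "fst (Z x)"] tangent_bundleD[OF TB[of x]] by force
    then have "\<forall>\<^sub>F s in at x within {0..l}. fst (Z s) \<in> cdom d"
      using Z x by (simp add: integral_curve_def)
    then obtain \<eta> where \<eta>: "\<eta> > 0" "\<And>s. s \<in> {0..l} \<Longrightarrow> s \<noteq> x \<Longrightarrow> dist s x < \<eta> \<Longrightarrow> fst (Z s) \<in> cdom d"
      unfolding eventually_at by blast
    have \<eta>': "fst (Z s) \<in> cdom d" if "s \<in> {0..l}" "dist s x < \<eta>" for s
      using \<eta>(2)[OF that(1) _ that(2)] charts_atD[OF d] by (cases "s = x") auto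
    show "\<exists>\<eta>>0. \<forall>a b. a \<le> x \<and> x \<le> b \<and> b - a < \<eta> \<longrightarrow> P a b"
    proof (intro exI[of _ \<eta>] conjI allI impI \<eta>(1))
      fix a b assume ab: "a \<le> x \<and> x \<le> b \<and> b - a < \<eta>"
      show "P a b"
        unfolding P_def
      proof (intro impI ballI)
        fix c assume 0: "0 \<le> a \<and> a < b \<and> b \<le> l" and c: "c \<in> charts_at (fst (Z a))"
        show "\<exists>\<delta> \<Phi> A. flow_around Z a b c \<delta> \<Phi> A"
        proof (rule flow_around_local[of a b Z d c])
          show "integral_curve {a..b} Z" by (rule integral_curve_subset[OF Z]) (use 0 in auto)
          show "fst (Z t) \<in> cdom d" if "t \<in> {a..b}" for t
            by (rule \<eta>') (use that 0 ab in \<open>auto simp: dist_real_def\<close>)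
        qed (use 0 c d charts_atD in auto)
      qed
    qed
  qed
  then show ?thesis using assms unfolding P_def by auto
qed

end

section \<open>Geodesics as integral curves of the spray\<close>

text \<open>Bootstrapping: if \<open>z\<close> is \<open>Ck k\<close>, so is its derivative
  \<open>f \<circ> z\<close>, hence \<open>z\<close> is \<open>Ck (Suc k)\<close>.\<close>

lemma ode_solution_Ck:
  fixes z :: "real \<Rightarrow> 'e::euclidean_space"
  assumes f: "\<And>k. Ck k U f" and zU: "\<And>t. t \<in> S \<Longrightarrow> z t \<in> U"
    and z: "\<And>t. t \<in> S \<Longrightarrow> (z has_vector_derivative f (z t)) (at t within S)"
  shows "Ck k S z"
proof (induction k)
  case 0
  show ?case unfolding Ck.simps by (rule continuous_on_vector_derivative[OF z])
next
  case (Suc k)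
  have "Ck k S (\<lambda>t. r *\<^sub>R f (z t))" for r
    by (intro Ck_scaleR Ck_const Ck_compose[OF f Suc]) (use zU in auto)
  then show ?case unfolding Ck.simps
    using z by (intro exI[of _ "\<lambda>t r. r *\<^sub>R f (z t)"]) (auto simp: has_vector_derivative_def)
qed

lemma at_within_eventually:
  assumes "\<forall>\<^sub>F s in at t within I. P s"
  shows "at t within {s \<in> I. P s} = at t within I"
proof -
  obtain B where "open B" "t \<in> B" "\<And>s. s \<in> B \<Longrightarrow> s \<noteq> t \<Longrightarrow> s \<in> I \<Longrightarrow> P s"
    using assms unfolding eventually_at_topological by blast
  then show ?thesis by (intro at_within_nhd[of t B]) auto
qed

lemma has_vector_derivative_fst:
  "(f has_vector_derivative D) F \<Longrightarrow> ((\<lambda>s. fst (f s)) has_vector_derivative fst D) F"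
  by (rule bounded_linear.has_vector_derivative[OF bounded_linear_fst])

lemma has_vector_derivative_snd:
  "(f has_vector_derivative D) F \<Longrightarrow> ((\<lambda>s. snd (f s)) has_vector_derivative snd D) F"
  by (rule bounded_linear.has_vector_derivative[OF bounded_linear_snd])

lemma has_vector_derivative_transform_eventually:
  assumes "(f has_vector_derivative D) (at t within I)" "\<forall>\<^sub>F s in at t within I. f s = h s" "f t = h t" "t \<in> I"
  shows "(h has_vector_derivative D) (at t within I)"
  using assms has_derivative_transform_eventually unfolding has_vector_derivative_def by blast

lemma (in smooth_manifold) zero_tvec_tangent: "c \<in> charts_at p \<Longrightarrow> zero_tvec p \<in> tangent_space p"
  using tvec_of_tangent[of c p 0] tvec_of_linear(3)[of c p] by (auto dest: charts_atD)

lemma (in smooth_manifold) scale_tvec_tangent: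
  assumes "c \<in> charts_at p" "v \<in> tangent_space p"
  shows "scale_tvec p r v = tvec_of c p (r *\<^sub>R v c)"
  using tvec_of_linear(2)[OF assms(1), of r "v c"] tvec_of_component[OF assms(2,1)] by simp

section \<open>From integral curves to unit-speed geodesics\<close>

context riemannian_manifold
begin

definition speed2 :: "'a \<times> ('a, 'n) tvec \<Rightarrow> real" where
  "speed2 P = g (fst P) (snd P) (snd P)"

lemma speed2_coords:
  assumes "P \<in> tangent_bundle" "c \<in> charts_at (fst P)"
  shows "speed2 P = metric_in c (fst (coords c P)) (snd (coords c P)) (snd (coords c P))"
  using metric_in_coords[OF assms(2)] tangent_bundleD[OF assms(1)] by (simp add: speed2_def coords_def)

lemma integral_curveD:
  assumes "integral_curve I Z" "t \<in> I"
  shows integral_curve_tangent_bundle: "Z t \<in> tangent_bundle"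
    and integral_curve_eventually: "c \<in> charts_at (fst (Z t)) \<Longrightarrow> \<forall>\<^sub>F s in at t within I. fst (Z s) \<in> cdom c"
    and integral_curve_deriv: "c \<in> charts_at (fst (Z t)) \<Longrightarrow>
      ((\<lambda>s. coords c (Z s)) has_vector_derivative spray c (coords c (Z t))) (at t within I)"
  using assms by (auto simp: integral_curve_def)

lemma integral_curve_charts:
  assumes "integral_curve I Z" "t \<in> I"
  obtains c where "c \<in> charts_at (fst (Z t))"
  using charts_at_exists tangent_bundleD[OF integral_curve_tangent_bundle[OF assms]] by blast

lemma integral_curve_dom:
  assumes "integral_curve I Z" "c \<in> \<A>" "t \<in> {s \<in> I. fst (Z s) \<in> cdom c}"
  shows "((\<lambda>s. coords c (Z s)) has_vector_derivative spray c (coords c (Z t)))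
      (at t within {s \<in> I. fst (Z s) \<in> cdom c})"
    and "coords c (Z t) \<in> bundle_dom c"
proof -
  show "((\<lambda>s. coords c (Z s)) has_vector_derivative spray c (coords c (Z t)))
      (at t within {s \<in> I. fst (Z s) \<in> cdom c})"
    using assms by (intro has_vector_derivative_within_subset[OF integral_curve_deriv[OF assms(1)]])
      (auto simp: charts_at_def)
  show "coords c (Z t) \<in> bundle_dom c" using assms by (intro coords_in_bundle_dom) auto
qed

lemma integral_curve_Ck:
  assumes "integral_curve I Z" "c \<in> \<A>"
  shows "Ck k {s \<in> I. fst (Z s) \<in> cdom c} (\<lambda>s. coords c (Z s))"
  by (rule ode_solution_Ck[OF Ck_spray[OF assms(2)] integral_curve_dom(2,1)[OF assms]])

text \<open>Continuity is recovered from the two clauses at a chart: nearby points stay in its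
  domain, where the chart map is injective, and their coordinates converge and so enter the open
  image of the given neighbourhood.\<close>

lemma integral_curve_continuous_map:
  assumes Z: "integral_curve I Z"
  shows "continuous_map (top_of_set I) X (\<lambda>t. fst (Z t))"
  unfolding continuous_map_def
proof (intro conjI allI impI)
  show "(\<lambda>t. fst (Z t)) \<in> topspace (top_of_set I) \<rightarrow> topspace X"
    using integral_curve_tangent_bundle[OF Z] tangent_bundleD by auto
  fix U assume U: "openin X U"
  have "\<exists>B. open B \<and> t \<in> B \<and> (\<forall>s\<in>B \<inter> I. fst (Z s) \<in> U)" if t: "t \<in> I" "fst (Z t) \<in> U" for t
  proof -
    obtain c where c: "c \<in> charts_at (fst (Z t))" using integral_curve_charts[OF Z t(1)] .
    then have cA: "c \<in> \<A>" and tc: "fst (Z t) \<in> cdom c" using charts_atD by auto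
    define V where "V = cmap c ` (cdom c \<inter> U)"
    have V: "open V" unfolding V_def by (rule open_cmap_image[OF cA U])
    have "((\<lambda>s. fst (coords c (Z s))) \<longlongrightarrow> fst (coords c (Z t))) (at t within I)"
      using has_vector_derivative_continuous[OF has_vector_derivative_fst[OF integral_curve_deriv[OF Z t(1) c]]]
      unfolding continuous_within .
    then have "\<forall>\<^sub>F s in at t within I. fst (coords c (Z s)) \<in> V"
      by (rule topological_tendstoD[OF _ V]) (use t tc in \<open>auto simp: V_def coords_def\<close>)
    with integral_curve_eventually[OF Z t(1) c] have "\<forall>\<^sub>F s in at t within I. fst (Z s) \<in> U"
    proof eventually_elim
      case (elim s)
      then obtain q where q: "q \<in> cdom c" "q \<in> U" "cmap c (fst (Z s)) = cmap c q"
        by (auto simp: V_def coords_def)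
      then have "fst (Z s) = q" using cmap_inj[OF cA] elim(1) by (simp add: inj_on_def)
      then show ?case using q by simp
    qed
    then obtain B where "open B" "t \<in> B" "\<And>s. s \<in> B \<Longrightarrow> s \<noteq> t \<Longrightarrow> s \<in> I \<Longrightarrow> fst (Z s) \<in> U"
      unfolding eventually_at_topological by blast
    then show ?thesis using t(2) by (intro exI[of _ B]) auto
  qed
  then obtain B where B: "\<And>t. t \<in> I \<Longrightarrow> fst (Z t) \<in> U \<Longrightarrow> open (B t) \<and> t \<in> B t \<and> (\<forall>s\<in>B t \<inter> I. fst (Z s) \<in> U)"
    by metis
  have "{t \<in> topspace (top_of_set I). fst (Z t) \<in> U} = I \<inter> (\<Union>t\<in>{t \<in> I. fst (Z t) \<in> U}. B t)"
    using B by auto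
  moreover have "open (\<Union>t\<in>{t \<in> I. fst (Z t) \<in> U}. B t)" using B by (intro open_UN) simp
  ultimately show "openin (top_of_set I) {t \<in> topspace (top_of_set I). fst (Z t) \<in> U}"
    unfolding openin_open by blast
qed

lemma integral_curve_smooth:
  assumes "integral_curve I Z"
  shows "smooth_curve I (\<lambda>t. fst (Z t))"
  unfolding smooth_curve_def smooth_on_def
proof (intro conjI ballI allI integral_curve_continuous_map[OF assms])
  fix c k assume "c \<in> \<A>"
  then show "Ck k {t \<in> I. fst (Z t) \<in> cdom c} (cmap c \<circ> (\<lambda>t. fst (Z t)))"
    using Ck_linear_compose[OF bounded_linear_fst integral_curve_Ck[OF assms]]
    by (simp add: coords_def o_def)
qed

lemma integral_curve_velocity:
  assumes Z: "integral_curve I Z" and "t \<in> I" "at t within I \<noteq> bot"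
  shows "velocity I (\<lambda>t. fst (Z t)) t = snd (Z t)"
proof (rule extensionalityI)
  show "velocity I (\<lambda>t. fst (Z t)) t \<in> extensional (charts_at (fst (Z t)))" by (simp add: velocity_def)
  show "snd (Z t) \<in> extensional (charts_at (fst (Z t)))"
    using tangent_bundleD[OF integral_curve_tangent_bundle[OF assms(1,2)]] by (simp add: tangent_space_iff)
  fix c assume c: "c \<in> charts_at (fst (Z t))"
  have "((\<lambda>s. cmap c (fst (Z s))) has_vector_derivative snd (Z t) c) (at t within I)"
    using has_vector_derivative_fst[OF integral_curve_deriv[OF assms(1,2) c]] by (simp add: coords_def spray_def)
  from vector_derivative_within[OF assms(3) this]
  show "velocity I (\<lambda>t. fst (Z t)) t c = snd (Z t) c" using c by (simp add: velocity_def o_def)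
qed

lemma integral_curve_geodesic:
  assumes Z: "integral_curve I Z" and I: "\<And>t. t \<in> I \<Longrightarrow> at t within I \<noteq> bot" and "t \<in> I"
  shows "cov_deriv I (\<lambda>t. fst (Z t)) (velocity I (\<lambda>t. fst (Z t))) t = zero_tvec (fst (Z t))"
  unfolding cov_deriv_def zero_tvec_def
proof (rule restrict_ext)
  fix c assume c: "c \<in> charts_at (fst (Z t))"
  have "((\<lambda>s. snd (Z s) c) has_vector_derivative
      - christoffel_form c (cmap c (fst (Z t))) (snd (Z t) c) (snd (Z t) c)) (at t within I)"
    using has_vector_derivative_snd[OF integral_curve_deriv[OF Z \<open>t \<in> I\<close> c]] by (simp add: coords_def spray_def)
  then have "((\<lambda>s. velocity I (\<lambda>t. fst (Z t)) s c) has_vector_derivative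
      - christoffel_form c (cmap c (fst (Z t))) (snd (Z t) c) (snd (Z t) c)) (at t within I)"
    by (rule has_vector_derivative_transform[OF \<open>t \<in> I\<close>, rotated]) (simp add: integral_curve_velocity[OF Z _ I])
  from vector_derivative_within[OF I[OF \<open>t \<in> I\<close>] this]
  show "vector_derivative (\<lambda>s. velocity I (\<lambda>t. fst (Z t)) s c) (at t within I) +
     (\<chi> k. \<Sum>i\<in>UNIV. \<Sum>j\<in>UNIV. christoffel c (cmap c (fst (Z t))) k i j *
        velocity I (\<lambda>t. fst (Z t)) t c $ i * velocity I (\<lambda>t. fst (Z t)) t c $ j) = 0"
    by (simp add: integral_curve_velocity[OF Z \<open>t \<in> I\<close> I[OF \<open>t \<in> I\<close>]] christoffel_form_def)
qed

text \<open>In a chart the derivative is that of the metric coefficients along \<open>w\<close>,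
  minus twice the product of the Christoffel form of \<open>w, w\<close> with \<open>w\<close>;
  \<open>koszul\<close> with all three arguments equal to \<open>w\<close> makes the two
  cancel.\<close>

lemma integral_curve_speed2:
  assumes Z: "integral_curve {a..b} Z" and "t \<in> {a..b}"
  shows "speed2 (Z t) = speed2 (Z a)"
proof -
  have deriv: "((\<lambda>s. speed2 (Z s)) has_vector_derivative 0) (at t within {a..b})" if t: "t \<in> {a..b}" for t
  proof -
    obtain c where c: "c \<in> charts_at (fst (Z t))" using integral_curve_charts[OF Z t] .
    then have cA: "c \<in> \<A>" and tc: "fst (Z t) \<in> cdom c" using charts_atD by auto
    define S where "S = {s \<in> {a..b}. fst (Z s) \<in> cdom c}"
    define x where "x s = fst (coords c (Z s))" for s
    define w where "w s = snd (coords c (Z s))" for s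
    have at: "at t within S = at t within {a..b}"
      unfolding S_def by (rule at_within_eventually[OF integral_curve_eventually[OF Z t c]])
    have tS: "t \<in> S" using t tc by (simp add: S_def)
    have xd: "x s \<in> cimg c" if "s \<in> S" for s using that by (auto simp: x_def coords_def S_def)
    have dx: "(x has_derivative (\<lambda>r. r *\<^sub>R w t)) (at t within S)"
      and dw: "(w has_derivative (\<lambda>r. r *\<^sub>R (- christoffel_form c (x t) (w t) (w t)))) (at t within S)"
      using has_vector_derivative_fst[OF integral_curve_deriv[OF Z t c]]
        has_vector_derivative_snd[OF integral_curve_deriv[OF Z t c]]
      unfolding at x_def w_def has_vector_derivative_def by (simp_all add: spray_def)
    have "((\<lambda>s. metric_in c (x s) (w s) (w s)) has_derivative
      (\<lambda>r. dmetric_in c (x t) (w t) (w t) (r *\<^sub>R w t)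
        + metric_in c (x t) (r *\<^sub>R (- christoffel_form c (x t) (w t) (w t))) (w t)
        + metric_in c (x t) (w t) (r *\<^sub>R (- christoffel_form c (x t) (w t) (w t))))) (at t within S)"
      by (rule has_derivative_metric_in[OF cA tS xd dx dw dw])
    moreover have "dmetric_in c (x t) (w t) (w t) (r *\<^sub>R w t)
        + metric_in c (x t) (r *\<^sub>R (- christoffel_form c (x t) (w t) (w t))) (w t)
        + metric_in c (x t) (w t) (r *\<^sub>R (- christoffel_form c (x t) (w t) (w t))) = 0" for r
    proof -
      note lin = linear_scale[OF dmetric_in_linear(1)[OF cA xd[OF tS]]]
        linear_scale[OF metric_in_linear1[OF cA xd[OF tS]]] linear_neg[OF metric_in_linear1[OF cA xd[OF tS]]]
        linear_scale[OF metric_in_linear2[OF cA xd[OF tS]]] linear_neg[OF metric_in_linear2[OF cA xd[OF tS]]]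
      have "metric_in c (x t) (w t) (christoffel_form c (x t) (w t) (w t)) =
          metric_in c (x t) (christoffel_form c (x t) (w t) (w t)) (w t)"
        by (rule metric_in_sym[OF cA xd[OF tS]])
      then show ?thesis using koszul[OF cA xd[OF tS], of "w t" "w t" "w t"]
        by (simp add: lin algebra_simps)
    qed
    ultimately have "((\<lambda>s. metric_in c (x s) (w s) (w s)) has_derivative (\<lambda>r. 0)) (at t within S)"
      by simp
    then have "((\<lambda>s. speed2 (Z s)) has_derivative (\<lambda>r. 0)) (at t within S)"
      by (rule has_derivative_transform[OF tS, rotated])
        (use integral_curve_tangent_bundle[OF Z] cA in \<open>auto simp: S_def x_def w_def charts_at_def speed2_coords\<close>)
    then show ?thesis by (simp add: at has_vector_derivative_def)
  qed
  obtain k where "\<And>s. s \<in> {a..b} \<Longrightarrow> speed2 (Z s) = k"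
    using has_vector_derivative_zero_constant[OF convex_closed_interval deriv] by metis
  then show ?thesis using \<open>t \<in> {a..b}\<close> by auto
qed

text \<open>The acceleration part of the spray is homogeneous of degree two in the velocity. This
  matches the factor \<open>1 / r^2\<close> of the rescaled velocity: one \<open>1 / r\<close> from
  the scaling, one from the time change.\<close>

lemma integral_curve_rescale:
  assumes Z: "integral_curve {0..l} Z" and "r > 0"
  shows "integral_curve {0..l * r} (\<lambda>t. (fst (Z (t / r)), scale_tvec (fst (Z (t / r))) (1 / r) (snd (Z (t / r)))))"
  unfolding integral_curve_def fst_conv
proof (intro ballI conjI)
  fix t assume t: "t \<in> {0..l * r}"
  define s where "s = t / r"
  have s: "s \<in> {0..l}" using t \<open>r > 0\<close> by (auto simp: s_def field_simps)
  define W where "W t = (fst (Z (t / r)), scale_tvec (fst (Z (t / r))) (1 / r) (snd (Z (t / r))))" for t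
  note TB = integral_curve_tangent_bundle[OF Z s]
  obtain c where c: "c \<in> charts_at (fst (Z s))" using integral_curve_charts[OF Z s] .
  show "(fst (Z (t / r)), scale_tvec (fst (Z (t / r))) (1 / r) (snd (Z (t / r)))) \<in> tangent_bundle"
    unfolding s_def[symmetric] using scale_tvec_tangent[OF c] tangent_bundleD[OF TB] tvec_of_tangent charts_atD[OF c]
    by (simp add: tangent_bundle_def)
  fix d assume d: "d \<in> charts_at (fst (Z (t / r)))"
  note ds = d[folded s_def]
  have im: "(\<lambda>t. t / r) ` {0..l * r} \<subseteq> {0..l}" using \<open>r > 0\<close> by (auto simp: field_simps)
  have lim: "filterlim (\<lambda>t. t / r) (at s within {0..l}) (at t within {0..l * r})"
    unfolding filterlim_at
  proof
    show "\<forall>\<^sub>F x in at t within {0..l * r}. x / r \<in> {0..l} \<and> x / r \<noteq> s"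
      unfolding eventually_at_filter using im \<open>r > 0\<close> by (intro always_eventually) (auto simp: s_def pos_divide_le_eq)
    show "((\<lambda>t. t / r) \<longlongrightarrow> s) (at t within {0..l * r})"
      unfolding s_def using \<open>r > 0\<close> by (intro tendsto_intros) auto
  qed
  have ev: "\<forall>\<^sub>F u in at t within {0..l * r}. fst (Z (u / r)) \<in> cdom d"
    using filterlim_iff[THEN iffD1, OF lim] integral_curve_eventually[OF Z s ds] by blast
  then show "\<forall>\<^sub>F u in at t within {0..l * r}. fst (Z (u / r)) \<in> cdom d" .
  define x where "x s = fst (coords d (Z s))" for s
  define w where "w s = snd (coords d (Z s))" for s
  have W: "coords d (W u) = (x (u / r), (1 / r) *\<^sub>R w (u / r))" if "fst (Z (u / r)) \<in> cdom d" for u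
    using that d by (simp add: W_def coords_def x_def w_def scale_tvec_def charts_at_def)
  have Wt: "coords d (W t) = (x s, (1 / r) *\<^sub>R w s)"
    unfolding s_def by (rule W) (use charts_atD[OF d] in simp)
  have lin: "((\<lambda>t. t / r) has_vector_derivative 1 / r) (at t within {0..l * r})"
    by (rule has_vector_derivative_eq_rhs)
      (auto intro!: derivative_eq_intros simp: has_vector_derivative_def divide_inverse bounded_linear_mult_left
        intro: bounded_linear_imp_has_derivative)
  have "((\<lambda>u. coords d (Z (u / r))) has_vector_derivative (1 / r) *\<^sub>R spray d (coords d (Z s))) (at t within {0..l * r})"
    using vector_diff_chain_within[OF lin, of "\<lambda>u. coords d (Z u)" "spray d (coords d (Z s))"]
      has_vector_derivative_within_subset[OF integral_curve_deriv[OF Z s ds] im] by (simp add: o_def s_def)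
  then have "((\<lambda>u. (x (u / r), (1 / r) *\<^sub>R w (u / r))) has_vector_derivative
     ((1 / r) *\<^sub>R w s, (1 / r) *\<^sub>R ((1 / r) *\<^sub>R (- christoffel_form d (x s) (w s) (w s))))) (at t within {0..l * r})"
    unfolding x_def w_def
    by (intro has_vector_derivative_Pair bounded_linear.has_vector_derivative[OF bounded_linear_scaleR_right])
      (auto dest: has_vector_derivative_fst has_vector_derivative_snd simp: spray_def)
  moreover have "christoffel_form d (x s) ((1 / r) *\<^sub>R w s) ((1 / r) *\<^sub>R w s) =
      (1 / r) *\<^sub>R (1 / r) *\<^sub>R christoffel_form d (x s) (w s) (w s)"
    by (simp only: linear_scale[OF christoffel_form_linear1] linear_scale[OF christoffel_form_linear2])
  ultimately have "((\<lambda>u. (x (u / r), (1 / r) *\<^sub>R w (u / r))) has_vector_derivative spray d (coords d (W t))) (at t within {0..l * r})"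
    by (simp add: Wt spray_def)
  moreover have "\<forall>\<^sub>F u in at t within {0..l * r}. (x (u / r), (1 / r) *\<^sub>R w (u / r)) = coords d (W u)"
    using ev by eventually_elim (simp add: W)
  ultimately have "((\<lambda>u. coords d (W u)) has_vector_derivative spray d (coords d (W t))) (at t within {0..l * r})"
    by (rule has_vector_derivative_transform_eventually) (use t in \<open>simp_all add: Wt s_def\<close>)
  then show "((\<lambda>u. coords d (fst (Z (u / r)), scale_tvec (fst (Z (u / r))) (1 / r) (snd (Z (u / r)))))
     has_vector_derivative spray d (coords d (fst (Z (t / r)), scale_tvec (fst (Z (t / r))) (1 / r) (snd (Z (t / r))))))
     (at t within {0..l * r})"
    unfolding W_def .
qed

lemma at_within_Icc_nontrivial:
  fixes a b t :: real
  assumes "a < b" "t \<in> {a..b}"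
  shows "at t within {a..b} \<noteq> bot"
  unfolding trivial_limit_within islimpt_Icc[OF assms(1)] using assms(2) by simp

lemma at_within_Ioo_nontrivial:
  fixes a b t :: real
  assumes "t \<in> {a<..<b}"
  shows "at t within {a<..<b} \<noteq> bot"
  unfolding at_within_open[OF assms open_greaterThanLessThan] by (rule at_neq_bot)

text \<open>Conservation of speed spreads unit speed from time 0 to the whole interval, which gives
  the length; a constant curve would have zero velocity and is thereby excluded.\<close>

lemma integral_curve_loop:
  assumes Z: "integral_curve {0..l} Z" and "l > 0" and unit: "speed2 (Z 0) = 1" and loop: "fst (Z 0) = fst (Z l)"
  shows "geodesic_loop (\<lambda>t. fst (Z t)) l" "curve_length (\<lambda>t. fst (Z t)) l = l"
    "velocity {0..l} (\<lambda>t. fst (Z t)) 0 = snd (Z 0)"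
proof -
  have vel: "velocity {0..l} (\<lambda>t. fst (Z t)) t = snd (Z t)" if "t \<in> {0..l}" for t
    by (rule integral_curve_velocity[OF Z that at_within_Icc_nontrivial[OF \<open>l > 0\<close> that]])
  then show "velocity {0..l} (\<lambda>t. fst (Z t)) 0 = snd (Z 0)" using \<open>l > 0\<close> by simp
  have unit': "g (fst (Z t)) (snd (Z t)) (snd (Z t)) = 1" if "t \<in> {0..l}" for t
    using integral_curve_speed2[OF Z that] unit by (simp add: speed2_def)
  have "curve_length (\<lambda>t. fst (Z t)) l = integral {0..l} (\<lambda>t. 1)"
    unfolding curve_length_def by (rule integral_cong) (simp add: vel unit')
  then show "curve_length (\<lambda>t. fst (Z t)) l = l" using \<open>l > 0\<close> by simp
  have Zo: "integral_curve {0<..<l} Z" by (rule integral_curve_subset[OF Z]) auto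
  have "unit_speed_geodesic {0<..<l} (\<lambda>t. fst (Z t))"
    unfolding unit_speed_geodesic_def
    using integral_curve_smooth[OF Zo] integral_curve_geodesic[OF Zo at_within_Ioo_nontrivial]
      integral_curve_velocity[OF Zo _ at_within_Ioo_nontrivial] unit' by simp
  moreover have "\<not> (\<lambda>t. fst (Z t)) constant_on {0..l}"
  proof
    assume "(\<lambda>t. fst (Z t)) constant_on {0..l}"
    then obtain p where p: "\<And>t. t \<in> {0..l} \<Longrightarrow> fst (Z t) = p" unfolding constant_on_def by blast
    have 0: "0 \<in> {0..l}" using \<open>l > 0\<close> by simp
    obtain c where c: "c \<in> charts_at (fst (Z 0))" using integral_curve_charts[OF Z 0] .
    have "((\<lambda>s. cmap c (fst (Z s))) has_vector_derivative snd (Z 0) c) (at 0 within {0..l})"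
      using has_vector_derivative_fst[OF integral_curve_deriv[OF Z 0 c]] by (simp add: coords_def spray_def)
    moreover have "((\<lambda>s. cmap c (fst (Z s))) has_vector_derivative 0) (at 0 within {0..l})"
      by (rule has_vector_derivative_transform[OF 0 _ has_vector_derivative_const[of "cmap c p"]]) (simp add: p)
    ultimately have "snd (Z 0) c = 0"
      using vector_derivative_unique_within[OF at_within_Icc_nontrivial[OF \<open>l > 0\<close> 0]] by blast
    then have "speed2 (Z 0) = 0"
      using speed2_coords[OF integral_curve_tangent_bundle[OF Z 0] c] charts_atD[OF c]
        linear_0[OF metric_in_linear1[of c "cmap c (fst (Z 0))"]] by (simp add: coords_def)
    then show False using unit by simp
  qed
  ultimately show "geodesic_loop (\<lambda>t. fst (Z t)) l"
    unfolding geodesic_loop_def using \<open>l > 0\<close> integral_curve_smooth[OF Z] loop by simp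
qed

end

lemma Ck_Suc_vector_derivative:
  fixes f :: "real \<Rightarrow> 'v::real_normed_vector"
  assumes "Ck (Suc k) S f"
  obtains f' where "\<And>t. t \<in> S \<Longrightarrow> (f has_vector_derivative f' t) (at t within S)" "Ck k S f'"
proof -
  obtain F where F: "\<forall>t\<in>S. (f has_derivative F t) (at t within S)" "\<forall>v. Ck k S (\<lambda>t. F t v)"
    using assms unfolding Ck.simps by blast
  have "(f has_vector_derivative F t 1) (at t within S)" if "t \<in> S" for t
  proof -
    have lin: "linear (F t)" using F(1) that has_derivative_linear by blast
    have "F t = (\<lambda>r. r *\<^sub>R F t 1)"
    proof
      show "F t r = r *\<^sub>R F t 1" for r using linear_scale[OF lin, of r 1] by simp
    qed
    moreover have "(f has_derivative F t) (at t within S)" using F(1) that by blast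
    ultimately show ?thesis unfolding has_vector_derivative_def by simp
  qed
  then show ?thesis by (rule that[of "\<lambda>t. F t 1"]) (use F(2) in auto)
qed

section \<open>From geodesic loops to integral curves\<close>

context riemannian_manifold
begin

text \<open>The definition of a loop gives smoothness up to the endpoints, but the geodesic equation
  and unit speed in the interior only. The equation extends by continuity of the one-sided
  derivatives, unit speed by conservation.\<close>

lemma geodesic_loop_integral_curve:
  assumes loop: "geodesic_loop \<gamma> l"
  shows "integral_curve {0..l} (\<lambda>t. (\<gamma> t, velocity {0..l} \<gamma> t))"
    and "t \<in> {0..l} \<Longrightarrow> speed2 (\<gamma> t, velocity {0..l} \<gamma> t) = 1"
proof -
  let ?I = "{0..l}" and ?O = "{0<..<l}"
  have "l > 0" and smooth: "smooth_curve ?I \<gamma>" and geo: "unit_speed_geodesic ?O \<gamma>"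
    using loop by (auto simp: geodesic_loop_def)
  have cont: "continuous_map (top_of_set ?I) X \<gamma>" using smooth by (simp add: smooth_curve_def)
  define S where "S c = {t \<in> ?I. \<gamma> t \<in> cdom c}" for c :: "('a, 'n) chart"
  \<comment> \<open>Collects for one chart the first and second derivatives of the coordinate curve,
    one-sided at the endpoints; as a single predicate it allows a simultaneous choice over all
    charts.\<close>
  define Q where "Q c B x' x'' \<longleftrightarrow> open B \<and> S c = ?I \<inter> B \<and>
      (\<forall>t\<in>S c. ((cmap c \<circ> \<gamma>) has_vector_derivative x' t) (at t within ?I) \<and>
         (x' has_vector_derivative x'' t) (at t within ?I)) \<and> continuous_on (S c) x' \<and> continuous_on (S c) x''" for c B x' x''
  have "\<exists>B x' x''. Q c B x' x''"
    if c: "c \<in> \<A>" for c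
  proof -
    have "openin (top_of_set ?I) (S c)"
      using openin_continuous_map_preimage[OF cont chart_open[OF c]] by (simp add: S_def)
    then obtain B where B: "open B" "S c = ?I \<inter> B" unfolding openin_open by blast
    have at: "at t within S c = at t within ?I" if "t \<in> S c" for t
      unfolding B(2) by (rule at_within_Int_open) (use that B in auto)
    have "Ck (Suc (Suc 0)) (S c) (cmap c \<circ> \<gamma>)"
      using smooth c unfolding smooth_curve_def smooth_on_def S_def by blast
    then obtain x' where x': "\<And>t. t \<in> S c \<Longrightarrow> ((cmap c \<circ> \<gamma>) has_vector_derivative x' t) (at t within S c)"
      "Ck (Suc 0) (S c) x'"
      using Ck_Suc_vector_derivative by blast
    obtain x'' where x'': "\<And>t. t \<in> S c \<Longrightarrow> (x' has_vector_derivative x'' t) (at t within S c)" "Ck 0 (S c) x''"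
      using Ck_Suc_vector_derivative[OF x'(2)] by blast
    show ?thesis
      using B x' x'' at Ck_imp_continuous_on[OF x'(2)] Ck_imp_continuous_on[OF x''(2)]
      unfolding Q_def by (intro exI[of _ B] exI[of _ x'] exI[of _ x'']) simp
  qed
  then have "\<forall>c. \<exists>B x' x''. c \<in> \<A> \<longrightarrow> Q c B x' x''" by blast
  then obtain B x' x'' where "\<forall>c. c \<in> \<A> \<longrightarrow> Q c (B c) (x' c) (x'' c)"
    unfolding choice_iff by blast
  then have B: "\<And>c. c \<in> \<A> \<Longrightarrow> open (B c)" "\<And>c. c \<in> \<A> \<Longrightarrow> S c = ?I \<inter> B c"
    and x': "\<And>c t. c \<in> \<A> \<Longrightarrow> t \<in> S c \<Longrightarrow> ((cmap c \<circ> \<gamma>) has_vector_derivative x' c t) (at t within ?I)"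
    and x'': "\<And>c t. c \<in> \<A> \<Longrightarrow> t \<in> S c \<Longrightarrow> (x' c has_vector_derivative x'' c t) (at t within ?I)"
    and contx: "\<And>c. c \<in> \<A> \<Longrightarrow> continuous_on (S c) (x' c)" "\<And>c. c \<in> \<A> \<Longrightarrow> continuous_on (S c) (x'' c)"
    unfolding Q_def by blast+
  have SI: "t \<in> S c \<Longrightarrow> t \<in> ?I" and Sc: "t \<in> S c \<Longrightarrow> \<gamma> t \<in> cdom c" for t c by (auto simp: S_def)
  have vel: "velocity ?I \<gamma> t c = x' c t" if "c \<in> \<A>" "t \<in> S c" for c t
    using vector_derivative_within[OF at_within_Icc_nontrivial[OF \<open>l > 0\<close> SI[OF that(2)]] x'[OF that]] that
    by (simp add: velocity_def charts_at_def Sc)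
  have interior_at: "at t within ?I = at t" if "t \<in> ?O" for t
    using that by (simp add: at_within_Icc_at)
  have velO: "velocity ?O \<gamma> t = velocity ?I \<gamma> t" if "t \<in> ?O" for t
    unfolding velocity_def interior_at[OF that] at_within_open[OF that open_greaterThanLessThan] ..
  have eqn: "x'' c t = - christoffel_form c (cmap c (\<gamma> t)) (x' c t) (x' c t)" if c: "c \<in> \<A>" and t: "t \<in> S c" for c t
  proof -
    \<comment> \<open>Residual of the geodesic equation in the chart \<open>c\<close>: continuous on
      all of \<open>S c\<close> and zero at the interior parameters.\<close>
    define f where "f s = x'' c s - snd (spray c (cmap c (\<gamma> s), x' c s))" for s
    have "continuous_on (S c) (cmap c \<circ> \<gamma>)"
      by (rule continuous_on_vector_derivative) (rule has_vector_derivative_within_subset[OF x'[OF c]], use SI[of _ c] in auto)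
    then have "continuous_on (S c) (\<lambda>s. (cmap c (\<gamma> s), x' c s))"
      by (intro continuous_on_Pair contx c) (simp add: o_def)
    then have "continuous_on (S c) (\<lambda>s. spray c (cmap c (\<gamma> s), x' c s))"
      by (rule continuous_on_compose2[OF Ck_imp_continuous_on[OF Ck_spray[OF c]]]) (auto simp: bundle_dom_def Sc)
    then have fcont: "continuous_on (S c) f"
      unfolding f_def by (intro continuous_intros contx c)
    have f0: "f s = 0" if s: "s \<in> B c \<inter> ?O" for s
    proof -
      have sS: "r \<in> S c" if "r \<in> B c \<inter> ?O" for r using that B(2)[OF c] by auto
      have opn: "open (B c \<inter> ?O)" using B(1)[OF c] by auto
      have v: "velocity ?O \<gamma> r c = x' c r" if "r \<in> B c \<inter> ?O" for r
        using velO[of r] vel[OF c sS[OF that]] that by simp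
      have cs: "c \<in> charts_at (\<gamma> s)" using c Sc[OF sS[OF s]] by (simp add: charts_at_def)
      have at: "at s within ?O = at s" using s at_within_open[OF _ open_greaterThanLessThan] by blast
      have "(x' c has_vector_derivative x'' c s) (at s)"
        using x''[OF c sS[OF s]] interior_at[of s] s by simp
      then have "((\<lambda>r. velocity ?O \<gamma> r c) has_vector_derivative x'' c s) (at s)"
        by (rule has_vector_derivative_transform_within_open[OF _ opn s]) (simp add: v)
      then have "vector_derivative (\<lambda>r. velocity ?O \<gamma> r c) (at s within ?O) = x'' c s"
        unfolding at by (rule vector_derivative_at)
      moreover have "cov_deriv ?O \<gamma> (velocity ?O \<gamma>) s c = zero_tvec (\<gamma> s) c"
        using geo s unfolding unit_speed_geodesic_def by simp
      ultimately have "x'' c s + christoffel_form c (cmap c (\<gamma> s)) (x' c s) (x' c s) = 0"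
        using cs by (simp add: cov_deriv_def zero_tvec_def v[OF s] christoffel_form_def)
      then show ?thesis by (simp add: f_def spray_def)
    qed
    \<comment> \<open>Even for \<open>t = 0\<close> or \<open>t = l\<close> the interior parameters
      accumulate at \<open>t\<close>, so the limit of the residual along them determines
      \<open>f t\<close>.\<close>
    have "at t within (?O \<inter> B c) = at t within ?O"
      by (rule at_within_Int_open) (use t B c in auto)
    moreover have "at t within ?O \<noteq> bot"
      using \<open>l > 0\<close> SI[OF t] limpt_of_closure[of t ?O] by (simp add: trivial_limit_within)
    ultimately have nb: "at t within (?O \<inter> B c) \<noteq> bot" by simp
    have sub: "?O \<inter> B c \<subseteq> S c" using B(2)[OF c] by auto
    have "(f \<longlongrightarrow> f t) (at t within (?O \<inter> B c))"
      using fcont t sub unfolding continuous_on by (meson tendsto_within_subset)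
    moreover have "(f \<longlongrightarrow> 0) (at t within (?O \<inter> B c))"
      by (rule tendsto_eventually) (use f0 in \<open>auto simp: eventually_at_filter\<close>)
    ultimately have "f t = 0" using tendsto_unique[OF nb] by blast
    then show ?thesis by (simp add: f_def spray_def eq_neg_iff_add_eq_0)
  qed
  have TB: "(\<gamma> t, velocity ?I \<gamma> t) \<in> tangent_bundle" if t: "t \<in> ?I" for t
    unfolding tangent_bundle_def
  proof (intro SigmaI)
    show "\<gamma> t \<in> topspace X" using cont t by (auto simp: continuous_map_def)
    show "velocity ?I \<gamma> t \<in> tangent_space (\<gamma> t)"
      unfolding tangent_space_iff
    proof (intro conjI ballI)
      show "velocity ?I \<gamma> t \<in> extensional (charts_at (\<gamma> t))" by (simp add: velocity_def)
      fix c d assume "c \<in> charts_at (\<gamma> t)" "d \<in> charts_at (\<gamma> t)"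
      then have c: "c \<in> \<A>" "t \<in> S c" and d: "d \<in> \<A>" "t \<in> S d" using t by (auto simp: charts_at_def S_def)
      have "((\<lambda>s. transition c d (cmap c (\<gamma> s))) has_vector_derivative dtrans c d (cmap c (\<gamma> t)) (x' c t)) (at t within ?I)"
        using vector_derivative_diff_chain_within[OF x'[OF c], of "transition c d" "dtrans c d (cmap c (\<gamma> t))"]
          transition_has_derivative[OF c(1) d(1) cmap_in_overlap[OF Sc[OF c(2)] Sc[OF d(2)]]]
        by (simp add: o_def has_derivative_at_withinI)
      then have "((cmap d \<circ> \<gamma>) has_vector_derivative dtrans c d (cmap c (\<gamma> t)) (x' c t)) (at t within ?I)"
      proof (rule has_vector_derivative_transform_eventually)
        have "\<forall>\<^sub>F s in at t within ?I. s \<in> B c \<and> s \<in> ?I"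
          unfolding eventually_at_topological using B(1)[OF c(1)] B(2)[OF c(1)] c(2) by blast
        then show "\<forall>\<^sub>F s in at t within ?I. transition c d (cmap c (\<gamma> s)) = (cmap d \<circ> \<gamma>) s"
        proof eventually_elim
          case (elim s)
          then have "s \<in> S c" using B(2)[OF c(1)] by auto
          then show ?case using transition_cmap[OF c(1) Sc] by simp
        qed
      qed (use transition_cmap[OF c(1) Sc[OF c(2)]] t in auto)
      from vector_derivative_unique_within[OF at_within_Icc_nontrivial[OF \<open>l > 0\<close> t] x'[OF d] this]
      show "velocity ?I \<gamma> t d = dtrans c d (cmap c (\<gamma> t)) (velocity ?I \<gamma> t c)"
        by (simp add: vel[OF c] vel[OF d])
    qed
  qed
  show Z: "integral_curve ?I (\<lambda>t. (\<gamma> t, velocity ?I \<gamma> t))"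
    unfolding integral_curve_def fst_conv
  proof (intro ballI conjI TB)
    fix t c assume t: "t \<in> ?I" and "c \<in> charts_at (\<gamma> t)"
    then have c: "c \<in> \<A>" "t \<in> S c" by (auto simp: charts_at_def S_def)
    have "\<forall>\<^sub>F s in at t within ?I. s \<in> B c \<and> s \<in> ?I"
      unfolding eventually_at_topological using B(1)[OF c(1)] B(2)[OF c(1)] c(2) by blast
    then have ev: "\<forall>\<^sub>F s in at t within ?I. s \<in> S c"
      by eventually_elim (use B(2)[OF c(1)] in auto)
    then show "\<forall>\<^sub>F s in at t within ?I. \<gamma> s \<in> cdom c" by eventually_elim (rule Sc)
    have "((\<lambda>s. (cmap c (\<gamma> s), x' c s)) has_vector_derivative spray c (cmap c (\<gamma> t), x' c t)) (at t within ?I)"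
      unfolding spray_def using has_vector_derivative_Pair[OF x'[OF c] x''[OF c]] eqn[OF c] by (simp add: o_def)
    moreover have "\<forall>\<^sub>F s in at t within ?I. (cmap c (\<gamma> s), x' c s) = coords c (\<gamma> s, velocity ?I \<gamma> s)"
      using ev by eventually_elim (simp add: coords_def vel[OF c(1)])
    ultimately have "((\<lambda>s. coords c (\<gamma> s, velocity ?I \<gamma> s)) has_vector_derivative spray c (cmap c (\<gamma> t), x' c t)) (at t within ?I)"
      by (rule has_vector_derivative_transform_eventually) (use vel[OF c] t in \<open>simp_all add: coords_def\<close>)
    then show "((\<lambda>s. coords c (\<gamma> s, velocity ?I \<gamma> s)) has_vector_derivative spray c (coords c (\<gamma> t, velocity ?I \<gamma> t))) (at t within ?I)"
      using vel[OF c] by (simp add: coords_def)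
  qed
  show "speed2 (\<gamma> t, velocity ?I \<gamma> t) = 1" if "t \<in> ?I"
  proof -
    \<comment> \<open>Any interior parameter would do: unit speed is known there, and conservation
      carries it to the endpoints.\<close>
    have half: "l / 2 \<in> ?O" "l / 2 \<in> ?I" using \<open>l > 0\<close> by auto
    have "g (\<gamma> (l / 2)) (velocity ?O \<gamma> (l / 2)) (velocity ?O \<gamma> (l / 2)) = 1"
      using geo half(1) unfolding unit_speed_geodesic_def by blast
    then have "speed2 (\<gamma> (l / 2), velocity ?I \<gamma> (l / 2)) = 1"
      by (simp add: speed2_def velO[OF half(1)])
    then show ?thesis
      using integral_curve_speed2[OF Z that] integral_curve_speed2[OF Z half(2)] by simp
  qed
qed

section \<open>Jacobi fields as variation fields\<close>

lemma dchristoffel_form_linear: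
  assumes "c \<in> \<A>" "x \<in> cimg c"
  shows "linear (dchristoffel_form c x a b)"
    and "linear (\<lambda>a. dchristoffel_form c x a b e)" "linear (\<lambda>b. dchristoffel_form c x a b e)"
proof -
  show "linear (dchristoffel_form c x a b)"
    using christoffel_form_has_derivative[OF assms] has_derivative_linear by blast
  show "linear (\<lambda>a. dchristoffel_form c x a b e)"
    by (rule linear_family_derivative_linear[OF chart_image_open[OF assms(1)] assms(2),
        where L="\<lambda>y a. christoffel_form c y a b"])
      (use assms in \<open>auto intro: christoffel_form_linear1 christoffel_form_has_derivative\<close>)
  show "linear (\<lambda>b. dchristoffel_form c x a b e)"
    by (rule linear_family_derivative_linear[OF chart_image_open[OF assms(1)] assms(2),
        where L="\<lambda>y. christoffel_form c y a"])
      (use assms in \<open>auto intro: christoffel_form_linear2 christoffel_form_has_derivative\<close>)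
qed

lemma dchristoffel_form_axis:
  assumes "c \<in> \<A>" "x \<in> cimg c"
  shows "dchristoffel_form c x (axis j 1) (axis k 1) (axis i 1) $ m = pderiv_at i (\<lambda>y. christoffel c y m j k) x"
proof -
  have "((\<lambda>y. christoffel_form c y (axis j 1) (axis k 1) $ m) has_derivative
      (\<lambda>e. dchristoffel_form c x (axis j 1) (axis k 1) e $ m)) (at x)"
    by (rule bounded_linear.has_derivative[OF bounded_linear_vec_nth christoffel_form_has_derivative[OF assms]])
  from frechet_derivative_at[OF this] show ?thesis
    unfolding christoffel_form_axis pderiv_at_def by metis
qed

lemma christoffel_form_axis_expand:
  "christoffel_form c x (axis i 1) v $ m = (\<Sum>r\<in>UNIV. christoffel c x m i r * v $ r)"
proof -
  have "(\<Sum>j\<in>UNIV. christoffel c x m i' j * axis i 1 $ i' * v $ j) =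
      (if i' = i then \<Sum>r\<in>UNIV. christoffel c x m i r * v $ r else 0)" for i'
    by (simp add: axis_def)
  then show ?thesis by (simp add: christoffel_form_def sum.delta)
qed

text \<open>Both sides are trilinear and agree on axis vectors by the definition of
  \<open>riemann_coeff\<close>. The right side is the curvature with the index sums absorbed into
  Christoffel forms, ready for comparison with iterated covariant derivatives.\<close>

lemma riemann_coeff_form:
  assumes "c \<in> \<A>" "x \<in> cimg c"
  shows "(\<chi> m. \<Sum>i\<in>UNIV. \<Sum>j\<in>UNIV. \<Sum>k\<in>UNIV. riemann_coeff c x m i j k * a $ i * b $ j * v $ k) =
    dchristoffel_form c x b v a - dchristoffel_form c x a v b
    + christoffel_form c x a (christoffel_form c x b v) - christoffel_form c x b (christoffel_form c x a v)"
proof -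
  define R where "R a b v = (\<chi> m. \<Sum>i\<in>UNIV. \<Sum>j\<in>UNIV. \<Sum>k\<in>UNIV. riemann_coeff c x m i j k * a $ i * b $ j * v $ k)" for a b v
  define T where "T a b v = dchristoffel_form c x b v a - dchristoffel_form c x a v b
    + christoffel_form c x a (christoffel_form c x b v) - christoffel_form c x b (christoffel_form c x a v)" for a b v
  have R: "linear (\<lambda>a. R a b v)" "linear (\<lambda>b. R a b v)" "linear (R a b)" for a b v
    by (rule linearI; simp add: R_def vec_eq_iff algebra_simps sum.distrib sum_distrib_left)+
  note lin = linear_compose_add linear_compose_sub dchristoffel_form_linear[OF assms]
    christoffel_form_linear1 christoffel_form_linear2
    linear_compose[OF _ christoffel_form_linear2, unfolded o_def]
  have T: "linear (\<lambda>a. T a b v)" "linear (\<lambda>b. T a b v)" "linear (T a b)" for a b v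
    unfolding T_def by (intro lin)+
  have axis: "R (axis i 1) (axis j 1) (axis k 1) = T (axis i 1) (axis j 1) (axis k 1)" for i j k
  proof (rule vec_eq_iff[THEN iffD2], rule allI)
    fix m
    have *: "(\<Sum>k'\<in>UNIV. riemann_coeff c x m i' j' k' * axis i 1 $ i' * axis j 1 $ j' * axis k 1 $ k') =
        (if i' = i then if j' = j then riemann_coeff c x m i j k else 0 else 0)" for i' j'
      by (auto simp: axis_def if_distrib[of "(*) _"] sum.delta cong: if_cong)
    have "(\<Sum>j'\<in>UNIV. \<Sum>k'\<in>UNIV. riemann_coeff c x m i' j' k' * axis i 1 $ i' * axis j 1 $ j' * axis k 1 $ k') =
        (if i' = i then riemann_coeff c x m i j k else 0)" for i'
      unfolding * by (cases "i' = i") (simp_all add: sum.delta)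
    then have "R (axis i 1) (axis j 1) (axis k 1) $ m = riemann_coeff c x m i j k"
      by (simp add: R_def sum.delta)
    also have "\<dots> = T (axis i 1) (axis j 1) (axis k 1) $ m"
    proof -
      have "(\<Sum>s\<in>UNIV. christoffel c x r q s * axis k 1 $ s) = christoffel c x r q k" for r q
        using christoffel_form_axis_expand[of c x q "axis k 1" r] by (simp only: christoffel_form_axis)
      then show ?thesis
        by (simp add: T_def riemann_coeff_def dchristoffel_form_axis[OF assms] christoffel_form_axis_expand
          sum_subtractf)
    qed
    finally show "R (axis i 1) (axis j 1) (axis k 1) $ m = T (axis i 1) (axis j 1) (axis k 1) $ m" .
  qed
  have 1: "R (axis i 1) (axis j 1) v = T (axis i 1) (axis j 1) v" for i j
    by (rule linear_eq_axis[OF R(3) T(3) axis])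
  have 2: "R (axis i 1) b v = T (axis i 1) b v" for i
    by (rule linear_eq_axis[OF R(2) T(2) 1])
  have "R a b v = T a b v" by (rule linear_eq_axis[OF R(1) T(1) 2])
  then show ?thesis by (simp add: R_def T_def)
qed

text \<open>Only the position half of \<open>A\<close> is kept: by the block form of the derivative
  of \<open>btrans\<close> it transforms as a tangent vector, which the velocity half does
  not.\<close>

definition variation_field ::
  "(('a, 'n) chart \<Rightarrow> real \<Rightarrow> (real^'n) \<times> (real^'n) \<Rightarrow> (real^'n) \<times> (real^'n)) \<Rightarrow> (real \<Rightarrow> 'a \<times> ('a, 'n) tvec) \<Rightarrow>
    (real^'n) \<times> (real^'n) \<Rightarrow> real \<Rightarrow> ('a, 'n) tvec" where
  "variation_field A Z \<zeta> t = (\<lambda>d\<in>charts_at (fst (Z t)). fst (A d t \<zeta>))"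

lemma flow_aroundD:
  assumes "flow_around Z a b c \<delta> \<Phi> A" "t \<in> {a..b}" "d \<in> charts_at (fst (Z t))"
  shows flow_around_deriv: "((\<lambda>z. coords d (\<Phi> z t)) has_derivative A d t) (at (coords c (Z a)))"
    and flow_around_linearized: "((\<lambda>s. A d s \<zeta>) has_vector_derivative dspray d (coords d (Z t)) (A d t \<zeta>)) (at t within {a..b})"
    and flow_around_center: "\<Phi> (coords c (Z a)) t = Z t"
    and flow_around_near: "\<exists>\<epsilon>>0. \<epsilon> \<le> \<delta> \<and> (\<forall>z\<in>ball (coords c (Z a)) \<epsilon>. fst (\<Phi> z t) \<in> cdom d) \<and>
         continuous_on (ball (coords c (Z a)) \<epsilon>) (\<lambda>z. coords d (\<Phi> z t))"
  using assms unfolding flow_around_def by (simp, blast, simp, simp)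

lemma flow_around_integral_curve:
  assumes "flow_around Z a b c \<delta> \<Phi> A" "z \<in> ball (coords c (Z a)) \<delta>"
  shows "integral_curve {a..b} (\<Phi> z)" "\<Phi> z a = point_of c z" "z \<in> bundle_dom c"
  using assms unfolding flow_around_def by blast+

text \<open>\<open>flow_around\<close> imposes no compatibility between the components of
  \<open>A\<close> in different charts; it follows from uniqueness of the derivative of one and the
  same flow map.\<close>

lemma flow_around_transform:
  assumes F: "flow_around Z a b c \<delta> \<Phi> A" and t: "t \<in> {a..b}" and d: "d \<in> charts_at (fst (Z t))" and e: "e \<in> charts_at (fst (Z t))"
  shows "A e t \<zeta> = frechet_derivative (btrans d e) (at (coords d (Z t))) (A d t \<zeta>)"
proof -
  define p where "p = coords c (Z a)"
  have dA: "d \<in> \<A>" "e \<in> \<A>" using d e charts_atD by auto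
  obtain \<epsilon>1 where \<epsilon>1: "\<epsilon>1 > 0" "\<epsilon>1 \<le> \<delta>" "\<And>z. z \<in> ball p \<epsilon>1 \<Longrightarrow> fst (\<Phi> z t) \<in> cdom d"
    using flow_around_near[OF F t d] unfolding p_def by blast
  obtain \<epsilon>2 where \<epsilon>2: "\<epsilon>2 > 0" "\<epsilon>2 \<le> \<delta>" "\<And>z. z \<in> ball p \<epsilon>2 \<Longrightarrow> fst (\<Phi> z t) \<in> cdom e"
    using flow_around_near[OF F t e] unfolding p_def by blast
  have ov: "coords d (Z t) \<in> bundle_overlap d e"
    using d e by (intro coords_in_bundle_overlap) (auto dest: charts_atD)
  have "(btrans d e has_derivative frechet_derivative (btrans d e) (at (coords d (Z t)))) (at (coords d (\<Phi> p t)))"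
    using Ck_Suc_has_derivative[OF Ck_btrans[OF dA] open_bundle_overlap[OF dA] ov] flow_around_center[OF F t d]
    by (simp add: p_def)
  from has_derivative_compose[OF flow_around_deriv[OF F t d, folded p_def] this]
  have "((\<lambda>z. coords e (\<Phi> z t)) has_derivative
      (\<lambda>\<zeta>. frechet_derivative (btrans d e) (at (coords d (Z t))) (A d t \<zeta>))) (at p)"
  proof (rule has_derivative_transform_within_open[OF _ open_ball[of p "min \<epsilon>1 \<epsilon>2"]])
    show "p \<in> ball p (min \<epsilon>1 \<epsilon>2)" using \<epsilon>1(1) \<epsilon>2(1) by simp
    fix z assume z: "z \<in> ball p (min \<epsilon>1 \<epsilon>2)"
    then have "\<Phi> z t \<in> tangent_bundle"
      using flow_around_integral_curve(1)[OF F, of z] integral_curve_tangent_bundle t \<epsilon>1(2) by (auto simp: p_def)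
    then show "btrans d e (coords d (\<Phi> z t)) = coords e (\<Phi> z t)"
      using z \<epsilon>1(3) \<epsilon>2(3) dA by (intro coords_btrans[symmetric]) (auto simp: charts_at_def)
  qed
  from has_derivative_unique[OF flow_around_deriv[OF F t e, folded p_def] this] show ?thesis by metis
qed

lemma variation_field_tangent:
  assumes F: "flow_around Z a b c \<delta> \<Phi> A" and t: "t \<in> {a..b}"
  shows "variation_field A Z \<zeta> t \<in> tangent_space (fst (Z t))"
  unfolding tangent_space_iff
proof (intro conjI ballI)
  show "variation_field A Z \<zeta> t \<in> extensional (charts_at (fst (Z t)))" by (simp add: variation_field_def)
  fix d e assume d: "d \<in> charts_at (fst (Z t))" and e: "e \<in> charts_at (fst (Z t))"
  have dA: "d \<in> \<A>" "e \<in> \<A>" using d e charts_atD by auto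
  have ov: "coords d (Z t) \<in> bundle_overlap d e"
    using d e by (intro coords_in_bundle_overlap) (auto dest: charts_atD)
  show "variation_field A Z \<zeta> t e = dtrans d e (cmap d (fst (Z t))) (variation_field A Z \<zeta> t d)"
    using d e flow_around_transform[OF F t d e, of \<zeta>] frechet_derivative_btrans[OF dA ov]
    by (simp add: variation_field_def) (simp add: coords_def)
qed

text \<open>In coordinates the linearised spray reads \<open>J' = K\<close> together with an
  equation for \<open>K'\<close>. Rewriting both through covariant derivatives turns the derivatives
  of the Christoffel form into the curvature term.\<close>

lemma variation_field_jacobi:
  assumes F: "flow_around Z a b c \<delta> \<Phi> A" and "a < b" and Z: "integral_curve {a..b} Z"
  shows "jacobi_field {a..b} (\<lambda>t. fst (Z t)) (variation_field A Z \<zeta>)"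
  unfolding jacobi_field_def smooth_field_along_def smooth_on_def
proof (intro conjI ballI allI)
  let ?I = "{a..b}" and ?J = "variation_field A Z \<zeta>" and ?\<gamma> = "\<lambda>t. fst (Z t)"
  fix t assume t: "t \<in> ?I"
  show "?J t \<in> tangent_space (?\<gamma> t)" by (rule variation_field_tangent[OF F t])
next
  let ?I = "{a..b}" and ?J = "variation_field A Z \<zeta>" and ?\<gamma> = "\<lambda>t. fst (Z t)"
  fix d k assume d: "d \<in> \<A>"
  define S where "S = {t \<in> ?I. ?\<gamma> t \<in> cdom d}"
  \<comment> \<open>The linearised equation depends on time through \<open>Z\<close>; coupled with
    the spray it becomes an autonomous smooth system, to which \<open>ode_solution_Ck\<close>
    applies.\<close>
  define f where "f p = (spray d (fst p), dspray d (fst p) (snd p))" for p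
  have S: "t \<in> ?I" "d \<in> charts_at (?\<gamma> t)" if "t \<in> S" for t using that d by (auto simp: S_def charts_at_def)
  have "Ck k S (\<lambda>t. (coords d (Z t), A d t \<zeta>))"
  proof (rule ode_solution_Ck[where U="bundle_dom d \<times> UNIV" and f=f])
    show "Ck k (bundle_dom d \<times> UNIV) f" for k
      unfolding f_def dspray_def
      by (intro Ck_Pair Ck_compose[OF Ck_spray[OF d]] Ck_fst Ck_snd
          Ck_frechet_derivative_apply[OF Ck_spray[OF d] open_bundle_dom[OF d]]) auto
    fix t assume t: "t \<in> S"
    show "(coords d (Z t), A d t \<zeta>) \<in> bundle_dom d \<times> UNIV"
      using coords_in_bundle_dom[of "Z t" d] t by (simp add: S_def)
    have "((\<lambda>t. (coords d (Z t), A d t \<zeta>)) has_vector_derivative f (coords d (Z t), A d t \<zeta>)) (at t within ?I)"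
      unfolding f_def fst_conv snd_conv
      by (rule has_vector_derivative_Pair[OF integral_curve_deriv[OF Z S[OF t]] flow_around_linearized[OF F S[OF t]]])
    then show "((\<lambda>t. (coords d (Z t), A d t \<zeta>)) has_vector_derivative f (coords d (Z t), A d t \<zeta>)) (at t within S)"
      by (rule has_vector_derivative_within_subset) (auto simp: S_def)
  qed
  then have "Ck k S (\<lambda>t. fst (snd (coords d (Z t), A d t \<zeta>)))"
    by (intro Ck_linear_compose[OF bounded_linear_fst] Ck_linear_compose[OF bounded_linear_snd])
  moreover have "?J t d = fst (A d t \<zeta>)" if "t \<in> S" for t
    using S[OF that] by (simp add: variation_field_def)
  ultimately show "Ck k {t \<in> ?I. ?\<gamma> t \<in> cdom d} (\<lambda>t. ?J t d)"
    unfolding S_def[symmetric] by (simp cong: Ck_cong)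
next
  let ?I = "{a..b}" and ?J = "variation_field A Z \<zeta>" and ?\<gamma> = "\<lambda>t. fst (Z t)"
  fix t assume t: "t \<in> ?I"
  have nb: "at s within ?I \<noteq> bot" if "s \<in> ?I" for s by (rule at_within_Icc_nontrivial[OF \<open>a < b\<close> that])
  have vel: "velocity ?I ?\<gamma> s = snd (Z s)" if "s \<in> ?I" for s
    by (rule integral_curve_velocity[OF Z that nb[OF that]])
  have "cov_deriv ?I ?\<gamma> (cov_deriv ?I ?\<gamma> ?J) t d + riemann (?\<gamma> t) (?J t) (velocity ?I ?\<gamma> t) (velocity ?I ?\<gamma> t) d = 0"
    if d: "d \<in> charts_at (?\<gamma> t)" for d
  proof -
    have dA: "d \<in> \<A>" using d charts_atD by blast
    define S where "S = {s \<in> ?I. ?\<gamma> s \<in> cdom d}"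
    have S: "s \<in> ?I" "d \<in> charts_at (?\<gamma> s)" if "s \<in> S" for s using that dA by (auto simp: S_def charts_at_def)
    have tS: "t \<in> S" using t d by (auto simp: S_def dest: charts_atD)
    have at: "at s within S = at s within ?I" if "s \<in> S" for s
      unfolding S_def by (rule at_within_eventually[OF integral_curve_eventually[OF Z S[OF that]]])
    define x where "x s = cmap d (?\<gamma> s)" for s
    define w where "w s = snd (Z s) d" for s
    define J where "J s = fst (A d s \<zeta>)" for s
    define K where "K s = snd (A d s \<zeta>)" for s
    note defs = x_def w_def J_def K_def
    let ?\<Gamma> = "\<lambda>s. christoffel_form d (x s)" and ?d\<Gamma> = "\<lambda>s. dchristoffel_form d (x s)"
    have xd: "x s \<in> cimg d" if "s \<in> S" for s using that by (auto simp: x_def S_def)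
    have dx: "(x has_vector_derivative w s) (at s within S)"
      and dw: "(w has_vector_derivative - ?\<Gamma> s (w s) (w s)) (at s within S)" if "s \<in> S" for s
      using has_vector_derivative_fst[OF integral_curve_deriv[OF Z S[OF that]]]
        has_vector_derivative_snd[OF integral_curve_deriv[OF Z S[OF that]]]
      unfolding at[OF that] by (simp_all add: spray_def coords_def x_def[abs_def] w_def[abs_def])
    have dsp: "dspray d (coords d (Z s)) (A d s \<zeta>) = (K s, - (?d\<Gamma> s (w s) (w s) (J s) + 2 *\<^sub>R ?\<Gamma> s (w s) (K s)))" if "s \<in> S" for s
      using dspray_eq[OF dA coords_in_bundle_dom[of "Z s" d]] that
      by (simp add: S_def) (simp add: coords_def defs)
    have dJ: "(J has_vector_derivative K s) (at s within S)"
      and dK: "(K has_vector_derivative - (?d\<Gamma> s (w s) (w s) (J s) + 2 *\<^sub>R ?\<Gamma> s (w s) (K s))) (at s within S)"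
      if "s \<in> S" for s
      using has_vector_derivative_fst[OF flow_around_linearized[OF F S[OF that], of \<zeta>]]
        has_vector_derivative_snd[OF flow_around_linearized[OF F S[OF that], of \<zeta>]]
      unfolding at[OF that] dsp[OF that] by (simp_all add: J_def[abs_def] K_def[abs_def])
    have Js: "?J s d = J s" if "s \<in> S" for s using S[OF that] by (simp add: variation_field_def J_def)
    have cov: "cov_deriv ?I ?\<gamma> V s d = V' + ?\<Gamma> s (w s) (V s d)"
      if "s \<in> S" "((\<lambda>s. V s d) has_vector_derivative V') (at s within S)" for V V' s
      using vector_derivative_within[OF nb[OF S(1)[OF that(1)]]] that(2) S[OF that(1)]
      by (simp add: at[OF that(1)] cov_deriv_def vel christoffel_form_def x_def w_def)
    \<comment> \<open>\<open>K\<close> alone depends on the chart; with the Christoffel correction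
      it is a component of the covariant derivative and can be differentiated covariantly once
      more.\<close>
    have D1: "cov_deriv ?I ?\<gamma> ?J s d = K s + ?\<Gamma> s (w s) (J s)" if "s \<in> S" for s
    proof -
      have "((\<lambda>s. ?J s d) has_vector_derivative K s) (at s within S)"
        by (rule has_vector_derivative_transform[OF that _ dJ[OF that]]) (simp add: Js)
      from cov[where V="?J", OF that this] show ?thesis by (simp add: Js[OF that])
    qed
    have "((\<lambda>s. ?\<Gamma> s (w s) (J s)) has_vector_derivative
        ?d\<Gamma> t (w t) (J t) (w t) + ?\<Gamma> t (- ?\<Gamma> t (w t) (w t)) (J t) + ?\<Gamma> t (w t) (K t)) (at t within S)"
      using has_derivative_christoffel_form[OF dA tS xd dx[OF tS, unfolded has_vector_derivative_def]
          dw[OF tS, unfolded has_vector_derivative_def] dJ[OF tS, unfolded has_vector_derivative_def]]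
      unfolding has_vector_derivative_def
      by (simp add: linear_scale[OF christoffel_form_linear1] linear_scale[OF christoffel_form_linear2]
          linear_scale[OF dchristoffel_form_linear(1)[OF dA xd[OF tS]]] linear_neg[OF christoffel_form_linear1] algebra_simps)
    note dD = has_vector_derivative_add[OF dK[OF tS] this]
    have "((\<lambda>s. cov_deriv ?I ?\<gamma> ?J s d) has_vector_derivative
        - (?d\<Gamma> t (w t) (w t) (J t) + 2 *\<^sub>R ?\<Gamma> t (w t) (K t)) +
        (?d\<Gamma> t (w t) (J t) (w t) + ?\<Gamma> t (- ?\<Gamma> t (w t) (w t)) (J t) + ?\<Gamma> t (w t) (K t))) (at t within S)"
      by (rule has_vector_derivative_transform[OF tS _ dD]) (simp add: D1)
    from cov[where V="cov_deriv ?I ?\<gamma> ?J", OF tS this]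
    have "cov_deriv ?I ?\<gamma> (cov_deriv ?I ?\<gamma> ?J) t d =
        ?d\<Gamma> t (w t) (J t) (w t) - ?d\<Gamma> t (w t) (w t) (J t) - ?\<Gamma> t (?\<Gamma> t (w t) (w t)) (J t) + ?\<Gamma> t (w t) (?\<Gamma> t (w t) (J t))"
      by (simp add: D1[OF tS] linear_neg[OF christoffel_form_linear1] linear_add[OF christoffel_form_linear2] scaleR_2)
    moreover have "riemann (?\<gamma> t) (?J t) (velocity ?I ?\<gamma> t) (velocity ?I ?\<gamma> t) d =
        ?d\<Gamma> t (w t) (w t) (J t) - ?d\<Gamma> t (J t) (w t) (w t)
        + ?\<Gamma> t (J t) (?\<Gamma> t (w t) (w t)) - ?\<Gamma> t (w t) (?\<Gamma> t (J t) (w t))"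
      using riemann_coeff_form[OF dA xd[OF tS], of "J t" "w t" "w t"] d
      by (simp add: riemann_def vel[OF t] Js[OF tS] x_def w_def)
    \<comment> \<open>The Christoffel form is symmetric at all points, hence so is its derivative in
      these two arguments; this matches the remaining derivative terms, and everything
      cancels.\<close>
    moreover have "?d\<Gamma> t (J t) (w t) (w t) = ?d\<Gamma> t (w t) (J t) (w t)"
    proof -
      have "((\<lambda>y. christoffel_form d y (w t) (J t)) has_derivative ?d\<Gamma> t (J t) (w t)) (at (x t))"
        by (rule has_derivative_transform_within_open[OF christoffel_form_has_derivative[OF dA xd[OF tS]]
              chart_image_open[OF dA] xd[OF tS]]) (rule christoffel_form_sym[OF dA])
      from has_derivative_unique[OF this christoffel_form_has_derivative[OF dA xd[OF tS]]] show ?thesis by metis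
    qed
    ultimately show ?thesis
      using christoffel_form_sym[OF dA xd[OF tS], of "J t"] by simp
  qed
  then show "add_tvec (?\<gamma> t) (cov_deriv ?I ?\<gamma> (cov_deriv ?I ?\<gamma> ?J) t)
      (riemann (?\<gamma> t) (?J t) (velocity ?I ?\<gamma> t) (velocity ?I ?\<gamma> t)) = zero_tvec (?\<gamma> t)"
    unfolding add_tvec_def zero_tvec_def by (intro restrict_ext) simp
qed

text \<open>Speed is conserved, so the squared speed at the start is also that of
  \<open>\<Phi> z\<close> at any time \<open>t\<close>. Differentiating it there gives twice the
  product of the covariant derivative of \<open>J\<close> with the velocity. As the velocity is
  parallel, the product of \<open>J\<close> with the velocity is therefore affine in time with slope
  \<open>h' \<zeta> / 2\<close>.\<close>

lemma first_variation:
  assumes F: "flow_around Z a b c \<delta> \<Phi> A" and "a < b" and Z: "integral_curve {a..b} Z"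
    and h: "((\<lambda>z. speed2 (point_of c z)) has_derivative h') (at (coords c (Z a)))"
  shows "(b - a) * h' \<zeta> = 2 * (g (fst (Z b)) (variation_field A Z \<zeta> b) (snd (Z b))
    - g (fst (Z a)) (variation_field A Z \<zeta> a) (snd (Z a)))"
proof -
  let ?I = "{a..b}" and ?J = "variation_field A Z \<zeta>"
  define p where "p = coords c (Z a)"
  define \<alpha> where "\<alpha> t = g (fst (Z t)) (?J t) (snd (Z t))" for t
  have deriv: "(\<alpha> has_vector_derivative h' \<zeta> / 2) (at t within ?I)" if t: "t \<in> ?I" for t
  proof -
    obtain d where d: "d \<in> charts_at (fst (Z t))" using integral_curve_charts[OF Z t] .
    then have dA: "d \<in> \<A>" and td: "fst (Z t) \<in> cdom d" using charts_atD by auto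
    define S where "S = {s \<in> ?I. fst (Z s) \<in> cdom d}"
    have S: "s \<in> ?I" "d \<in> charts_at (fst (Z s))" if "s \<in> S" for s using that dA by (auto simp: S_def charts_at_def)
    have tS: "t \<in> S" using t td by (simp add: S_def)
    have at: "at t within S = at t within ?I"
      unfolding S_def by (rule at_within_eventually[OF integral_curve_eventually[OF Z t d]])
    define x where "x s = cmap d (fst (Z s))" for s
    define w where "w s = snd (Z s) d" for s
    define J where "J s = fst (A d s \<zeta>)" for s
    define K where "K s = snd (A d s \<zeta>)" for s
    have xd: "x s \<in> cimg d" if "s \<in> S" for s using that by (auto simp: x_def S_def)
    have dx: "(x has_vector_derivative w t) (at t within S)"
      and dw: "(w has_vector_derivative - christoffel_form d (x t) (w t) (w t)) (at t within S)"
      using has_vector_derivative_fst[OF integral_curve_deriv[OF Z t d]]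
        has_vector_derivative_snd[OF integral_curve_deriv[OF Z t d]]
      unfolding at by (simp_all add: spray_def coords_def x_def[abs_def] w_def[abs_def])
    have dJ: "(J has_vector_derivative K t) (at t within S)"
      using has_vector_derivative_fst[OF flow_around_linearized[OF F t d, of \<zeta>]]
        dspray_eq[OF dA coords_in_bundle_dom[of "Z t" d]] td
      unfolding at by (simp add: J_def[abs_def] K_def[abs_def])
    note lin = linear_scale[OF dmetric_in_linear(1)[OF dA xd[OF tS]]]
      linear_scale[OF metric_in_linear1[OF dA xd[OF tS]]]
      linear_scale[OF metric_in_linear2[OF dA xd[OF tS]]] linear_neg[OF metric_in_linear2[OF dA xd[OF tS]]]
    have "((\<lambda>s. metric_in d (x s) (J s) (w s)) has_vector_derivative
        dmetric_in d (x t) (J t) (w t) (w t) + metric_in d (x t) (K t) (w t)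
        - metric_in d (x t) (J t) (christoffel_form d (x t) (w t) (w t))) (at t within S)"
      using has_derivative_metric_in[OF dA tS xd dx[unfolded has_vector_derivative_def]
          dJ[unfolded has_vector_derivative_def] dw[unfolded has_vector_derivative_def]]
      unfolding has_vector_derivative_def by (simp add: lin algebra_simps)
    \<comment> \<open>\<open>koszul\<close> with arguments \<open>w, w, J\<close> replaces the
      Christoffel term; what remains is half the derivative of the squared speed along the
      variation.\<close>
    moreover have "h' \<zeta> / 2 = dmetric_in d (x t) (J t) (w t) (w t) + metric_in d (x t) (K t) (w t)
        - metric_in d (x t) (J t) (christoffel_form d (x t) (w t) (w t))"
    proof -
      obtain \<epsilon> where \<epsilon>: "\<epsilon> > 0" "\<epsilon> \<le> \<delta>" "\<And>z. z \<in> ball p \<epsilon> \<Longrightarrow> fst (\<Phi> z t) \<in> cdom d"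
        using flow_around_near[OF F t d] unfolding p_def by blast
      have pb: "p \<in> ball p \<epsilon>" using \<epsilon>(1) by simp
      have dF: "((\<lambda>z. coords d (\<Phi> z t)) has_derivative A d t) (at p within ball p \<epsilon>)"
        using flow_around_deriv[OF F t d] by (simp add: p_def has_derivative_at_withinI)
      have center: "coords d (\<Phi> p t) = (x t, w t)"
        using flow_around_center[OF F t d] by (simp add: p_def coords_def x_def w_def)
      have "((\<lambda>z. metric_in d (fst (coords d (\<Phi> z t))) (snd (coords d (\<Phi> z t))) (snd (coords d (\<Phi> z t)))) has_derivative
        (\<lambda>\<zeta>. dmetric_in d (x t) (w t) (w t) (fst (A d t \<zeta>)) + metric_in d (x t) (snd (A d t \<zeta>)) (w t)
           + metric_in d (x t) (w t) (snd (A d t \<zeta>)))) (at p within ball p \<epsilon>)"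
        using has_derivative_metric_in[OF dA pb _ has_derivative_fst[OF dF] has_derivative_snd[OF dF] has_derivative_snd[OF dF]]
          \<epsilon>(3) by (simp add: center) (simp add: coords_def)
      then have "((\<lambda>z. metric_in d (fst (coords d (\<Phi> z t))) (snd (coords d (\<Phi> z t))) (snd (coords d (\<Phi> z t)))) has_derivative
        (\<lambda>\<zeta>. dmetric_in d (x t) (w t) (w t) (fst (A d t \<zeta>)) + metric_in d (x t) (snd (A d t \<zeta>)) (w t)
           + metric_in d (x t) (w t) (snd (A d t \<zeta>)))) (at p)"
        by (simp add: at_within_open[OF pb open_ball])
      then have "((\<lambda>z. speed2 (point_of c z)) has_derivative
        (\<lambda>\<zeta>. dmetric_in d (x t) (w t) (w t) (fst (A d t \<zeta>)) + metric_in d (x t) (snd (A d t \<zeta>)) (w t)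
           + metric_in d (x t) (w t) (snd (A d t \<zeta>)))) (at p)"
      proof (rule has_derivative_transform_within_open[OF _ open_ball pb])
        fix z assume z: "z \<in> ball p \<epsilon>"
        then have zb: "z \<in> ball (coords c (Z a)) \<delta>" using \<epsilon>(2) by (auto simp: p_def)
        note \<Phi>z = flow_around_integral_curve[OF F zb]
        have "speed2 (point_of c z) = speed2 (\<Phi> z t)"
          using integral_curve_speed2[OF \<Phi>z(1) t] \<Phi>z(2) by simp
        then show "metric_in d (fst (coords d (\<Phi> z t))) (snd (coords d (\<Phi> z t))) (snd (coords d (\<Phi> z t))) = speed2 (point_of c z)"
          using speed2_coords[OF integral_curve_tangent_bundle[OF \<Phi>z(1) t], of d] \<epsilon>(3)[OF z] dA
          by (simp add: charts_at_def)
      qed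
      from has_derivative_unique[OF h[folded p_def] this]
      have "h' \<zeta> = dmetric_in d (x t) (w t) (w t) (J t) + metric_in d (x t) (K t) (w t) + metric_in d (x t) (w t) (K t)"
        by (simp add: J_def K_def)
      then show ?thesis
        using koszul[OF dA xd[OF tS], of "w t" "w t" "J t"] dmetric_in_sym[OF dA xd[OF tS], of "w t" "J t"]
          metric_in_sym[OF dA xd[OF tS], of "w t" "K t"]
          metric_in_sym[OF dA xd[OF tS], of "J t" "christoffel_form d (x t) (w t) (w t)"]
        by simp
    qed
    ultimately have "((\<lambda>s. metric_in d (x s) (J s) (w s)) has_vector_derivative h' \<zeta> / 2) (at t within S)" by (simp only:)
    then have "(\<alpha> has_vector_derivative h' \<zeta> / 2) (at t within S)"
    proof (rule has_vector_derivative_transform[OF tS, rotated])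
      fix s assume s: "s \<in> S"
      show "\<alpha> s = metric_in d (x s) (J s) (w s)"
        using metric_in_coords[OF S(2)[OF s] variation_field_tangent[OF F S(1)[OF s]], of "snd (Z s)" \<zeta>]
          tangent_bundleD[OF integral_curve_tangent_bundle[OF Z S(1)[OF s]]] S[OF s]
        by (simp add: \<alpha>_def x_def w_def J_def variation_field_def)
    qed
    then show ?thesis unfolding at .
  qed
  have "((\<lambda>t. \<alpha> t - t * (h' \<zeta> / 2)) has_vector_derivative h' \<zeta> / 2 - h' \<zeta> / 2) (at t within ?I)"
    if "t \<in> ?I" for t
    by (rule has_vector_derivative_diff[OF deriv[OF that]])
      (auto intro!: derivative_eq_intros simp flip: has_real_derivative_iff_has_vector_derivative)
  then obtain k where k: "\<And>t. t \<in> ?I \<Longrightarrow> \<alpha> t - t * (h' \<zeta> / 2) = k"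
    using has_vector_derivative_zero_constant[OF convex_real_interval(5)[of a b], of "\<lambda>t. \<alpha> t - t * (h' \<zeta> / 2)"]
    by (metis diff_self)
  have "\<alpha> b - b * (h' \<zeta> / 2) = \<alpha> a - a * (h' \<zeta> / 2)" using k[of a] k[of b] \<open>a < b\<close> by simp
  then show ?thesis by (simp add: \<alpha>_def field_simps)
qed

end

section \<open>Locally extremal geodesic loops\<close>

context riemannian_manifold
begin

text \<open>At time 0 the flow, read in the chart \<open>c\<close>, is the identity.\<close>

lemma variation_field_start:
  assumes F: "flow_around Z 0 l c \<delta> \<Phi> A" and "0 < l" and c: "c \<in> charts_at (fst (Z 0))"
  shows "A c 0 \<zeta> = \<zeta>"
proof -
  have 0: "0 \<in> {0..l}" using \<open>0 < l\<close> by auto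
  have "((\<lambda>z. coords c (\<Phi> z 0)) has_derivative (\<lambda>\<zeta>. \<zeta>)) (at (coords c (Z 0)))"
  proof (rule has_derivative_transform_within_open[OF has_derivative_ident open_ball])
    show "coords c (Z 0) \<in> ball (coords c (Z 0)) \<delta>" using F by (simp add: flow_around_def)
    show "z = coords c (\<Phi> z 0)" if "z \<in> ball (coords c (Z 0)) \<delta>" for z
      using flow_around_integral_curve(2,3)[OF F that] coords_point_of_self charts_atD[OF c] by simp
  qed
  from has_derivative_unique[OF flow_around_deriv[OF F 0 c] this] show ?thesis by metis
qed

text \<open>Here conjugacy enters: a variation that fixes the initial point and does not move the
  end point to first order is a Jacobi field vanishing at both ends. It is nontrivial because its
  coordinate derivative at time 0 is \<omega>.\<close>

lemma variation_field_endpoint_injective: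
  assumes F: "flow_around Z 0 l c \<delta> \<Phi> A" and "0 < l" and Z: "integral_curve {0..l} Z"
    and c: "c \<in> charts_at (fst (Z 0))" and loop: "fst (Z 0) = fst (Z l)"
    and nsc: "\<not> self_conjugate (\<lambda>t. fst (Z t)) l" and 0: "fst (A c l (0, \<omega>)) = 0"
  shows "\<omega> = 0"
proof (rule ccontr)
  assume "\<omega> \<noteq> 0"
  let ?J = "variation_field A Z (0, \<omega>)"
  have ends: "0 \<in> {0..l}" "l \<in> {0..l}" using \<open>0 < l\<close> by auto
  have cl: "c \<in> charts_at (fst (Z l))" using c loop by simp
  have A0: "A c 0 \<zeta> = \<zeta>" for \<zeta> by (rule variation_field_start[OF F \<open>0 < l\<close> c])
  have "?J 0 = zero_tvec (fst (Z 0))"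
    by (rule tangent_eqI[OF variation_field_tangent[OF F ends(1)] zero_tvec_tangent[OF c] c])
      (use c A0 in \<open>simp add: variation_field_def zero_tvec_def\<close>)
  moreover have "?J l = zero_tvec (fst (Z l))"
    by (rule tangent_eqI[OF variation_field_tangent[OF F ends(2)] zero_tvec_tangent[OF cl] cl])
      (use cl 0 in \<open>simp add: variation_field_def zero_tvec_def\<close>)
  moreover have "\<exists>t\<in>{0..l}. ?J t \<noteq> zero_tvec (fst (Z t))"
  proof (rule ccontr)
    assume "\<not> ?thesis"
    then have J0: "?J t = zero_tvec (fst (Z t))" if "t \<in> {0..l}" for t using that by blast
    have "\<forall>\<^sub>F s in at 0 within {0..l}. s \<in> {0..l}" by (simp add: eventually_at_filter)
    with integral_curve_eventually[OF Z ends(1) c] have "\<forall>\<^sub>F s in at 0 within {0..l}. 0 = fst (A c s (0, \<omega>))"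
    proof eventually_elim
      case (elim s)
      then have "c \<in> charts_at (fst (Z s))" using charts_atD[OF c] by (simp add: charts_at_def)
      moreover have "?J s c = zero_tvec (fst (Z s)) c" using J0[OF elim(2)] by (rule arg_cong)
      ultimately show ?case by (simp add: variation_field_def zero_tvec_def)
    qed
    then have "((\<lambda>s. fst (A c s (0, \<omega>))) has_vector_derivative 0) (at 0 within {0..l})"
      by (rule has_vector_derivative_transform_eventually[OF has_vector_derivative_const]) (use A0 ends in auto)
    \<comment> \<open>The position half of the linearised equation at time 0 has the velocity half
      of the initial value, here \<omega>, as its right-hand side.\<close>
    moreover have "((\<lambda>s. fst (A c s (0, \<omega>))) has_vector_derivative \<omega>) (at 0 within {0..l})"
      using has_vector_derivative_fst[OF flow_around_linearized[OF F ends(1) c, of "(0, \<omega>)"]]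
        dspray_eq[of c "coords c (Z 0)"] coords_in_bundle_dom[of "Z 0" c] charts_atD[OF c] A0 by simp
    ultimately show False
      using vector_derivative_unique_within[OF at_within_Icc_nontrivial[OF \<open>0 < l\<close> ends(1)]] \<open>\<omega> \<noteq> 0\<close> by blast
  qed
  ultimately have "self_conjugate (\<lambda>t. fst (Z t)) l"
    unfolding self_conjugate_def using variation_field_jacobi[OF F \<open>0 < l\<close> Z] by blast
  then show False using nsc by contradiction
qed

text \<open>Dividing the velocity by \<open>r\<close> and stretching time by \<open>r\<close> yields
  unit speed, so a loop of speed \<open>r\<close> on \<open>{0..l}\<close> becomes one of length
  \<open>l * r\<close>. Its initial vector is the normalised one, and closeness to the given loop
  must be tested there.\<close>

lemma nearby_loop:
  assumes F: "flow_around Z 0 l c \<delta> \<Phi> A" and "0 < l" and c: "c \<in> \<A>"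
    and z: "z \<in> ball (coords c (Z 0)) \<delta>" "fst (\<Phi> z l) \<in> cdom c" "fst (coords c (\<Phi> z l)) = fst z"
    and "speed2 (point_of c z) = r\<^sup>2" "r > 0"
  shows "\<exists>\<gamma>'. geodesic_loop \<gamma>' (l * r) \<and> curve_length \<gamma>' (l * r) = l * r \<and>
    (\<gamma>' 0, velocity {0..l * r} \<gamma>' 0) = point_of c (fst z, (1 / r) *\<^sub>R snd z)"
proof -
  note \<Phi>z = flow_around_integral_curve[OF F z(1)]
  have 0: "0 \<in> {0..l}" using \<open>0 < l\<close> by simp
  define p where "p = fst (point_of c z)"
  have p: "p = cinv c (fst z)" by (simp add: p_def point_of_def)
  have xz: "fst z \<in> cimg c" using \<Phi>z(3) by (auto simp: bundle_dom_def)
  have cp: "c \<in> charts_at p" unfolding p by (rule cinv_charts_at[OF c xz])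
  have TB: "point_of c z \<in> tangent_bundle" by (rule point_of_tangent_bundle[OF c \<Phi>z(3)])
  then have v: "snd (point_of c z) \<in> tangent_space p" using tangent_bundleD by (simp add: p_def)
  have top: "p \<in> topspace X" using tangent_bundleD[OF TB] by (simp add: p_def)
  define W where "W t = (fst (\<Phi> z (t / r)), scale_tvec (fst (\<Phi> z (t / r))) (1 / r) (snd (\<Phi> z (t / r))))" for t
  have W: "integral_curve {0..l * r} W"
    unfolding W_def by (rule integral_curve_rescale[OF \<Phi>z(1) \<open>r > 0\<close>])
  have comp: "snd (point_of c z) c = snd z"
    unfolding point_of_def by (simp add: tvec_of_self[OF c cinv_in[OF xz]])
  have W0: "W 0 = point_of c (fst z, (1 / r) *\<^sub>R snd z)"
    using scale_tvec_tangent[OF cp v, of "1 / r"] comp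
    by (simp add: W_def \<Phi>z(2) p_def[symmetric]) (simp add: point_of_def p)
  have sc: "scale_tvec p (1 / r) (snd (point_of c z)) \<in> tangent_space p"
    unfolding scale_tvec_tangent[OF cp v] using cp charts_atD by (intro tvec_of_tangent) auto
  have "speed2 (W 0) = (1 / r) * ((1 / r) * speed2 (point_of c z))"
    unfolding speed2_def W_def using metric_scale[OF top v sc, of "1 / r"] metric_scale[OF top v v, of "1 / r"] metric_sym[OF top v sc]
    by (simp add: \<Phi>z(2) p_def[symmetric])
  also have "\<dots> = 1" using assms(7,8) by (simp add: power2_eq_square)
  finally have unit: "speed2 (W 0) = 1" .
  have "fst (\<Phi> z l) = p"
    using cinv_cmap[OF c z(2)] z(3) by (simp add: p coords_def)
  then have "fst (W 0) = fst (W (l * r))" using \<open>r > 0\<close> by (simp add: W_def \<Phi>z(2) p_def)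
  from integral_curve_loop[OF W _ unit this] \<open>0 < l\<close> \<open>r > 0\<close> W0 show ?thesis
    by (intro exI[of _ "\<lambda>t. fst (W t)"]) (simp add: prod_eq_iff)
qed

text \<open>If the end velocities differ, the endpoint condition and the speed are jointly a submersion at the
  given loop, so nearby initial vectors give both longer and shorter loops.\<close>

lemma longer_and_shorter_loops:
  assumes loop: "geodesic_loop \<gamma> l" and nsc: "\<not> self_conjugate \<gamma> l"
    and ne: "velocity {0..l} \<gamma> 0 \<noteq> velocity {0..l} \<gamma> l"
    and W: "openin tangent_bundle_topology W" "(\<gamma> 0, velocity {0..l} \<gamma> 0) \<in> W"
  shows "\<exists>\<gamma>\<^sub>1 l\<^sub>1 \<gamma>\<^sub>2 l\<^sub>2. geodesic_loop \<gamma>\<^sub>1 l\<^sub>1 \<and> (\<gamma>\<^sub>1 0, velocity {0..l\<^sub>1} \<gamma>\<^sub>1 0) \<in> W \<and> curve_length \<gamma>\<^sub>1 l\<^sub>1 < curve_length \<gamma> l \<and>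
    geodesic_loop \<gamma>\<^sub>2 l\<^sub>2 \<and> (\<gamma>\<^sub>2 0, velocity {0..l\<^sub>2} \<gamma>\<^sub>2 0) \<in> W \<and> curve_length \<gamma> l < curve_length \<gamma>\<^sub>2 l\<^sub>2"
proof -
  define Z where "Z t = (\<gamma> t, velocity {0..l} \<gamma> t)" for t
  have l: "l > 0" and closed: "\<gamma> 0 = \<gamma> l" using loop by (auto simp: geodesic_loop_def)
  have ends: "0 \<in> {0..l}" "l \<in> {0..l}" using l by auto
  have Z: "integral_curve {0..l} Z" unfolding Z_def by (rule geodesic_loop_integral_curve(1)[OF loop])
  have unit: "speed2 (Z 0) = 1"
    unfolding Z_def by (rule geodesic_loop_integral_curve(2)[OF loop ends(1)])
  have fstZ: "(\<lambda>t. fst (Z t)) = \<gamma>" by (simp add: Z_def)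
  have closedZ: "fst (Z 0) = fst (Z l)" using closed by (simp add: Z_def)
  have len: "curve_length \<gamma> l = l"
    using integral_curve_loop(2)[OF Z l unit closedZ] unfolding fstZ .
  obtain c where c: "c \<in> charts_at (fst (Z 0))" using integral_curve_charts[OF Z ends(1)] .
  then have cA: "c \<in> \<A>" and c0: "fst (Z 0) \<in> cdom c" and cl: "c \<in> charts_at (fst (Z l))"
    using charts_atD closedZ by auto
  obtain \<delta> \<Phi> A where F: "flow_around Z 0 l c \<delta> \<Phi> A" using flow_around_exists[OF l Z c] by blast
  define p where "p = coords c (Z 0)"
  define S where "S z = coords c (\<Phi> z l)" for z
  define h where "h z = speed2 (point_of c z)" for z
  have TB: "Z t \<in> tangent_bundle" if "t \<in> {0..l}" for t by (rule integral_curve_tangent_bundle[OF Z that])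
  have pdom: "p \<in> bundle_dom c" unfolding p_def by (rule coords_in_bundle_dom[OF c0])
  have xp: "fst p \<in> cimg c" using pdom by (auto simp: bundle_dom_def)
  have hp: "h p = 1" unfolding h_def p_def point_of_coords[OF TB[OF ends(1)] c] by (rule unit)
  have hm: "h z = metric_in c (fst z) (snd z) (snd z)" if "z \<in> bundle_dom c" for z
    unfolding h_def
    using speed2_coords[OF point_of_tangent_bundle[OF cA that], of c] fst_point_of[OF that] cA
    by (simp add: charts_at_def coords_point_of_self[OF cA that])
  obtain \<epsilon> where \<epsilon>: "\<epsilon> > 0" "\<epsilon> \<le> \<delta>" "\<And>z. z \<in> ball p \<epsilon> \<Longrightarrow> fst (\<Phi> z l) \<in> cdom c" "continuous_on (ball p \<epsilon>) S"
    using flow_around_near[OF F ends(2) cl] unfolding p_def S_def by blast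
  have dom: "z \<in> bundle_dom c" if "z \<in> ball p \<epsilon>" for z
    using flow_around_integral_curve(3)[OF F, of z] that \<epsilon>(2) by (auto simp: p_def)
  have dS: "(S has_derivative A c l) (at p)"
    unfolding S_def p_def by (rule flow_around_deriv[OF F ends(2) cl])
  have Sp: "S p = coords c (Z l)" unfolding S_def p_def using flow_around_center[OF F ends(2) cl] by simp
  have dh: "\<exists>h'. (h has_derivative h') (at z)" if z: "z \<in> bundle_dom c" for z
  proof -
    have fs: "(fst has_derivative fst) (at z within bundle_dom c)" "(snd has_derivative snd) (at z within bundle_dom c)"
      by (intro bounded_linear_imp_has_derivative bounded_linear_fst bounded_linear_snd)+
    have "\<exists>h'. ((\<lambda>z. metric_in c (fst z) (snd z) (snd z)) has_derivative h') (at z within bundle_dom c)"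
      using has_derivative_metric_in[OF cA z _ fs fs(2)] by (auto simp: bundle_dom_def)
    then obtain h' where "((\<lambda>z. metric_in c (fst z) (snd z) (snd z)) has_derivative h') (at z)"
      unfolding at_within_open[OF z open_bundle_dom[OF cA]] by blast
    then have "(h has_derivative h') (at z)"
      by (rule has_derivative_transform_within_open[OF _ open_bundle_dom[OF cA] z]) (simp add: hm)
    then show ?thesis by blast
  qed
  obtain h' where h': "(h has_derivative h') (at p)" using dh[OF pdom] by blast
  have hcont: "continuous_on (ball p \<epsilon>) h"
    using dh[OF dom] has_derivative_continuous continuous_at_imp_continuous_on by blast
  \<comment> \<open>Zeros of the first component are initial vectors whose geodesics close up at
    time \<open>l\<close>; the second component prescribes the squared speed and with it the
    length.\<close>
  define M where "M z = (fst (S z) - fst z, h z)" for z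
  define M' where "M' \<zeta> = (fst (A c l \<zeta>) - fst \<zeta>, h' \<zeta>)" for \<zeta>
  have dM: "(M has_derivative M') (at p)"
    unfolding M_def M'_def
    by (intro has_derivative_Pair has_derivative_diff has_derivative_fst dS h' has_derivative_ident)
  have Mcont: "continuous_on (ball p \<epsilon>) M"
    unfolding M_def by (intro continuous_intros \<epsilon>(4) hcont)
  have Mp: "M p = (0, 1)"
    using closedZ by (simp add: M_def Sp hp) (simp add: p_def coords_def)
  have linA: "linear (A c l)" using dS has_derivative_linear by blast
  have linM: "linear M'" using dM has_derivative_linear by blast
  \<comment> \<open>Derivative of the end point in the initial velocity at fixed initial point, that
    is, the differential of \<open>v \<mapsto> exp (l v)\<close> for the exponential map. It is
    injective as there is no conjugacy, hence surjective by equality of dimensions.\<close>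
  define L where "L \<omega> = fst (A c l (0, \<omega>))" for \<omega>
  have linL: "linear L"
    unfolding L_def
    by (rule linearI) (use linear_add[OF linA, of "(0, _)" "(0, _)"] linear_scale[OF linA, of _ "(0, _)"] in auto)
  have "inj L"
    unfolding linear_injective_0[OF linL] L_def
    using variation_field_endpoint_injective[OF F l Z c closedZ] nsc unfolding fstZ by blast
  then have surjL: "\<exists>\<omega>. L \<omega> = u" for u
    using linear_injective_imp_surjective[OF linL] by (metis surjD)
  \<comment> \<open>The end velocities sit at the same point because the loop closes up, so their
    components in \<open>c\<close> may be subtracted.\<close>
  define u where "u = velocity {0..l} \<gamma> l c - velocity {0..l} \<gamma> 0 c"
  have "u \<noteq> 0"
  proof
    assume "u = 0"
    then have "snd (Z 0) = snd (Z l)"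
      using tangent_bundleD[OF TB[OF ends(1)]] tangent_bundleD[OF TB[OF ends(2)]] closedZ c
      by (intro tangent_eqI[of _ "fst (Z 0)" _ c]) (auto simp: u_def Z_def)
    then show False using ne by (simp add: Z_def)
  qed
  \<comment> \<open>Corrects the initial velocity so that the variation field starting with value
    \<open>u\<close> also ends with value \<open>u\<close>.\<close>
  obtain \<omega> where \<omega>: "L \<omega> = u - fst (A c l (u, 0))" using surjL by blast
  define \<zeta> where "\<zeta> = (u, \<omega>)"
  have A\<zeta>: "fst (A c l \<zeta>) = u"
    using linear_add[OF linA, of "(u, 0)" "(0, \<omega>)"] \<omega> by (simp add: \<zeta>_def L_def)
  \<comment> \<open>With the value \<open>u\<close> at both ends, the boundary terms of the first
    variation combine to the product of \<open>u\<close> with the difference of the end velocities,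
    which is \<open>u\<close> itself.\<close>
  have "l * h' \<zeta> = 2 * metric_in c (fst p) u u"
  proof -
    have J0: "variation_field A Z \<zeta> 0 c = u"
      using c variation_field_start[OF F l c, of \<zeta>] by (simp add: variation_field_def \<zeta>_def)
    have Jl: "variation_field A Z \<zeta> l c = u"
      using cl A\<zeta> by (simp add: variation_field_def)
    have "l * h' \<zeta> = 2 * (g (fst (Z l)) (variation_field A Z \<zeta> l) (snd (Z l))
        - g (fst (Z 0)) (variation_field A Z \<zeta> 0) (snd (Z 0)))"
      using first_variation[OF F l Z, of h' \<zeta>] h' unfolding h_def p_def by simp
    also have "\<dots> = 2 * (metric_in c (fst p) u (snd (Z l) c) - metric_in c (fst p) u (snd (Z 0) c))"
      using metric_in_coords[OF cl variation_field_tangent[OF F ends(2)]]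
        metric_in_coords[OF c variation_field_tangent[OF F ends(1)]] tangent_bundleD[OF TB[OF ends(1)]]
        tangent_bundleD[OF TB[OF ends(2)]] closedZ
      by (simp add: J0 Jl p_def coords_def)
    also have "\<dots> = 2 * metric_in c (fst p) u u"
      using linear_diff[OF metric_in_linear2[OF cA xp], of u "snd (Z l) c" "snd (Z 0) c"] by (simp add: u_def Z_def)
    finally show ?thesis .
  qed
  then have h\<zeta>: "h' \<zeta> \<noteq> 0" using metric_in_pos[OF cA xp \<open>u \<noteq> 0\<close>] by auto
  have "surj M'"
    unfolding surj_def
  proof
    fix y :: "(real^'n) \<times> real"
    obtain \<omega>' where \<omega>': "L \<omega>' = fst y" using surjL by blast
    \<comment> \<open>\<open>M' \<zeta>\<close> has vanishing displacement and nonzero speed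
      component, so a multiple of \<zeta> adjusts the speed without disturbing the displacement
      already reached by \<open>\<omega>'\<close>.\<close>
    define k where "k = (snd y - h' (0, \<omega>')) / h' \<zeta>"
    have "M' ((0, \<omega>') + k *\<^sub>R \<zeta>) = M' (0, \<omega>') + k *\<^sub>R M' \<zeta>"
      by (simp only: linear_add[OF linM] linear_scale[OF linM])
    also have "\<dots> = y"
      using \<omega>' h\<zeta> A\<zeta> by (simp add: M'_def L_def[symmetric] k_def \<zeta>_def prod_eq_iff)
    finally show "\<exists>x. y = M' x" by metis
  qed
  then obtain G where G: "linear G" "M' \<circ> G = id"
    using linear_surjective_right_inverse[OF linM] by blast
  \<comment> \<open>Initial vector after normalisation to unit speed. This vector, not
    \<open>z\<close>, has to lie in \<open>W\<close>; as \<open>N\<close> is continuous and fixes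
    \<open>p\<close>, a small ball suffices.\<close>
  define N where "N z = (fst z, (1 / sqrt (h z)) *\<^sub>R snd z)" for z
  define V where "V = {z \<in> bundle_dom c. point_of c z \<in> W}"
  have V: "open V"
  proof -
    have "V = {(x, w). x \<in> cimg c \<and> (cinv c x, tvec_of c (cinv c x) w) \<in> W}"
      by (auto simp: V_def bundle_dom_def point_of_def)
    then show ?thesis using W(1) cA unfolding openin_tangent_bundle_topology by simp
  qed
  have Np: "N p = p" by (simp add: N_def hp)
  have "p \<in> V"
    using pdom W(2) point_of_coords[OF TB[OF ends(1)] c] by (simp add: V_def p_def) (simp add: Z_def)
  have "\<exists>\<epsilon>'>0. \<epsilon>' \<le> \<epsilon> \<and> (\<forall>z\<in>ball p \<epsilon>'. h z > 0 \<and> N z \<in> V)"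
  proof -
    define H where "H = ball p \<epsilon> \<inter> h -` {0<..}"
    have H: "open H"
      unfolding H_def by (rule continuous_open_preimage[OF hcont open_ball open_greaterThan])
    have "continuous_on H h" by (rule continuous_on_subset[OF hcont]) (auto simp: H_def)
    then have "continuous_on H N"
      unfolding N_def by (intro continuous_intros) (auto simp: H_def)
    then have "open (H \<inter> N -` V)" by (rule continuous_open_preimage[OF _ H V])
    moreover have "p \<in> H \<inter> N -` V" using \<epsilon>(1) hp Np \<open>p \<in> V\<close> by (simp add: H_def)
    ultimately obtain e where "e > 0" "ball p e \<subseteq> H \<inter> N -` V" using open_contains_ball by metis
    then show ?thesis using \<epsilon>(1) by (intro exI[of _ "min e \<epsilon>"]) (auto simp: H_def)
  qed
  then obtain \<epsilon>' where \<epsilon>': "\<epsilon>' > 0" "\<epsilon>' \<le> \<epsilon>" "\<And>z. z \<in> ball p \<epsilon>' \<Longrightarrow> h z > 0 \<and> N z \<in> V" by blast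
  \<comment> \<open>Sussmann's open mapping theorem needs continuity nearby and a derivative with
    right inverse at the single point \<open>p\<close>, which is just what the flow
    provides.\<close>
  have "M p \<in> interior (M ` ball p \<epsilon>')"
    by (rule sussmann_open_mapping[OF open_ball Mcont _ dM linear_conv_bounded_linear[THEN iffD1, OF G(1)] G(2)])
      (use \<epsilon>(1) \<epsilon>' in auto)
  then obtain \<eta> where \<eta>: "\<eta> > 0" "ball (0, 1) \<eta> \<subseteq> M ` ball p \<epsilon>'"
    unfolding mem_interior Mp by blast
  \<comment> \<open>The value \<open>(0, s)\<close> of \<open>M\<close> encodes a closed-up geodesic
    of squared speed \<open>s\<close>; values of \<open>s\<close> on either side of 1 give the
    shorter and the longer loop.\<close>
  have loops: "\<exists>\<gamma>' l'. geodesic_loop \<gamma>' l' \<and> (\<gamma>' 0, velocity {0..l'} \<gamma>' 0) \<in> W \<and> curve_length \<gamma>' l' = l * sqrt s"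
    if s: "\<bar>s - 1\<bar> < \<eta>" for s
  proof -
    have "(0, s) \<in> ball (0, 1) \<eta>" using s by (simp add: dist_Pair_Pair dist_real_def abs_minus_commute)
    then obtain z where z: "z \<in> ball p \<epsilon>'" "M z = (0, s)" using \<eta>(2) by (metis imageE subsetD)
    have zb: "z \<in> ball p \<epsilon>" using z(1) \<epsilon>'(2) by auto
    have zd: "z \<in> ball (coords c (Z 0)) \<delta>" using zb \<epsilon>(2) by (auto simp: p_def)
    have "h z = s" "fst (S z) = fst z" using z(2) by (simp_all add: M_def)
    moreover have "h z > 0" "N z \<in> V" using \<epsilon>'(3)[OF z(1)] by auto
    ultimately obtain \<gamma>' where "geodesic_loop \<gamma>' (l * sqrt s)" "curve_length \<gamma>' (l * sqrt s) = l * sqrt s"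
      "(\<gamma>' 0, velocity {0..l * sqrt s} \<gamma>' 0) = point_of c (N z)"
      using nearby_loop[OF F l cA zd \<epsilon>(3)[OF zb], of "sqrt s"] unfolding S_def h_def N_def by auto
    with \<open>N z \<in> V\<close> show ?thesis
      by (intro exI[of _ \<gamma>'] exI[of _ "l * sqrt s"]) (simp add: V_def)
  qed
  define e where "e = min (\<eta> / 2) (1 / 2)"
  have e: "0 < e" "e < 1" "e < \<eta>" using \<eta>(1) by (auto simp: e_def)
  have "l * sqrt (1 - e) < l" "l < l * sqrt (1 + e)" using l e by auto
  then show ?thesis
    using loops[of "1 - e"] loops[of "1 + e"] e len by (simp add: abs_if) metis
qed

end

theorem theorem1p1:
  fixes X :: "'a topology" and \<A> :: "('a, 'n::finite) chart set"
    and g :: "'a \<Rightarrow> ('a, 'n) tvec \<Rightarrow> ('a, 'n) tvec \<Rightarrow> real"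
    and \<gamma> :: "real \<Rightarrow> 'a" and l :: real
  assumes "riemannian_manifold X \<A> g"
    and "riemannian_manifold.geodesic_loop X \<A> g \<gamma> l"
    and "riemannian_manifold.locally_extremal X \<A> g \<gamma> l"
    and "\<not> riemannian_manifold.self_conjugate \<A> g \<gamma> l"
  shows "riemannian_manifold.closed_geodesic X \<A> g \<gamma> l"
proof -
  interpret riemannian_manifold X \<A> g by fact
  have "velocity {0..l} \<gamma> 0 = velocity {0..l} \<gamma> l"
  proof (rule ccontr)
    assume ne: "velocity {0..l} \<gamma> 0 \<noteq> velocity {0..l} \<gamma> l"
    obtain W where W: "openin tangent_bundle_topology W" "(\<gamma> 0, velocity {0..l} \<gamma> 0) \<in> W"
      and "(\<forall>\<gamma>' l'. geodesic_loop \<gamma>' l' \<and> (\<gamma>' 0, velocity {0..l'} \<gamma>' 0) \<in> W \<longrightarrow> curve_length \<gamma> l \<le> curve_length \<gamma>' l') \<or>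
        (\<forall>\<gamma>' l'. geodesic_loop \<gamma>' l' \<and> (\<gamma>' 0, velocity {0..l'} \<gamma>' 0) \<in> W \<longrightarrow> curve_length \<gamma> l \<ge> curve_length \<gamma>' l')"
      using assms(3) unfolding locally_extremal_def locally_minimizing_def locally_maximizing_def by blast
    then show False
      using longer_and_shorter_loops[OF assms(2,4) ne W] by (meson not_le)
  qed
  then show ?thesis using assms(2) by (simp add: closed_geodesic_def)
qed

end
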